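(* Let $X$ be a two-sided shift space on a finite alphabet with the specification property, and let $\varphi\colon X\to\mathbb{R}$ be a continuous potential function with the Walters property. Then the unique equilibrium measure $\mu$ for $(X,\varphi)$ has local product structure.
   Context: Let $A$ be a finite set and $\sigma\colon A^{\mathbb Z}\to A^{\mathbb Z}$ the shift $(\sigma x)_n=x_{n+1}$; $A^{\mathbb Z}$ has the metric $d(x,y)=2^{-\min\{|n|:x_n\ne y_n\}}$. A two-sided shift space is a (nonempty) closed $\sigma$-invariant set $X\subset A^{\mathbb Z}$. Write $x_{[i,j)}=x_i\cdots x_{j-1}$, and similarly for other intervals. For $w\in A^n$ let $[w]^+=\{x\in X: x_{[0,n)}=w\}$; $\mathcal L_n=\{w\in A^n:[w]^+\neq\emptyset\}$, $\mathcal L=\bigcup_{n\ge0}\mathcal L_n$. Specification property: there is $t\in\mathbb N$ such that for all $v,w\in\mathcal L$ there is $u\in\mathcal L_t$ with $vuw\in\mathcal L$. Walters property: with $S_n\varphi(x)=\sum_{k=0}^{n-1}\varphi(\sigma^kx)$, for every $\epsilon>0$ there is $k\in\mathbb N$ such that for all $n\in\mathbb N$ and $x,y\in X$ with $x_{[-k,n+k)}=y_{[-k,n+k)}$ we have $|S_n\varphi(x)-S_n\varphi(y)|\le\epsilon$. An equilibrium measure for $(X,\varphi)$ is a $\sigma$-invariant Borel probability measure $\mu$ on $X$ maximizing $h(\mu)+\int\varphi\,d\mu$ among all such measures, where $h$ is measure-theoretic entropy. (Under the hypotheses of the claim, a unique equilibrium measure exists by a known theorem of Bowen.) Bracket: for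 $x,y\in X$ with $x_0=y_0$, $[x,y]$ is the sequence with $[x,y]_n=x_n$ for $n\le0$ and $[x,y]_n=y_n$ for $n\ge0$; it is defined if it lies in $X$. A set $R\subset X$ is a rectangle (has product structure) if for all $x,y\in R$ the bracket $[x,y]$ is defined and lies in $R$. For $q\in R$ let $W^{\mathrm u}_R(q)=\{x\in R:x_n=q_n\ \forall n\le0\}$, $W^{\mathrm s}_R(q)=\{x\in R:x_n=q_n\ \forall n\ge0\}$, and let $\iota_q\colon W^{\mathrm u}_R(q)\times W^{\mathrm s}_R(q)\to R$ be the bijection $\iota_q(x,y)=[y,x]$. A measure $m$ on $R$ is a product measure if $m=(\iota_q)_*(m^{\mathrm u}_q\times m^{\mathrm s}_q)$ for some $\sigma$-finite Borel measures $m^{\mathrm u}_q$ on $W^{\mathrm u}_R(q)$ and $m^{\mathrm s}_q$ on $W^{\mathrm s}_R(q)$. A probability measure $\mu$ on $X$ has local product structure if there exist a sequence of product measures $m_n$ on rectangles $R_n$ such that $\mu|_{R_n}\ll m_n$ for every $n\in\mathbb N$ and $\mu(\bigcup_{n}R_n)=1$. *)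

theory Defs
  imports "HOL-Probability.Probability"
begin

section \<open>Two-sided shift spaces\<close>

text \<open>The finite alphabet is a type of class \<open>finite\<close>.\<close>

definition shift :: "(int \<Rightarrow> 'a) \<Rightarrow> (int \<Rightarrow> 'a)" where
  "shift x = (\<lambda>n. x (n + 1))"

definition shift_dist :: "(int \<Rightarrow> 'a) \<Rightarrow> (int \<Rightarrow> 'a) \<Rightarrow> real" where
  "shift_dist x y =
     (if x = y then 0 else (1/2) ^ (LEAST k. \<exists>n. nat \<bar>n\<bar> = k \<and> x n \<noteq> y n))"

lemma shift_dist_less_iff:
  "shift_dist x y < (1/2) ^ k \<longleftrightarrow> (\<forall>n. nat \<bar>n\<bar> \<le> k \<longrightarrow> x n = y n)"
proof (cases "x = y")
  case True
  then show ?thesis by (simp add: shift_dist_def)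
next
  case False
  define P where "P j \<longleftrightarrow> (\<exists>n. nat \<bar>n\<bar> = j \<and> x n \<noteq> y n)" for j
  obtain n0 where "x n0 \<noteq> y n0" using False by auto
  then have P: "P (LEAST j. P j)"
    by (intro LeastI[of P "nat \<bar>n0\<bar>"]) (auto simp: P_def)
  have "shift_dist x y < (1/2) ^ k \<longleftrightarrow> k < (LEAST j. P j)"
    using False by (auto simp: shift_dist_def P_def power_strict_decreasing_iff)
  also have "\<dots> \<longleftrightarrow> (\<forall>j\<le>k. \<not> P j)"
    using P by (metis Least_le le_less_trans not_le not_less_Least)
  finally show ?thesis by (auto simp: P_def)
qed

lemma Metric_space_shift_dist: "Metric_space UNIV (shift_dist :: (int \<Rightarrow> 'a) \<Rightarrow> _)"
proof
  fix x y z :: "int \<Rightarrow> 'a"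
  show "0 \<le> shift_dist x y" by (simp add: shift_dist_def)
  show "shift_dist x y = shift_dist y x"
    unfolding shift_dist_def by (simp only: eq_commute[of x y] eq_commute[of "x _" "y _"])
  show "shift_dist x y = 0 \<longleftrightarrow> x = y" by (simp add: shift_dist_def)
  show "shift_dist x z \<le> shift_dist x y + shift_dist y z"
  proof (cases "x = z")
    case False
    then obtain k where k: "shift_dist x z = (1/2) ^ k"
      by (simp add: shift_dist_def)
    then have "\<not> shift_dist x z < (1/2) ^ k" by simp
    then have "\<not> shift_dist x y < (1/2) ^ k \<or> \<not> shift_dist y z < (1/2) ^ k"
      unfolding shift_dist_less_iff by metis
    moreover have "0 \<le> shift_dist x y" "0 \<le> shift_dist y z"
      by (simp_all add: shift_dist_def)
    ultimately show ?thesis using k by linarith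
  qed (simp add: shift_dist_def)
qed

definition shift_topology :: "(int \<Rightarrow> 'a) topology" where
  "shift_topology = Metric_space.mtopology UNIV shift_dist"

definition shift_space :: "(int \<Rightarrow> 'a::finite) set \<Rightarrow> bool" where
  "shift_space X \<longleftrightarrow> X \<noteq> {} \<and> closedin shift_topology X \<and> shift ` X = X"

definition Borel_on :: "(int \<Rightarrow> 'a) set \<Rightarrow> (int \<Rightarrow> 'a) measure" where
  "Borel_on S = sigma S {U. openin (subtopology shift_topology S) U}"

text \<open>\<open>block x i j\<close> is the word $x_{[i,j)}$.\<close>

definition block :: "(int \<Rightarrow> 'a) \<Rightarrow> int \<Rightarrow> int \<Rightarrow> 'a list" where
  "block x i j = map x [i..j - 1]"

definition cylinder :: "(int \<Rightarrow> 'a) set \<Rightarrow> 'a list \<Rightarrow> (int \<Rightarrow> 'a) set" where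
  "cylinder X w = {x \<in> X. block x 0 (int (length w)) = w}"

definition language_n :: "(int \<Rightarrow> 'a) set \<Rightarrow> nat \<Rightarrow> 'a list set" where
  "language_n X n = {w. length w = n \<and> cylinder X w \<noteq> {}}"

definition language :: "(int \<Rightarrow> 'a) set \<Rightarrow> 'a list set" where
  "language X = (\<Union>n. language_n X n)"

definition specification_property :: "(int \<Rightarrow> 'a) set \<Rightarrow> bool" where
  "specification_property X \<longleftrightarrow>
     (\<exists>t. \<forall>v\<in>language X. \<forall>w\<in>language X. \<exists>u\<in>language_n X t. v @ u @ w \<in> language X)"

definition birkhoff_sum :: "((int \<Rightarrow> 'a) \<Rightarrow> real) \<Rightarrow> nat \<Rightarrow> (int \<Rightarrow> 'a) \<Rightarrow> real" where
  "birkhoff_sum \<phi> n x = (\<Sum>k<n. \<phi> ((shift ^^ k) x))"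

definition walters_property :: "(int \<Rightarrow> 'a) set \<Rightarrow> ((int \<Rightarrow> 'a) \<Rightarrow> real) \<Rightarrow> bool" where
  "walters_property X \<phi> \<longleftrightarrow>
     (\<forall>\<epsilon>>0. \<exists>k::nat. \<forall>n::nat. \<forall>x\<in>X. \<forall>y\<in>X.
        block x (- int k) (int n + int k) = block y (- int k) (int n + int k) \<longrightarrow>
        \<bar>birkhoff_sum \<phi> n x - birkhoff_sum \<phi> n y\<bar> \<le> \<epsilon>)"


section \<open>Measure-theoretic entropy and equilibrium measures\<close>

definition finite_partition :: "'b measure \<Rightarrow> 'b set set \<Rightarrow> bool" where
  "finite_partition M P \<longleftrightarrow> finite P \<and> P \<subseteq> sets M \<and> partition_on (space M) P"

definition partition_entropy :: "'b measure \<Rightarrow> 'b set set \<Rightarrow> real" where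
  "partition_entropy M P = - (\<Sum>A\<in>P. measure M A * ln (measure M A))"

text \<open>The join $\bigvee_{i<n} T^{-i}P$.\<close>

definition iterated_join :: "'b measure \<Rightarrow> ('b \<Rightarrow> 'b) \<Rightarrow> 'b set set \<Rightarrow> nat \<Rightarrow> 'b set set" where
  "iterated_join M T P n =
     {space M \<inter> (\<Inter>i<n. (T ^^ i) -` p i) | p. \<forall>i<n. p i \<in> P} - {{}}"

definition entropy_wrt_partition :: "'b measure \<Rightarrow> ('b \<Rightarrow> 'b) \<Rightarrow> 'b set set \<Rightarrow> real" where
  "entropy_wrt_partition M T P =
     lim (\<lambda>n. partition_entropy M (iterated_join M T P n) / real n)"

definition measure_entropy :: "'b measure \<Rightarrow> ('b \<Rightarrow> 'b) \<Rightarrow> ereal" where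
  "measure_entropy M T =
     (SUP P\<in>{P. finite_partition M P}. ereal (entropy_wrt_partition M T P))"

definition invariant_measure :: "(int \<Rightarrow> 'a) set \<Rightarrow> (int \<Rightarrow> 'a) measure \<Rightarrow> bool" where
  "invariant_measure X \<mu> \<longleftrightarrow>
     prob_space \<mu> \<and> space \<mu> = X \<and> sets \<mu> = sets (Borel_on X) \<and>
     shift \<in> measurable \<mu> \<mu> \<and> distr \<mu> \<mu> shift = \<mu>"

definition equilibrium_measure ::
    "(int \<Rightarrow> 'a) set \<Rightarrow> ((int \<Rightarrow> 'a) \<Rightarrow> real) \<Rightarrow> (int \<Rightarrow> 'a) measure \<Rightarrow> bool" where
  "equilibrium_measure X \<phi> \<mu> \<longleftrightarrow>
     invariant_measure X \<mu> \<and>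
     (\<forall>\<nu>. invariant_measure X \<nu> \<longrightarrow>
        measure_entropy \<nu> shift + ereal (integral\<^sup>L \<nu> \<phi>)
        \<le> measure_entropy \<mu> shift + ereal (integral\<^sup>L \<mu> \<phi>))"


section \<open>Local product structure\<close>

definition bracket :: "(int \<Rightarrow> 'a) \<Rightarrow> (int \<Rightarrow> 'a) \<Rightarrow> (int \<Rightarrow> 'a)" where
  "bracket x y = (\<lambda>n. if n \<le> 0 then x n else y n)"

definition bracket_defined :: "(int \<Rightarrow> 'a) set \<Rightarrow> (int \<Rightarrow> 'a) \<Rightarrow> (int \<Rightarrow> 'a) \<Rightarrow> bool" where
  "bracket_defined X x y \<longleftrightarrow> x 0 = y 0 \<and> bracket x y \<in> X"

definition rectangle :: "(int \<Rightarrow> 'a) set \<Rightarrow> (int \<Rightarrow> 'a) set \<Rightarrow> bool" where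
  "rectangle X R \<longleftrightarrow>
     R \<subseteq> X \<and> (\<forall>x\<in>R. \<forall>y\<in>R. bracket_defined X x y \<and> bracket x y \<in> R)"

definition Wu :: "(int \<Rightarrow> 'a) set \<Rightarrow> (int \<Rightarrow> 'a) \<Rightarrow> (int \<Rightarrow> 'a) set" where
  "Wu R q = {x \<in> R. \<forall>n\<le>0. x n = q n}"

definition Ws :: "(int \<Rightarrow> 'a) set \<Rightarrow> (int \<Rightarrow> 'a) \<Rightarrow> (int \<Rightarrow> 'a) set" where
  "Ws R q = {x \<in> R. \<forall>n\<ge>0. x n = q n}"

text \<open>The map $\iota_q$ is given by the same formula for every \<open>q\<close>; only its domain
  \<open>Wu R q \<times> Ws R q\<close> depends on \<open>q\<close>.\<close>

definition \<iota> :: "(int \<Rightarrow> 'a) \<times> (int \<Rightarrow> 'a) \<Rightarrow> (int \<Rightarrow> 'a)" where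
  "\<iota> = (\<lambda>(x, y). bracket y x)"

lemma bij_betw_\<iota>:
  assumes "rectangle X R" "q \<in> R"
  shows "bij_betw \<iota> (Wu R q \<times> Ws R q) R"
proof (rule bij_betw_byWitness[where f' = "\<lambda>z. (bracket q z, bracket z q)"])
  have R: "x 0 = y 0" "bracket x y \<in> R" if "x \<in> R" "y \<in> R" for x y
    using assms(1) that by (auto simp: rectangle_def bracket_defined_def)
  show "\<forall>a\<in>Wu R q \<times> Ws R q. (bracket q (\<iota> a), bracket (\<iota> a) q) = a"
    by (auto simp: \<iota>_def bracket_def Wu_def Ws_def fun_eq_iff)
  show "\<forall>z\<in>R. \<iota> (bracket q z, bracket z q) = z"
    by (auto simp: \<iota>_def bracket_def fun_eq_iff)
  show "\<iota> ` (Wu R q \<times> Ws R q) \<subseteq> R"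
    using R by (auto simp: \<iota>_def Wu_def Ws_def)
  show "(\<lambda>z. (bracket q z, bracket z q)) ` R \<subseteq> Wu R q \<times> Ws R q"
    using R[OF _ assms(2)] R[OF assms(2)]
    by (auto simp: Wu_def Ws_def) (auto simp: bracket_def order.antisym)
qed

text \<open>The factorization is required at every base point \<open>q\<close>. Since the maps
  \<open>bracket q'\<close> and \<open>\<lambda>y. bracket y q'\<close> carry \<open>Wu R q\<close> to \<open>Wu R q'\<close> and \<open>Ws R q\<close> to \<open>Ws R q'\<close>,
  this is the same as requiring it at one base point when \<open>R\<close> is nonempty.\<close>

definition product_measure_on :: "(int \<Rightarrow> 'a) set \<Rightarrow> (int \<Rightarrow> 'a) measure \<Rightarrow> bool" where
  "product_measure_on R m \<longleftrightarrow>
     space m = R \<and> sets m = sets (Borel_on R) \<and>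
     (\<forall>q\<in>R. \<exists>mu ms.
        space mu = Wu R q \<and> sets mu = sets (Borel_on (Wu R q)) \<and> sigma_finite_measure mu \<and>
        space ms = Ws R q \<and> sets ms = sets (Borel_on (Ws R q)) \<and> sigma_finite_measure ms \<and>
        m = distr (mu \<Otimes>\<^sub>M ms) (Borel_on R) \<iota>)"

text \<open>The rectangles are required to be Borel, so that restricting \<open>\<mu>\<close> to them makes sense.\<close>

definition local_product_structure ::
    "(int \<Rightarrow> 'a) set \<Rightarrow> (int \<Rightarrow> 'a) measure \<Rightarrow> bool" where
  "local_product_structure X \<mu> \<longleftrightarrow>
     (\<exists>(R :: nat \<Rightarrow> (int \<Rightarrow> 'a) set) (m :: nat \<Rightarrow> (int \<Rightarrow> 'a) measure).
        (\<forall>n. rectangle X (R n) \<and> R n \<in> sets \<mu> \<and> product_measure_on (R n) (m n) \<and>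
             absolutely_continuous (m n) (restrict_space \<mu> (R n))) \<and>
        emeasure \<mu> (\<Union>n. R n) = 1)"

end

(*
  The shift has a synchronizing word s (as, sb in the language imply asb in the language), so every
  cylinder of points whose past up to time 0 ends in a fixed word containing s is a rectangle.
  Normalized sums over words of length 3N produce, in the limit, an invariant measure nu with
  nu[w] comparable to exp(S_n phi - n P) on all n-words w. Comparability gives
  nu[azb] <= C nu[az] nu[zb], so on each rectangle nu is absolutely continuous with respect to the
  product of its past and future marginals, and specification forces s to occur in the past nu-almost
  surely.
  For an arbitrary equilibrium measure mu, the block entropies satisfy H_n(mu) >= n (P - int phi dmu),
  which says that the relative entropy of mu with respect to nu on n-words is bounded
  independently of n. Hence mu << nu, and the product structure passes from nu to mu.
*)
theory Submission
  imports Defs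
begin

section \<open>Words and the Borel structure of sequence spaces\<close>

text \<open>The obstacle is that \<open>X\<close> need not have a local rule: gluing a past to a
  future that agree at one coordinate can leave \<open>X\<close>. A synchronizing word marks a place
  where gluing is safe, at the price of countably many rectangles and of having to show that the
  word recurs. The analysis rests on the Walters condition at tolerance 1: Birkhoff sums over n
  steps vary by a bounded amount, uniformly in n, on points that share an n-word. All errors are
  therefore multiplicative constants, never factors exp(o(n)). The entropy side needs the same care:
  by subadditivity the entropy bound is an infimum over n, and not only a limit, so the inequality
  for each single n carries no error. This is what bounds the relative entropy. A bounded relative
  entropy in turn forces absolute continuity: a set with mass b under mu and mass e under nu
  contributes about b ln (b / e), which explodes as e tends to 0.\<close>

lemma length_block [simp]: "length (block x i j) = nat (j - i)"
  by (simp add: block_def)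

lemma block_append: "i \<le> j \<Longrightarrow> j \<le> k \<Longrightarrow> block x i j @ block x j k = block x i k"
proof -
  assume "i \<le> j" "j \<le> k"
  then have "[i..j - 1] @ [j..k - 1] = [i..k - 1]"
    using upto_split1[of i j "k - 1"] by (cases "j = k") auto
  then show ?thesis
    unfolding block_def by (metis map_append)
qed

lemma block_eq_iff: "block x i j = block y i j \<longleftrightarrow> (\<forall>k. i \<le> k \<and> k < j \<longrightarrow> x k = y k)"
  by (auto simp: block_def)

lemma block_funpow_shift: "block ((shift ^^ n) x) i j = block x (i + int n) (j + int n)"
proof (rule nth_equalityI)
  have *: "(shift ^^ n) x k = x (k + int n)" for k
    by (induction n arbitrary: k) (auto simp: shift_def algebra_simps)
  fix k assume "k < length (block ((shift ^^ n) x) i j)"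
  then show "block ((shift ^^ n) x) i j ! k = block x (i + int n) (j + int n) ! k"
    by (simp add: block_def * nth_upto algebra_simps)
qed simp

lemma block_shift: "block (shift x) i j = block x (i + 1) (j + 1)"
  using block_funpow_shift[of 1 x i j] by simp

lemma block_nth: "n < nat (j - i) \<Longrightarrow> block x i j ! n = x (i + int n)"
  by (simp add: block_def nth_upto)

lemma block_self [simp]: "j \<le> i \<Longrightarrow> block x i j = []"
  by (simp add: block_def)

lemma block_eq_append_iff:
  assumes "i \<le> j"
  shows "block x i j = v @ w \<longleftrightarrow>
    int (length v) + int (length w) = j - i \<and>
    block x i (i + int (length v)) = v \<and> block x (i + int (length v)) j = w"
    (is "?L \<longleftrightarrow> ?R")
proof
  assume L: ?L
  then have len: "int (length v) + int (length w) = j - i"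
    using assms length_block[of x i j] by auto
  then have "block x i (i + int (length v)) @ block x (i + int (length v)) j = v @ w"
    using L assms by (subst block_append) auto
  with len show ?R by (auto simp: append_eq_append_conv)
next
  assume R: ?R
  then show ?L using assms block_append[of i "i + int (length v)" j x] by auto
qed

section \<open>The topology and the Borel sets in terms of words\<close>

lemma openin_shift_topology:
  "openin shift_topology U \<longleftrightarrow>
     (\<forall>x\<in>U. \<exists>n::nat. \<forall>y. block x (- int n) (int n) = block y (- int n) (int n) \<longrightarrow> y \<in> U)"
    (is "_ \<longleftrightarrow> ?R")
proof -
  interpret Metric_space "UNIV :: (int \<Rightarrow> 'a) set" shift_dist
    by (rule Metric_space_shift_dist)
  have "openin shift_topology U \<longleftrightarrow> (\<forall>x\<in>U. \<exists>r>0. mball x r \<subseteq> U)"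
    by (auto simp: shift_topology_def openin_mtopology)
  also have "\<dots> \<longleftrightarrow> ?R"
  proof (intro ball_cong refl iffI)
    fix x assume "\<exists>r>0. mball x r \<subseteq> U"
    then obtain r where r: "r > 0" "mball x r \<subseteq> U" by auto
    obtain k where k: "(1/2) ^ k < r"
      using r(1) real_arch_pow_inv[of r "1/2"] by auto
    show "\<exists>n::nat. \<forall>y. block x (- int n) (int n) = block y (- int n) (int n) \<longrightarrow> y \<in> U"
    \<comment> \<open>Distance below (1/2)^k means agreement at all |n| <= k, right end included,
      whereas blocks are half-open; so the block has to be one longer.\<close>
    proof (intro exI[of _ "Suc k"] allI impI)
      fix y assume "block x (- int (Suc k)) (int (Suc k)) = block y (- int (Suc k)) (int (Suc k))"
      then have "shift_dist x y < (1/2) ^ k"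
        unfolding shift_dist_less_iff block_eq_iff by (smt (verit) nat_le_iff of_nat_Suc)
      then show "y \<in> U" using r k by (auto simp: in_mball)
    qed
  next
    fix x assume "\<exists>n::nat. \<forall>y. block x (- int n) (int n) = block y (- int n) (int n) \<longrightarrow> y \<in> U"
    then obtain n :: nat where n: "\<And>y. block x (- int n) (int n) = block y (- int n) (int n) \<Longrightarrow> y \<in> U"
      by auto
    have "mball x ((1/2) ^ n) \<subseteq> U"
      by (auto simp: in_mball shift_dist_less_iff block_eq_iff intro!: n)
    then show "\<exists>r>0. mball x r \<subseteq> U"
      by (intro exI[of _ "(1/2)^n"]) auto
  qed
  finally show ?thesis .
qed

abbreviation seq_algebra :: "(int \<Rightarrow> 'a) measure" where
  "seq_algebra \<equiv> PiM UNIV (\<lambda>_. count_space UNIV)"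

lemma sets_seq_block:
  "{x. block x i j = w} \<in> sets (seq_algebra :: (int \<Rightarrow> 'a::finite) measure)"
proof -
  have eq: "{x. block x i j = w} =
     {x \<in> space seq_algebra. length w = nat (j - i) \<and>
        (\<forall>n\<in>{..<nat (j - i)}. x (i + int n) \<in> {w ! n})}"
    by (auto simp: list_eq_iff_nth_eq block_nth space_PiM)
  have "{x \<in> space (seq_algebra :: (int \<Rightarrow> 'a) measure). x (i + int n) \<in> {w ! n}} \<in> sets seq_algebra" for n
    by (rule measurable_sets_Collect[OF measurable_component_singleton]) auto
  then show ?thesis
    unfolding eq by (intro sets.sets_Collect) auto
qed

lemma space_Borel_on [simp]: "space (Borel_on S) = S"
  by (simp add: Borel_on_def space_measure_of_conv)

lemma sets_Borel_on_eq:
  "sets (Borel_on S) = sigma_sets S {U. openin (subtopology shift_topology S) U}"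
  by (auto simp: Borel_on_def openin_subtopology intro!: sets_measure_of)

text \<open>Words over a finite alphabet are countable, so every open set is a countable union of
  sets fixed by one central block; conversely the coordinates are continuous. Measurability into
  sequence spaces can thus be checked coordinatewise.\<close>

lemma sets_Borel_on:
  fixes S :: "(int \<Rightarrow> 'a::finite) set"
  shows "sets (Borel_on S) = sets (restrict_space seq_algebra S)"
proof
  have "U \<in> sets (restrict_space seq_algebra S)"
    if "openin (subtopology shift_topology S) U" for U
  proof -
    obtain V where V: "openin shift_topology V" "U = V \<inter> S"
      using \<open>openin (subtopology shift_topology S) U\<close> by (auto simp: openin_subtopology)
    define I where "I = {(n, w). {x. block x (- int n) (int n) = w} \<subseteq> V}"
    have "V = (\<Union>(n, w)\<in>I. {x. block x (- int n) (int n) = w})"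
    proof
      show "V \<subseteq> (\<Union>(n, w)\<in>I. {x. block x (- int n) (int n) = w})"
      proof
        fix x assume "x \<in> V"
        then obtain n where "\<And>y. block x (- int n) (int n) = block y (- int n) (int n) \<Longrightarrow> y \<in> V"
          using V(1) unfolding openin_shift_topology by blast
        then have "(n, block x (- int n) (int n)) \<in> I"
          unfolding I_def by auto
        then show "x \<in> (\<Union>(n, w)\<in>I. {x. block x (- int n) (int n) = w})"
          by force
      qed
    qed (auto simp: I_def)
    also have "\<dots> \<in> sets seq_algebra"
      by (intro sets.countable_UN') (auto intro: sets_seq_block)
    finally show ?thesis
      using V(2) by (auto simp: sets_restrict_space)
  qed
  then show "sets (Borel_on S) \<subseteq> sets (restrict_space seq_algebra S)"
    using sets.sigma_sets_subset[of "{U. openin (subtopology shift_topology S) U}" "restrict_space seq_algebra S"]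
    unfolding sets_Borel_on_eq by (auto simp: space_restrict_space space_PiM)
next
  have m: "(\<lambda>x. x) \<in> measurable (Borel_on S) (seq_algebra :: (int \<Rightarrow> 'a) measure)"
  proof (rule measurable_PiM_single')
    fix i :: int
    have "{x \<in> S. x i = a} \<in> sets (Borel_on S)" for a
    proof -
      have "openin shift_topology {x :: int \<Rightarrow> 'a. x i = a}"
        unfolding openin_shift_topology
      proof clarsimp
        fix x :: "int \<Rightarrow> 'a"
        show "\<exists>n. \<forall>y. block x (- int n) (int n) = block y (- int n) (int n) \<longrightarrow> y i = x i"
          by (rule exI[of _ "nat \<bar>i\<bar> + 1"]) (simp add: block_eq_iff, smt (verit))
      qed
      then have "openin (subtopology shift_topology S) {x \<in> S. x i = a}"
        by (auto simp: openin_subtopology)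
      then show ?thesis by (auto simp: sets_Borel_on_eq)
    qed
    then show "(\<lambda>x. x i) \<in> Borel_on S \<rightarrow>\<^sub>M count_space UNIV"
      by (subst measurable_count_space_eq2) (auto simp: vimage_def Int_def conj_commute)
  qed auto
  show "sets (restrict_space seq_algebra S) \<subseteq> sets (Borel_on S)"
  proof
    fix A assume "A \<in> sets (restrict_space (seq_algebra :: (int \<Rightarrow> 'a) measure) S)"
    then obtain B where B: "B \<in> sets (seq_algebra :: (int \<Rightarrow> 'a) measure)" "A = S \<inter> B"
      by (auto simp: sets_restrict_space)
    have "(\<lambda>x. x) -` B \<inter> space (Borel_on S) \<in> sets (Borel_on S)"
      by (rule measurable_sets[OF m B(1)])
    then show "A \<in> sets (Borel_on S)" using B(2) by (simp add: Int_commute)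
  qed
qed

lemma sets_Borel_on_block:
  fixes S :: "(int \<Rightarrow> 'a::finite) set"
  shows "{x \<in> S. block x i j = w} \<in> sets (Borel_on S)"
proof -
  have "{x \<in> S. block x i j = w} = S \<inter> {x. block x i j = w}" by auto
  then show ?thesis
    using sets_seq_block[of i j w] by (auto simp: sets_Borel_on sets_restrict_space)
qed

lemma sets_Borel_on_block_in:
  fixes S :: "(int \<Rightarrow> 'a::finite) set"
  shows "{x \<in> S. block x i j \<in> W} \<in> sets (Borel_on S)"
proof -
  have "{x \<in> S. block x i j \<in> W} = (\<Union>w\<in>W. {x \<in> S. block x i j = w})" by auto
  also have "\<dots> \<in> sets (Borel_on S)"
    by (intro sets.countable_UN') (auto intro: sets_Borel_on_block)
  finally show ?thesis .
qed

section \<open>Approximation of Borel sets by conditions on finitely many coordinates\<close>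

definition window :: "(int \<Rightarrow> 'a) set \<Rightarrow> nat \<Rightarrow> 'a list set \<Rightarrow> (int \<Rightarrow> 'a) set" where
  "window S m W = {x \<in> S. block x (- int m) (int m) \<in> W}"

text \<open>Widening means forgetting the new letters: \<open>cut\<close> drops the first
  \<open>m' - m\<close> of them and keeps the middle \<open>2 * m\<close>. Finitely many windows can
  therefore be given the same width and united.\<close>

lemma window_extend:
  assumes "m \<le> m'"
  shows "\<exists>W'. window S m W = window S m' W'"
proof -
  define cut where "cut v = take (2 * m) (drop (m' - m) v)" for v :: "'a list"
  have "cut (block x (- int m') (int m')) = block x (- int m) (int m)" for x
    using assms by (auto simp: list_eq_iff_nth_eq cut_def block_nth algebra_simps of_nat_diff)
  then have "window S m W = window S m' {v. cut v \<in> W}"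
    by (auto simp: window_def)
  then show ?thesis ..
qed

lemma sets_Borel_on_windows:
  fixes S :: "(int \<Rightarrow> 'a::finite) set"
  shows "sets (Borel_on S) = sigma_sets S {window S m W | m W. True}"
proof
  have "U \<in> sigma_sets S {window S m W | m W. True}"
    if "openin (subtopology shift_topology S) U" for U
  proof -
    obtain V where V: "openin shift_topology V" "U = V \<inter> S"
      using \<open>openin (subtopology shift_topology S) U\<close> by (auto simp: openin_subtopology)
    define W where "W n = {w. {x. block x (- int n) (int n) = w} \<subseteq> V}" for n
    have "U = (\<Union>n. window S n (W n))"
    proof
      show "U \<subseteq> (\<Union>n. window S n (W n))"
      proof
        fix x assume "x \<in> U"
        then obtain n where "\<And>y. block x (- int n) (int n) = block y (- int n) (int n) \<Longrightarrow> y \<in> V"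
          using V unfolding openin_shift_topology by blast
        then have "x \<in> window S n (W n)"
          using \<open>x \<in> U\<close> V unfolding window_def W_def by auto
        then show "x \<in> (\<Union>n. window S n (W n))" by auto
      qed
    qed (auto simp: W_def window_def V)
    then show ?thesis
      by (auto intro!: sigma_sets.Union)
  qed
  then show "sets (Borel_on S) \<subseteq> sigma_sets S {window S m W | m W. True}"
    unfolding sets_Borel_on_eq by (intro sigma_sets_mono) auto
next
  show "sigma_sets S {window S m W | m W. True} \<subseteq> sets (Borel_on S)"
    using sets.sigma_sets_subset[of "{window S m W | m W. True}" "Borel_on S"]
    by (auto simp: window_def intro: sets_Borel_on_block_in)
qed

text \<open>Two measures at once, so that a set null for one of them gets windows small for that one.\<close>

lemma window_approx:
  fixes S :: "(int \<Rightarrow> 'a::finite) set"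
  assumes M: "finite_measure M" "sets M = sets (Borel_on S)"
    and N: "finite_measure N" "sets N = sets (Borel_on S)"
    and B: "B \<in> sets (Borel_on S)" and "e > 0"
  shows "\<exists>m W. measure M (B - window S m W \<union> (window S m W - B)) < e \<and>
               measure N (B - window S m W \<union> (window S m W - B)) < e"
proof -
  interpret M: finite_measure M by fact
  interpret N: finite_measure N by fact
  have win: "window S m W \<in> sets (Borel_on S)" for m W
    unfolding window_def by (rule sets_Borel_on_block_in)
  have M_space: "space M = S" "space N = S"
    using sets_eq_imp_space_eq[OF M(2)] sets_eq_imp_space_eq[OF N(2)] by auto
  have "B \<in> sigma_sets S {window S m W | m W. True}"
    using B sets_Borel_on_windows by blast
  then show ?thesis using \<open>e > 0\<close>
  proof (induction arbitrary: e rule: sigma_sets.induct)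
    case (Basic a)
    then obtain m W where "a = window S m W" by auto
    with \<open>e > 0\<close> show ?case by (intro exI[of _ m] exI[of _ W]) auto
  next
    case Empty
    have "window S 0 {} = {}" by (auto simp: window_def)
    with \<open>e > 0\<close> show ?case by (intro exI[of _ 0] exI[of _ "{}"]) auto
  next
    case (Compl a)
    from Compl.IH[OF Compl.prems] obtain m W where
      mW: "measure M (a - window S m W \<union> (window S m W - a)) < e"
          "measure N (a - window S m W \<union> (window S m W - a)) < e" by auto
    have "a \<subseteq> S" using Compl.hyps sigma_sets_into_sp[of "{window S m W | m W. True}" S]
      by (auto simp: window_def)
    then have "(S - a) - window S m (- W) \<union> (window S m (- W) - (S - a)) =
               a - window S m W \<union> (window S m W - a)"
      by (auto simp: window_def)
    with mW show ?case by metis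
  next
    case (Union a)
    have a: "a i \<in> sets (Borel_on S)" for i
      using Union.hyps sets_Borel_on_windows by blast
    let ?U = "\<Union>i. a i"
    have lim: "(\<lambda>n. measure K (\<Union>i\<le>n. a i)) \<longlonglongrightarrow> measure K ?U"
      if "finite_measure K" "sets K = sets (Borel_on S)" for K
    proof -
      interpret K: finite_measure K by fact
      have "(\<lambda>n. measure K (\<Union>i\<le>n. a i)) \<longlonglongrightarrow> measure K (\<Union>n. \<Union>i\<le>n. a i)"
        by (rule K.finite_Lim_measure_incseq)
          (auto simp: that a incseq_def intro!: sets.finite_UN intro: order_trans)
      also have "(\<Union>n. \<Union>i\<le>n. a i) = ?U" by auto
      finally show ?thesis .
    qed
    have "eventually (\<lambda>n. measure M ?U - measure M (\<Union>i\<le>n. a i) < e / 2 \<and>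
                          measure N ?U - measure N (\<Union>i\<le>n. a i) < e / 2) sequentially"
      using order_tendstoD(1)[OF lim[OF M], of "measure M ?U - e / 2"]
            order_tendstoD(1)[OF lim[OF N], of "measure N ?U - e / 2"] \<open>e > 0\<close>
      by (auto elim: eventually_elim2)
    then obtain n where n: "measure M ?U - measure M (\<Union>i\<le>n. a i) < e / 2"
                           "measure N ?U - measure N (\<Union>i\<le>n. a i) < e / 2"
      by (auto simp: eventually_sequentially)
    \<comment> \<open>The \<open>n + 1\<close> approximations share one half of \<open>e\<close>;
      the other half pays for truncating the union at \<open>n\<close>.\<close>
    define d where "d = e / (2 * real (Suc n))"
    have "d > 0" using \<open>e > 0\<close> by (simp add: d_def)
    have "\<forall>i. \<exists>m W. measure M (a i - window S m W \<union> (window S m W - a i)) < d \<and>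
                    measure N (a i - window S m W \<union> (window S m W - a i)) < d"
      using Union.IH \<open>d > 0\<close> by blast
    then obtain m W where mW:
      "\<And>i. measure M (a i - window S (m i) (W i) \<union> (window S (m i) (W i) - a i)) < d"
      "\<And>i. measure N (a i - window S (m i) (W i) \<union> (window S (m i) (W i) - a i)) < d"
      by metis
    define k where "k = Max (m ` {..n})"
    have "\<forall>i\<in>{..n}. \<exists>V. window S (m i) (W i) = window S k V"
      unfolding k_def by (intro ballI window_extend) auto
    then obtain V where V: "\<And>i. i \<le> n \<Longrightarrow> window S (m i) (W i) = window S k (V i)"
      by (metis atMost_iff)
    have win_UN: "window S k (\<Union>i\<le>n. V i) = (\<Union>i\<le>n. window S k (V i))"
      by (auto simp: window_def)
    have bound: "measure K (?U - window S k (\<Union>i\<le>n. V i) \<union> (window S k (\<Union>i\<le>n. V i) - ?U)) < e"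
      if K: "finite_measure K" "sets K = sets (Borel_on S)"
        and 1: "measure K ?U - measure K (\<Union>i\<le>n. a i) < e / 2"
        and 2: "\<And>i. measure K (a i - window S (m i) (W i) \<union> (window S (m i) (W i) - a i)) < d" for K
    proof -
      interpret K: finite_measure K by fact
      let ?D = "\<lambda>i. a i - window S k (V i) \<union> (window S k (V i) - a i)"
      have D: "?D i \<in> sets K" for i using a win K by auto
      have aK: "(\<Union>i\<le>n. a i) \<in> sets K" "?U \<in> sets K" using a K by auto
      have "measure K (?U - window S k (\<Union>i\<le>n. V i) \<union> (window S k (\<Union>i\<le>n. V i) - ?U))
        \<le> measure K ((?U - (\<Union>i\<le>n. a i)) \<union> (\<Union>i\<le>n. ?D i))"
        unfolding win_UN using D aK by (intro K.finite_measure_mono) auto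
      also have "\<dots> \<le> measure K (?U - (\<Union>i\<le>n. a i)) + measure K (\<Union>i\<le>n. ?D i)"
        using D aK by (intro measure_Un_le) auto
      also have "measure K (?U - (\<Union>i\<le>n. a i)) = measure K ?U - measure K (\<Union>i\<le>n. a i)"
        using aK by (intro K.finite_measure_Diff) auto
      also have "measure K (\<Union>i\<le>n. ?D i) \<le> (\<Sum>i\<le>n. measure K (?D i))"
        using D by (intro K.finite_measure_subadditive_finite) auto
      also have "(\<Sum>i\<le>n. measure K (?D i)) \<le> (\<Sum>i\<le>n. d)"
        using 2 V by (intro sum_mono) (metis atMost_iff less_imp_le)
      also have "(\<Sum>i\<le>n. d) = e / 2" by (simp add: d_def field_simps del: of_nat_Suc)
      finally show ?thesis using 1 by simp
    qed
    show ?case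
      using bound[OF M n(1) mW(1)] bound[OF N n(2) mW(2)] by blast
  qed
qed

text \<open>A window splits into finitely many word cylinders, so the measures agree on windows.
  Since \<open>window_approx\<close> picks one window for both measures, the agreement carries over
  to every Borel set up to an arbitrary error.\<close>

lemma measure_eqI_windows:
  fixes S :: "(int \<Rightarrow> 'a::finite) set"
  assumes M: "finite_measure M" "sets M = sets (Borel_on S)"
    and N: "finite_measure N" "sets N = sets (Borel_on S)"
    and eq: "\<And>m w. measure M {x \<in> S. block x (- int m) (int m) = w} =
                    measure N {x \<in> S. block x (- int m) (int m) = w}"
  shows "M = N"
proof (rule measure_eqI)
  interpret M: finite_measure M by fact
  interpret N: finite_measure N by fact
  have win: "measure K (window S m W) =
      (\<Sum>w\<in>W \<inter> {w. length w = 2 * m}. measure K {x \<in> S. block x (- int m) (int m) = w})"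
    if "finite_measure K" "sets K = sets (Borel_on S)" for K m and W :: "'a list set"
  proof -
    interpret K: finite_measure K by fact
    have "finite {w :: 'a list. length w = 2 * m}"
      using finite_lists_length_eq[of "UNIV :: 'a set" "2 * m"] by simp
    then have fin: "finite (W \<inter> {w. length w = 2 * m})" by simp
    have "window S m W = (\<Union>w\<in>W \<inter> {w. length w = 2 * m}. {x \<in> S. block x (- int m) (int m) = w})"
      by (auto simp: window_def)
    moreover have "measure K (\<Union>w\<in>W \<inter> {w. length w = 2 * m}. {x \<in> S. block x (- int m) (int m) = w}) =
      (\<Sum>w\<in>W \<inter> {w. length w = 2 * m}. measure K {x \<in> S. block x (- int m) (int m) = w})"
    proof (rule K.finite_measure_finite_Union[OF fin])
      show "disjoint_family_on (\<lambda>w. {x \<in> S. block x (- int m) (int m) = w})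
              (W \<inter> {w. length w = 2 * m})"
        unfolding disjoint_family_on_def by blast
    qed (use that(2) sets_Borel_on_block in blast)
    ultimately show ?thesis by (rule trans[OF arg_cong[of _ _ "measure K"]])
  qed
  show "sets M = sets N" using M N by simp
  fix B assume B: "B \<in> sets M"
  have "\<bar>measure M B - measure N B\<bar> \<le> e" if e: "e > 0" for e
  proof -
    obtain m W where mW: "measure M (B - window S m W \<union> (window S m W - B)) < e / 2"
               "measure N (B - window S m W \<union> (window S m W - B)) < e / 2"
      using window_approx[OF M N B[unfolded M(2)] half_gt_zero[OF e]] by blast
    have "\<bar>measure K B - measure K (window S m W)\<bar> \<le> e / 2"
      if K: "finite_measure K" "sets K = sets (Borel_on S)"
        and l: "measure K (B - window S m W \<union> (window S m W - B)) < e / 2" for K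
    proof -
      interpret K: finite_measure K by fact
      have s: "B \<in> sets K" "window S m W \<in> sets K"
        using B M K by (auto simp: window_def intro: sets_Borel_on_block_in)
      let ?D = "B - window S m W \<union> (window S m W - B)"
      have "measure K B \<le> measure K (window S m W \<union> ?D)"
           "measure K (window S m W) \<le> measure K (B \<union> ?D)"
        using s by (auto intro!: K.finite_measure_mono)
      moreover have "measure K (window S m W \<union> ?D) \<le> measure K (window S m W) + measure K ?D"
           "measure K (B \<union> ?D) \<le> measure K B + measure K ?D"
        using s by (intro measure_Un_le; simp)+
      ultimately show ?thesis using l by linarith
    qed
    from this[OF M mW(1)] this[OF N mW(2)] 
    have "\<bar>measure M B - measure M (window S m W)\<bar> \<le> e / 2"
      "\<bar>measure N B - measure N (window S m W)\<bar> \<le> e / 2" .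
    moreover have "measure M (window S m W) = measure N (window S m W)"
      using win[OF M] win[OF N] eq by simp
    ultimately show ?thesis by linarith
  qed
  then have "measure M B = measure N B"
    by (metis abs_le_zero_iff eq_iff_diff_eq_0 field_le_epsilon add_0)
  then show "emeasure M B = emeasure N B"
    by (simp add: M.emeasure_eq_measure N.emeasure_eq_measure)
qed

section \<open>Synchronizing words and rectangles\<close>

locale subshift =
  fixes X :: "(int \<Rightarrow> 'a::finite) set"
  assumes shift_space: "shift_space X"
begin

lemma X_nonempty: "X \<noteq> {}" and closedin_X: "closedin shift_topology X"
  and shift_image: "shift ` X = X"
  using shift_space by (auto simp: shift_space_def)

lemma funpow_shift_mem: "x \<in> X \<Longrightarrow> (shift ^^ n) x \<in> X"
proof (induction n)
  case (Suc n)
  then have "(shift ^^ n) x \<in> X" by simp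
  then have "shift ((shift ^^ n) x) \<in> X" using shift_image by (metis imageI)
  then show ?case by (metis funpow.simps(2) comp_apply)
qed (metis funpow_0)

lemma funpow_shift_preimage: "x \<in> X \<Longrightarrow> \<exists>y\<in>X. (shift ^^ n) y = x"
proof (induction n arbitrary: x)
  case (Suc n)
  from Suc.prems have "x \<in> shift ` X" by (subst shift_image)
  then obtain x' where x': "x' \<in> X" "shift x' = x" by (elim imageE) simp
  with Suc.IH[of x'] obtain y where "y \<in> X" "(shift ^^ n) y = x'" by blast
  with x' show ?case by (metis funpow.simps(2) comp_apply)
qed (metis funpow_0)

text \<open>Negative translations need preimages inside \<open>X\<close>. They come from the
  equality in \<open>shift_image\<close>; the inclusion alone would cover only forward
  shifts.\<close>

lemma translate_mem:
  assumes "x \<in> X"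
  shows "\<exists>y\<in>X. \<forall>j k. block y j k = block x (j + i) (k + i)"
proof (cases "i \<ge> 0")
  case True
  then show ?thesis
    by (intro bexI[of _ "(shift ^^ nat i) x"]) (auto simp: block_funpow_shift assms funpow_shift_mem)
next
  case False
  then obtain y where y: "y \<in> X" "(shift ^^ nat (- i)) y = x"
    using funpow_shift_preimage[OF assms] by blast
  have "block y j k = block x (j + i) (k + i)" for j k
    using False block_funpow_shift[of "nat (- i)" y "j + i" "k + i"] y by simp
  with y show ?thesis by blast
qed

lemma language_iff: "w \<in> language X \<longleftrightarrow> (\<exists>x\<in>X. block x i (i + int (length w)) = w)"
proof
  assume "w \<in> language X"
  then obtain x where x: "x \<in> X" "block x 0 (int (length w)) = w"
    by (auto simp: language_def language_n_def cylinder_def)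
  obtain y where "y \<in> X" "\<forall>j k. block y j k = block x (j - i) (k - i)"
    using translate_mem[OF x(1), of "- i"] by auto
  then show "\<exists>x\<in>X. block x i (i + int (length w)) = w"
    using x by (intro bexI[of _ y]) simp_all
next
  assume "\<exists>x\<in>X. block x i (i + int (length w)) = w"
  then obtain x where x: "x \<in> X" "block x i (i + int (length w)) = w" by auto
  obtain y where "y \<in> X" "\<forall>j k. block y j k = block x (j + i) (k + i)"
    using translate_mem[OF x(1), of i] by auto
  then have "y \<in> cylinder X w"
    using x by (simp add: cylinder_def add.commute)
  then show "w \<in> language X"
    by (auto simp: language_def language_n_def)
qed

lemma block_in_language: "x \<in> X \<Longrightarrow> block x i j \<in> language X"
  unfolding language_iff[of _ i] by (cases "i \<le> j") (auto intro: bexI[of _ x])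

lemma language_appendD:
  assumes "v @ w \<in> language X"
  shows "v \<in> language X" "w \<in> language X"
proof -
  obtain x where x: "x \<in> X" "block x 0 (int (length (v @ w))) = v @ w"
    using assms language_iff[of "v @ w" 0] by auto
  then have "block x 0 (int (length v)) = v"
    "block x (int (length v)) (int (length (v @ w))) = w"
    by (auto simp: block_eq_append_iff)
  then show "v \<in> language X" "w \<in> language X"
    using block_in_language[OF x(1)] by metis+
qed

lemma Nil_in_language: "[] \<in> language X"
  using X_nonempty block_in_language[of _ 0 0] by auto

text \<open>Closedness enters here: a point outside \<open>X\<close> has a central block that no
  point of \<open>X\<close> shares, so the language determines \<open>X\<close>.\<close>

lemma mem_iff_blocks: "x \<in> X \<longleftrightarrow> (\<forall>n::nat. block x (- int n) (int n) \<in> language X)"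
proof
  assume blocks: "\<forall>n::nat. block x (- int n) (int n) \<in> language X"
  have "openin shift_topology (- X)"
    using closedin_X openin_diff[of shift_topology "topspace shift_topology" X]
    by (auto simp: closedin_def shift_topology_def Compl_eq_Diff_UNIV
          Metric_space.topspace_mtopology[OF Metric_space_shift_dist])
  show "x \<in> X"
  proof (rule ccontr)
    assume "x \<notin> X"
    then obtain n :: nat where
      n: "\<And>y. block x (- int n) (int n) = block y (- int n) (int n) \<Longrightarrow> y \<notin> X"
      using \<open>openin shift_topology (- X)\<close> unfolding openin_shift_topology by blast
    obtain y where "y \<in> X" "block y (- int n) (int n) = block x (- int n) (int n)"
      using blocks[rule_format, of n] language_iff[of "block x (- int n) (int n)" "- int n"] by auto
    with n[of y] show False by simp
  qed
qed (simp add: block_in_language)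

text \<open>A past and a future that are each compatible with \<open>s\<close> can be joined across
  it: \<open>s\<close> decouples the two sides as a state does in a Markov shift.\<close>

definition synchronizing :: "'a list \<Rightarrow> bool" where
  "synchronizing s \<longleftrightarrow>
     (\<forall>a b. a @ s \<in> language X \<longrightarrow> s @ b \<in> language X \<longrightarrow> a @ s @ b \<in> language X)"

text \<open>The appended letters count as part of the future \<open>b\<close>. Hence an occurrence
  of a synchronizing word anywhere in the past can be continued up to coordinate 0.\<close>

lemma synchronizing_append: "synchronizing s \<Longrightarrow> synchronizing (s @ r)"
  unfolding synchronizing_def
proof (intro allI impI)
  fix a b
  assume s: "\<forall>a b. a @ s \<in> language X \<longrightarrow> s @ b \<in> language X \<longrightarrow> a @ s @ b \<in> language X"
    and ab: "a @ s @ r \<in> language X" "(s @ r) @ b \<in> language X"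
  then have "a @ s \<in> language X" "s @ (r @ b) \<in> language X"
    using language_appendD(1)[of "a @ s" r] by auto
  then show "a @ (s @ r) @ b \<in> language X" using s[rule_format, of a "r @ b"] by simp
qed

text \<open>The connecting words between \<open>v\<close> and \<open>w\<close> can only disappear when \<open>v\<close> is extended to the
  left and \<open>w\<close> to the right; once their number is minimal, all of them survive.\<close>

lemma synchronizing_exists:
  assumes "specification_property X"
  shows "\<exists>s\<in>language X. synchronizing s"
proof -
  obtain t where t: "\<And>v w. v \<in> language X \<Longrightarrow> w \<in> language X \<Longrightarrow>
      \<exists>u\<in>language_n X t. v @ u @ w \<in> language X"
    using assms unfolding specification_property_def by blast
  define C where "C v w = {u \<in> language_n X t. v @ u @ w \<in> language X}" for v w
  have finC: "finite (C v w)" for v w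
  proof (rule finite_subset)
    show "C v w \<subseteq> {u. length u = t}" by (auto simp: C_def language_n_def)
    show "finite {u :: 'a list. length u = t}"
      using finite_lists_length_eq[of "UNIV :: 'a set" t] by simp
  qed
  obtain vw where vw: "fst vw \<in> language X \<and> snd vw \<in> language X"
    and minC: "\<And>v'w'. fst v'w' \<in> language X \<and> snd v'w' \<in> language X \<Longrightarrow>
                 card (C (fst vw) (snd vw)) \<le> card (C (fst v'w') (snd v'w'))"
    using ex_has_least_nat[of "\<lambda>vw. fst vw \<in> language X \<and> snd vw \<in> language X" "([], [])"
        "\<lambda>vw. card (C (fst vw) (snd vw))"] Nil_in_language by auto
  define v w where "v = fst vw" and "w = snd vw"
  obtain u where u: "u \<in> C v w" using t[of v w] vw by (auto simp: C_def v_def w_def)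
  have "a @ (v @ u @ w) @ b \<in> language X"
    if "a @ v @ u @ w \<in> language X" "(v @ u @ w) @ b \<in> language X" for a b
  proof -
    have "a @ v \<in> language X" using language_appendD(1)[of "a @ v" "u @ w"] that by simp
    moreover have "w @ b \<in> language X" using language_appendD(2)[of "v @ u" "w @ b"] that by simp
    ultimately have "card (C v w) \<le> card (C (a @ v) (w @ b))"
      using minC[of "(a @ v, w @ b)"] by (simp add: v_def w_def)
    moreover have "C (a @ v) (w @ b) \<subseteq> C v w"
    proof
      fix u' assume "u' \<in> C (a @ v) (w @ b)"
      then have u': "u' \<in> language_n X t" "a @ ((v @ u' @ w) @ b) \<in> language X"
        by (auto simp: C_def)
      then have "v @ u' @ w \<in> language X"
        using language_appendD by blast
      with u' show "u' \<in> C v w" by (simp add: C_def)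
    qed
    ultimately have "C (a @ v) (w @ b) = C v w"
      using finC by (meson card_seteq)
    then show ?thesis using u by (auto simp: C_def)
  qed
  then have "synchronizing (v @ u @ w)" by (auto simp: synchronizing_def)
  moreover have "v @ u @ w \<in> language X" using u by (simp add: C_def)
  ultimately show ?thesis by blast
qed

text \<open>The word occupies the coordinates from \<open>1 - int (length z)\<close> to 0. Ending at
  0 makes all its points agree at the gluing coordinate and leaves the positive coordinates to the
  future.\<close>

definition past_cyl :: "'a list \<Rightarrow> (int \<Rightarrow> 'a) set" where
  "past_cyl z = {x \<in> X. block x (1 - int (length z)) 1 = z}"

text \<open>Up to coordinate 0 the bracket follows \<open>x\<close>, and from the start of
  \<open>z\<close> on it follows \<open>y\<close>, because both points carry \<open>z\<close>. A
  wide window thus reads a word a z b with a z taken from \<open>x\<close> and z b from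
  \<open>y\<close>, and synchronization puts it in the language.\<close>

lemma rectangle_past_cyl:
  assumes "synchronizing z" "z \<noteq> []"
  shows "rectangle X (past_cyl z)"
  unfolding rectangle_def bracket_defined_def
proof (intro conjI ballI)
  show "past_cyl z \<subseteq> X" by (auto simp: past_cyl_def)
  fix x y assume x: "x \<in> past_cyl z" and y: "y \<in> past_cyl z"
  let ?l = "1 - int (length z)"
  have l: "?l \<le> 0" using assms(2) by (cases z) auto
  have same: "x k = y k" if "?l \<le> k" "k \<le> 0" for k
    using x y that block_eq_iff[of x ?l 1 y] by (auto simp: past_cyl_def)
  then show "x 0 = y 0" using l by auto
  have left: "block (bracket x y) i j = block x i j" if "j \<le> 1" for i j
    using that by (auto simp: block_eq_iff bracket_def)
  have right: "block (bracket x y) i j = block y i j" if "?l \<le> i" for i j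
    using that same by (auto simp: block_eq_iff bracket_def)
  show "bracket x y \<in> X"
    unfolding mem_iff_blocks
  proof
    fix n :: nat
    \<comment> \<open>The window is enlarged until it contains the coordinates of \<open>z\<close>;
      the smaller one is recovered as a subword.\<close>
    define N where "N = max n (length z)"
    have N: "- int N \<le> ?l" "1 \<le> int N"
      using assms(2) by (auto simp: N_def) (cases z; simp)
    have "block x (- int N) ?l @ z = block x (- int N) 1"
      "z @ block y 1 (int N) = block y ?l (int N)"
      using x y N l block_append[of "- int N" ?l 1 x] block_append[of ?l 1 "int N" y]
      by (simp_all add: past_cyl_def)
    then have "block x (- int N) ?l @ z @ block y 1 (int N) \<in> language X"
      using x y by (intro assms(1)[unfolded synchronizing_def, rule_format])
        (simp_all add: block_in_language past_cyl_def)
    also have "block x (- int N) ?l @ z @ block y 1 (int N) = block (bracket x y) (- int N) (int N)"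
    proof -
      have "block (bracket x y) ?l 1 = z" using left[of 1 ?l] x by (simp add: past_cyl_def)
      then show ?thesis
        using N l left[of ?l "- int N"] right[of 1 "int N"]
          block_append[of "- int N" ?l "int N" "bracket x y"]
          block_append[of ?l 1 "int N" "bracket x y"] by simp
    qed
    finally have "block (bracket x y) (- int N) (int N) \<in> language X" .
    moreover have "block (bracket x y) (- int N) (int N) =
      block (bracket x y) (- int N) (- int n) @ block (bracket x y) (- int n) (int n) @
      block (bracket x y) (int n) (int N)"
      by (simp add: block_append N_def)
    ultimately show "block (bracket x y) (- int n) (int n) \<in> language X"
      by (metis language_appendD)
  qed
  then show "bracket x y \<in> past_cyl z"
    using x left[of 1 ?l] by (simp add: past_cyl_def)
qed

end

section \<open>Bowen weights and the pressure\<close>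

definition words :: "nat \<Rightarrow> 'a list set" where
  "words n = {w. length w = n}"

lemma finite_words [simp, intro]: "finite (words n :: 'a::finite list set)"
  using finite_lists_length_eq[of "UNIV :: 'a set" n] by (simp add: words_def)

lemma mem_words_iff [simp]: "w \<in> words n \<longleftrightarrow> length w = n"
  by (simp add: words_def)

lemma sum_words_add:
  fixes f :: "'a::finite list \<Rightarrow> real"
  shows "(\<Sum>w\<in>words (m + n). f w) = (\<Sum>v\<in>words m. \<Sum>w\<in>words n. f (v @ w))"
proof -
  have "(\<Sum>w\<in>words (m + n). f w) = (\<Sum>(v, w)\<in>words m \<times> words n. f (v @ w))"
    by (rule sum.reindex_bij_witness[of _ "\<lambda>(v, w). v @ w" "\<lambda>w. (take m w, drop m w)"]) auto
  also have "\<dots> = (\<Sum>v\<in>words m. \<Sum>w\<in>words n. f (v @ w))"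
    by (simp add: sum.cartesian_product)
  finally show ?thesis .
qed

lemma birkhoff_sum_add:
  "birkhoff_sum \<phi> (m + n) x = birkhoff_sum \<phi> m x + birkhoff_sum \<phi> n ((shift ^^ m) x)"
proof -
  have "birkhoff_sum \<phi> (m + n) x =
      (\<Sum>k<m. \<phi> ((shift ^^ k) x)) + (\<Sum>k=m..<m+n. \<phi> ((shift ^^ k) x))"
    by (simp add: birkhoff_sum_def lessThan_atLeast0 sum.atLeastLessThan_concat)
  also have "(\<Sum>k=m..<m+n. \<phi> ((shift ^^ k) x)) = (\<Sum>k<n. \<phi> ((shift ^^ (k + m)) x))"
    using sum.shift_bounds_nat_ivl[of "\<lambda>k. \<phi> ((shift ^^ k) x)" 0 m n]
    by (simp add: lessThan_atLeast0 add.commute)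
  finally show ?thesis by (simp add: birkhoff_sum_def funpow_add)
qed

text \<open>Evaluating \<open>a (m * n)\<close> as m copies of n and as n copies of m shows that
  every \<open>(a n - C) / real n\<close> lies below every \<open>(a m + C) / real m\<close>. Any
  number between the two families serves; \<open>P\<close> is the supremum of the lower one.\<close>

lemma quasi_additive_limit:
  fixes a :: "nat \<Rightarrow> real"
  assumes C: "\<And>m n. \<bar>a (m + n) - a m - a n\<bar> \<le> C"
  shows "\<exists>P. \<forall>n. \<bar>a n - real n * P\<bar> \<le> C"
proof -
  have mult: "\<bar>a (Suc m * n) - real (Suc m) * a n\<bar> \<le> real m * C" for m n
  proof (induction m)
    case (Suc m)
    then show ?case using C[of n "Suc m * n"] by (simp add: algebra_simps abs_le_iff)
  qed simp
  have C0: "0 \<le> C" using C[of 0 0] by linarith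
  have cross: "real m * (a n - C) \<le> real n * (a m + C)" if "m \<ge> 1" "n \<ge> 1" for m n
  proof -
    have "real m * a n - (real m - 1) * C \<le> a (m * n)"
      using mult[of "m - 1" n] that by (simp add: abs_le_iff of_nat_diff)
    moreover have "a (m * n) \<le> real n * a m + (real n - 1) * C"
      using mult[of "n - 1" m] that by (simp add: abs_le_iff of_nat_diff mult.commute)
    moreover have "real m * a n - real m * C \<le> real m * a n - (real m - 1) * C"
      "real n * a m + (real n - 1) * C \<le> real n * a m + real n * C"
      using C0 by (auto simp: algebra_simps)
    ultimately show ?thesis by (simp add: algebra_simps)
  qed
  define S where "S = (\<lambda>n. (a n - C) / real n) ` {1..}"
  have up: "s \<le> (a m + C) / real m" if "s \<in> S" "m \<ge> 1" for s m
  proof -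
    obtain n where n: "n \<ge> 1" "s = (a n - C) / real n" using \<open>s \<in> S\<close> by (auto simp: S_def)
    have "real n * (s * real m) = real m * (a n - C)" using n by simp
    also have "\<dots> \<le> real n * (a m + C)" using cross[OF \<open>m \<ge> 1\<close> n(1)] .
    finally have "s * real m \<le> a m + C" using n(1) by (subst (asm) mult_le_cancel_left_pos) auto
    then show ?thesis using \<open>m \<ge> 1\<close> by (simp add: pos_le_divide_eq)
  qed
  then have bdd: "bdd_above S" by (intro bdd_aboveI[of _ "a 1 + C"]) (use up[of _ 1] in auto)
  have ne: "S \<noteq> {}" by (auto simp: S_def)
  define P where "P = Sup S"
  have "\<bar>a n - real n * P\<bar> \<le> C" for n
  proof (cases "n = 0")
    case True
    then show ?thesis using C[of 0 0] by simp
  next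
    case False
    then have "(a n - C) / real n \<le> P"
      unfolding P_def by (intro cSup_upper bdd) (auto simp: S_def)
    moreover have "P \<le> (a n + C) / real n"
      unfolding P_def using up[of _ n] False by (intro cSup_least ne) auto
    ultimately show ?thesis using False by (simp add: field_simps abs_le_iff)
  qed
  then show ?thesis by blast
qed

section \<open>Distortion of Birkhoff sums and weights of words\<close>

locale potential = subshift X for X :: "(int \<Rightarrow> 'a::finite) set" +
  fixes \<phi> :: "(int \<Rightarrow> 'a) \<Rightarrow> real"
  assumes walters: "walters_property X \<phi>"
begin

text \<open>At tolerance 1 and for one step, the Walters condition lets \<open>\<phi>\<close> vary
  by at most 1 among points sharing a block of length \<open>2 * k + 1\<close> around 0, and there
  are finitely many such blocks.\<close>

lemma potential_bounded: "\<exists>B\<ge>0. \<forall>x\<in>X. \<bar>\<phi> x\<bar> \<le> B"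
proof -
  obtain k :: nat where k: "\<And>n x y. x \<in> X \<Longrightarrow> y \<in> X \<Longrightarrow>
      block x (- int k) (int n + int k) = block y (- int k) (int n + int k) \<Longrightarrow>
      \<bar>birkhoff_sum \<phi> n x - birkhoff_sum \<phi> n y\<bar> \<le> 1"
    using walters unfolding walters_property_def by (meson zero_less_one)
  define b where "b x = block x (- int k) (1 + int k)" for x :: "int \<Rightarrow> 'a"
  \<comment> \<open>For a word that no point realizes the choice is arbitrary; its value of
    \<open>\<phi>\<close> merely enlarges the finite sum used as a bound.\<close>
  define r where "r w = (SOME x. x \<in> X \<and> b x = w)" for w
  have "\<bar>\<phi> x\<bar> \<le> (\<Sum>w\<in>words (2 * k + 1). \<bar>\<phi> (r w)\<bar>) + 1" if "x \<in> X" for x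
  proof -
    have r: "r (b x) \<in> X \<and> b (r (b x)) = b x"
      unfolding r_def[of "b x"] by (rule someI[of _ x]) (simp add: that)
    have "\<bar>\<phi> x - \<phi> (r (b x))\<bar> \<le> 1"
      using k[of x "r (b x)" 1] r that by (simp add: b_def birkhoff_sum_def)
    moreover have "\<bar>\<phi> (r (b x))\<bar> \<le> (\<Sum>w\<in>words (2 * k + 1). \<bar>\<phi> (r w)\<bar>)"
      by (rule member_le_sum) (auto simp: b_def)
    ultimately show ?thesis by linarith
  qed
  then show ?thesis
    by (intro exI[of _ "(\<Sum>w\<in>words (2 * k + 1). \<bar>\<phi> (r w)\<bar>) + 1"]) (auto intro!: add_nonneg_nonneg sum_nonneg)
qed

lemma birkhoff_sum_bounded:
  assumes "\<forall>x\<in>X. \<bar>\<phi> x\<bar> \<le> B" "x \<in> X"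
  shows "\<bar>birkhoff_sum \<phi> n x\<bar> \<le> real n * B"
proof -
  have "\<bar>birkhoff_sum \<phi> n x\<bar> \<le> (\<Sum>k<n. \<bar>\<phi> ((shift ^^ k) x)\<bar>)"
    unfolding birkhoff_sum_def by (rule sum_abs)
  also have "\<dots> \<le> (\<Sum>k<n. B)"
    using assms funpow_shift_mem by (intro sum_mono) blast
  finally show ?thesis by simp
qed

text \<open>Walters compares points that agree \<open>k\<close> letters beyond both ends of the
  summation range, whereas here agreement stops at the ends. Applied to the middle part of the sum,
  it leaves \<open>k\<close> terms at each end, which boundedness controls.\<close>

lemma bounded_distortion:
  "\<exists>V\<ge>0. \<forall>n. \<forall>x\<in>X. \<forall>y\<in>X. block x 0 (int n) = block y 0 (int n) \<longrightarrow>
     \<bar>birkhoff_sum \<phi> n x - birkhoff_sum \<phi> n y\<bar> \<le> V"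
proof -
  obtain k :: nat where k: "\<And>n x y. x \<in> X \<Longrightarrow> y \<in> X \<Longrightarrow>
      block x (- int k) (int n + int k) = block y (- int k) (int n + int k) \<Longrightarrow>
      \<bar>birkhoff_sum \<phi> n x - birkhoff_sum \<phi> n y\<bar> \<le> 1"
    using walters unfolding walters_property_def by (meson zero_less_one)
  obtain B where B: "B \<ge> 0" "\<forall>x\<in>X. \<bar>\<phi> x\<bar> \<le> B" using potential_bounded by auto
  note bs = birkhoff_sum_bounded[OF B(2)]
  \<comment> \<open>The term \<open>4 * real k * B\<close> counts \<open>k\<close> summands at two
    ends for two points; it also covers words too short to be trimmed.\<close>
  have "\<bar>birkhoff_sum \<phi> n x - birkhoff_sum \<phi> n y\<bar> \<le> 1 + 4 * real k * B"
    if x: "x \<in> X" and y: "y \<in> X" and eq: "block x 0 (int n) = block y 0 (int n)" for n x y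
  proof (cases "n \<le> 2 * k")
    case True
    then have "real n * B \<le> real (2 * k) * B"
      using B(1) by (intro mult_right_mono) auto
    then show ?thesis using bs[OF x, of n] bs[OF y, of n] by (simp add: abs_le_iff)
  next
    case False
    define m where "m = n - 2 * k"
    have n: "n = k + (m + k)" using False by (simp add: m_def)
    let ?x = "(shift ^^ k) x" and ?y = "(shift ^^ k) y"
    have "block ?x (- int k) (int m + int k) = block ?y (- int k) (int m + int k)"
      using eq n by (simp add: block_funpow_shift algebra_simps)
    then have "\<bar>birkhoff_sum \<phi> m ?x - birkhoff_sum \<phi> m ?y\<bar> \<le> 1"
      using x y by (intro k funpow_shift_mem)
    moreover have "birkhoff_sum \<phi> n z = birkhoff_sum \<phi> k z + birkhoff_sum \<phi> m ((shift ^^ k) z) +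
        birkhoff_sum \<phi> k ((shift ^^ m) ((shift ^^ k) z))" for z
      unfolding n birkhoff_sum_add by simp
    moreover note bs[OF x, of k] bs[OF y, of k]
      bs[OF funpow_shift_mem[OF funpow_shift_mem[OF x]], of k m k]
      bs[OF funpow_shift_mem[OF funpow_shift_mem[OF y]], of k m k]
    ultimately show ?thesis by (simp add: abs_le_iff)
  qed
  then show ?thesis using B(1) by (intro exI[of _ "1 + 4 * real k * B"]) auto
qed

text \<open>The exponential is taken at an arbitrary point of the cylinder, not as a supremum;
  bounded distortion makes the choice immaterial up to a constant. The value 0 off the language lets
  sums run over all words of a given length.\<close>

definition weight :: "'a list \<Rightarrow> real" where
  "weight w = (if w \<in> language X
     then exp (birkhoff_sum \<phi> (length w) (SOME x. x \<in> X \<and> block x 0 (int (length w)) = w)) else 0)"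

lemma weight_nonneg [simp]: "0 \<le> weight w"
  by (simp add: weight_def)

lemma weight_pos_iff [simp]: "0 < weight w \<longleftrightarrow> w \<in> language X"
  by (simp add: weight_def)

lemma weight_eq_0_iff: "weight w = 0 \<longleftrightarrow> w \<notin> language X"
  by (simp add: weight_def)

lemma weight_distortion:
  "\<exists>V\<ge>0. \<forall>n. \<forall>x\<in>X. \<bar>ln (weight (block x 0 (int n))) - birkhoff_sum \<phi> n x\<bar> \<le> V"
proof -
  obtain V where V: "V \<ge> 0" "\<And>n x y. x \<in> X \<Longrightarrow> y \<in> X \<Longrightarrow> block x 0 (int n) = block y 0 (int n) \<Longrightarrow>
     \<bar>birkhoff_sum \<phi> n x - birkhoff_sum \<phi> n y\<bar> \<le> V"
    using bounded_distortion by blast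
  have "\<bar>ln (weight (block x 0 (int n))) - birkhoff_sum \<phi> n x\<bar> \<le> V" if x: "x \<in> X" for n x
  proof -
    define y where "y = (SOME y. y \<in> X \<and> block y 0 (int n) = block x 0 (int n))"
    have y: "y \<in> X \<and> block y 0 (int n) = block x 0 (int n)"
      unfolding y_def by (rule someI[of _ x]) (simp add: x)
    have "ln (weight (block x 0 (int n))) = birkhoff_sum \<phi> n y"
      using block_in_language[OF x, of 0 "int n"] by (simp add: weight_def y_def)
    then show ?thesis using V(2)[of y x n] y x by simp
  qed
  then show ?thesis using V(1) by blast
qed

text \<open>One distortion error each for \<open>v @ w\<close>, \<open>v\<close> and
  \<open>w\<close> gives the constant \<open>exp (3 * V)\<close>. The reverse inequality asks for an
  admissible \<open>v @ w\<close>, whose weight would otherwise be 0.\<close>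

lemma weight_append:
  "\<exists>K\<ge>1. (\<forall>v w. weight (v @ w) \<le> K * (weight v * weight w)) \<and>
          (\<forall>v w. v @ w \<in> language X \<longrightarrow> weight v * weight w \<le> K * weight (v @ w))"
proof -
  obtain V where V: "V \<ge> 0"
    "\<And>n x. x \<in> X \<Longrightarrow> \<bar>ln (weight (block x 0 (int n))) - birkhoff_sum \<phi> n x\<bar> \<le> V"
    using weight_distortion by blast
  have main: "\<bar>ln (weight (v @ w)) - ln (weight v) - ln (weight w)\<bar> \<le> 3 * V"
    if vw: "v @ w \<in> language X" for v w
  proof -
    let ?m = "length v" and ?n = "length w"
    obtain x where x: "x \<in> X" "block x 0 (0 + int (length (v @ w))) = v @ w"
      using vw unfolding language_iff[of "v @ w" 0] by blast
    then have b: "block x 0 (int (?m + ?n)) = v @ w" "block x 0 (int ?m) = v"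
        "block ((shift ^^ ?m) x) 0 (int ?n) = w"
      by (auto simp: block_eq_append_iff block_funpow_shift add.commute)
    show ?thesis
      using V(2)[OF x(1), of "?m + ?n"] V(2)[OF x(1), of ?m]
        V(2)[OF funpow_shift_mem[OF x(1), of ?m], of ?n] b
      by (simp add: birkhoff_sum_add abs_le_iff)
  qed
  have "weight (v @ w) \<le> exp (3 * V) * (weight v * weight w)" for v w
  proof (cases "v @ w \<in> language X")
    case True
    then have p: "0 < weight v" "0 < weight w" "0 < weight (v @ w)"
      using language_appendD[OF True] by auto
    then have "ln (weight (v @ w)) \<le> ln (exp (3 * V) * (weight v * weight w))"
      using main[OF True] by (simp add: ln_mult_pos abs_le_iff)
    then show ?thesis using p by (subst (asm) ln_le_cancel_iff) auto
  next
    case False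
    then have "weight (v @ w) = 0" by (simp add: weight_def)
    then show ?thesis by simp
  qed
  moreover have "weight v * weight w \<le> exp (3 * V) * weight (v @ w)" if vw: "v @ w \<in> language X" for v w
  proof -
    have p: "0 < weight v" "0 < weight w" "0 < weight (v @ w)"
      using vw language_appendD[OF vw] by auto
    then have "ln (weight v * weight w) \<le> ln (exp (3 * V) * weight (v @ w))"
      using main[OF vw] by (simp add: ln_mult_pos abs_le_iff)
    then show ?thesis using p by (subst (asm) ln_le_cancel_iff) auto
  qed
  ultimately show ?thesis using V(1) by (intro exI[of _ "exp (3 * V)"]) auto
qed

text \<open>The partition function of thermodynamic formalism; its exponential growth rate is the
  topological pressure.\<close>

definition partition_sum :: "nat \<Rightarrow> real" where
  "partition_sum n = (\<Sum>w\<in>words n. weight w)"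

lemma partition_sum_pos: "0 < partition_sum n"
proof -
  obtain x where x: "x \<in> X" using X_nonempty by auto
  have "0 < weight (block x 0 (int n))" using block_in_language[OF x] by simp
  also have "\<dots> \<le> partition_sum n"
    unfolding partition_sum_def by (rule member_le_sum) auto
  finally show ?thesis .
qed

end

section \<open>Growth of the partition function under specification\<close>

locale spec_potential = potential +
  assumes has_specification: "specification_property X"
begin

text \<open>Specification supplies one admissible \<open>u\<close>, whose \<open>t\<close> letters
  cost a bounded factor. Summing over all \<open>u\<close> hides that the connecting word depends on
  \<open>v\<close> and \<open>w\<close>.\<close>

lemma weight_specification:
  "\<exists>t. \<exists>c>0. \<forall>v w. c * (weight v * weight w) \<le> (\<Sum>u\<in>words t. weight (v @ u @ w))"
proof -
  obtain t where t: "\<And>v w. v \<in> language X \<Longrightarrow> w \<in> language X \<Longrightarrow>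
      \<exists>u\<in>language_n X t. v @ u @ w \<in> language X"
    using has_specification unfolding specification_property_def by blast
  obtain K where K: "K \<ge> 1" "\<And>v w. v @ w \<in> language X \<Longrightarrow> weight v * weight w \<le> K * weight (v @ w)"
    using weight_append by blast
  obtain V where V: "V \<ge> 0"
    "\<And>n x. x \<in> X \<Longrightarrow> \<bar>ln (weight (block x 0 (int n))) - birkhoff_sum \<phi> n x\<bar> \<le> V"
    using weight_distortion by blast
  obtain B where B: "B \<ge> 0" "\<forall>x\<in>X. \<bar>\<phi> x\<bar> \<le> B" using potential_bounded by auto
  \<comment> \<open>\<open>exp (- (V + real t * B))\<close> bounds the weight of an admissible word
    of length \<open>t\<close> from below; the two factors \<open>K\<close> come from cutting
    \<open>v @ u @ w\<close> twice.\<close>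
  define c where "c = exp (- (V + real t * B)) / K^2"
  have "c > 0" using K(1) by (simp add: c_def)
  moreover have "c * (weight v * weight w) \<le> (\<Sum>u\<in>words t. weight (v @ u @ w))" for v w
  proof (cases "v \<in> language X \<and> w \<in> language X")
    case False
    then have "weight v * weight w = 0" by (auto simp: weight_eq_0_iff)
    then have "c * (weight v * weight w) = 0" by (simp only: mult_zero_right)
    also have "0 \<le> (\<Sum>u\<in>words t. weight (v @ u @ w))" by (rule sum_nonneg) simp
    finally show ?thesis .
  next
    case True
    then obtain u where u: "u \<in> language_n X t" "v @ u @ w \<in> language X" using t by blast
    then have lu: "length u = t" by (simp add: language_n_def)
    have uw: "u @ w \<in> language X" using u(2) language_appendD by blast
    then have ul: "u \<in> language X" using language_appendD by blast
    then obtain x where x: "x \<in> X" "block x 0 (int t) = u"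
      unfolding language_iff[of u 0] lu by auto
    have "- (V + real t * B) \<le> ln (weight u)"
      using V(2)[OF x(1), of t] birkhoff_sum_bounded[OF B(2) x(1), of t] x(2) by (simp add: abs_le_iff)
    then have "exp (- (V + real t * B)) \<le> weight u"
      using ul by (metis weight_pos_iff exp_le_cancel_iff exp_ln)
    then have "exp (- (V + real t * B)) * (weight v * weight w) \<le> weight u * (weight v * weight w)"
      by (intro mult_right_mono) auto
    also have "\<dots> = weight v * (weight u * weight w)" by simp
    also have "\<dots> \<le> weight v * (K * weight (u @ w))"
      using K(2)[OF uw] by (intro mult_left_mono) auto
    also have "\<dots> = K * (weight v * weight (u @ w))" by simp
    also have "\<dots> \<le> K * (K * weight (v @ u @ w))"
      using K(2)[OF u(2)] K(1) by (intro mult_left_mono) auto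
    finally have "c * (weight v * weight w) \<le> weight (v @ u @ w)"
      using K(1) by (simp add: c_def field_simps power2_eq_square)
    also have "\<dots> \<le> (\<Sum>u\<in>words t. weight (v @ u @ w))"
      by (rule member_le_sum[of u]) (auto simp: lu)
    finally show ?thesis .
  qed
  ultimately show ?thesis by blast
qed

text \<open>The logarithm of the partition function is additive up to a constant: one side is
  submultiplicativity, and for the other specification inserts a gap of length \<open>t\<close> that
  is removed afterwards.\<close>

lemma partition_sum_growth:
  "\<exists>P. \<exists>D\<ge>1. \<forall>n. exp (real n * P) / D \<le> partition_sum n \<and> partition_sum n \<le> D * exp (real n * P)"
proof -
  obtain K where K: "K \<ge> 1" "\<And>v w. weight (v @ w) \<le> K * (weight v * weight w)"
    using weight_append by blast
  obtain t c where tc: "c > 0" "\<And>v w. c * (weight v * weight w) \<le> (\<Sum>u\<in>words t. weight (v @ u @ w))"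
    using weight_specification by blast
  have upper: "partition_sum (m + n) \<le> K * (partition_sum m * partition_sum n)" for m n
  proof -
    have "partition_sum (m + n) \<le> (\<Sum>v\<in>words m. \<Sum>w\<in>words n. K * (weight v * weight w))"
      unfolding partition_sum_def sum_words_add by (intro sum_mono K(2))
    also have "\<dots> = K * (partition_sum m * partition_sum n)"
      unfolding partition_sum_def sum_product by (simp add: sum_distrib_left)
    finally show ?thesis .
  qed
  have "c * (partition_sum m * partition_sum n) \<le> partition_sum (m + (t + n))" for m n
  proof -
    have "c * (partition_sum m * partition_sum n) = (\<Sum>v\<in>words m. \<Sum>w\<in>words n. c * (weight v * weight w))"
      unfolding partition_sum_def sum_product by (simp add: sum_distrib_left)
    also have "\<dots> \<le> (\<Sum>v\<in>words m. \<Sum>w\<in>words n. \<Sum>u\<in>words t. weight (v @ u @ w))"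
      by (intro sum_mono tc(2))
    also have "\<dots> = (\<Sum>v\<in>words m. \<Sum>u\<in>words t. \<Sum>w\<in>words n. weight (v @ u @ w))"
      by (intro sum.cong refl sum.swap)
    finally show ?thesis by (simp add: partition_sum_def sum_words_add)
  qed
  \<comment> \<open>Only the total length matters, so the gap can be moved to the end and split off
    at the cost of a constant.\<close>
  moreover have "partition_sum (m + (t + n)) \<le> K * (partition_sum (m + n) * partition_sum t)" for m n
    using upper[of "m + n" t] by (simp add: add_ac)
  ultimately have lower: "c * (partition_sum m * partition_sum n) \<le>
      K * partition_sum t * partition_sum (m + n)" for m n
    by (smt (verit) mult.commute mult.left_commute)
  define C where "C = max (ln K) (ln (K * partition_sum t / c))"
  have pos: "K > 0" using K(1) by simp
  have "\<bar>ln (partition_sum (m + n)) - ln (partition_sum m) - ln (partition_sum n)\<bar> \<le> C" for m n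
  proof -
    have "ln (partition_sum (m + n)) \<le> ln (K * (partition_sum m * partition_sum n))"
      using upper[of m n] by (intro ln_mono) (simp_all add: partition_sum_pos pos)
    then have "ln (partition_sum (m + n)) \<le> ln K + ln (partition_sum m) + ln (partition_sum n)"
      by (simp add: ln_mult_pos partition_sum_pos pos)
    moreover have "partition_sum m * partition_sum n \<le> K * partition_sum t / c * partition_sum (m + n)"
      using lower[of m n] tc(1) by (simp add: field_simps)
    then have "ln (partition_sum m * partition_sum n) \<le> ln (K * partition_sum t / c * partition_sum (m + n))"
      by (intro ln_mono) (simp_all add: partition_sum_pos pos)
    then have "ln (partition_sum m) + ln (partition_sum n) \<le>
        ln (K * partition_sum t / c) + ln (partition_sum (m + n))"
      using ln_mult_pos[of "K * partition_sum t / c" "partition_sum (m + n)"] tc(1)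
      by (simp add: ln_mult_pos[of "partition_sum m"] partition_sum_pos pos)
    ultimately show ?thesis by (auto simp: C_def abs_le_iff)
  qed
  then obtain P where P: "\<And>n. \<bar>ln (partition_sum n) - real n * P\<bar> \<le> C"
    using quasi_additive_limit[of "\<lambda>n. ln (partition_sum n)" C] by blast
  have C0: "0 \<le> C" using P[of 0] by linarith
  have "exp (real n * P) / exp C \<le> partition_sum n \<and> partition_sum n \<le> exp C * exp (real n * P)" for n
  proof -
    have "real n * P - C \<le> ln (partition_sum n)" "ln (partition_sum n) \<le> C + real n * P"
      using P[of n] by (auto simp: abs_le_iff)
    then have "exp (real n * P - C) \<le> exp (ln (partition_sum n))"
      "exp (ln (partition_sum n)) \<le> exp (C + real n * P)" by simp_all
    then show ?thesis by (simp add: partition_sum_pos exp_add exp_diff)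
  qed
  then show ?thesis using C0 by (intro exI[of _ P] exI[of _ "exp C"]) auto
qed

end

section \<open>Measures from consistent word functions\<close>

lemma words_0 [simp]: "words 0 = {[]}"
  by (auto simp: words_def)

text \<open>Tychonoff's theorem makes the cube compact. The countable index type makes the product
  metrizable, so that compactness yields a subsequence.\<close>

lemma convergent_subsequence_pointwise:
  fixes f :: "nat \<Rightarrow> 'i::countable \<Rightarrow> real"
  assumes "\<And>n i. f n i \<in> {0..1}"
  shows "\<exists>r l. strict_mono r \<and> (\<forall>i. (\<lambda>n. f (r n) i) \<longlonglongrightarrow> l i)"
proof -
  have "compact (PiE UNIV (\<lambda>_::'i. {0..1::real}))"
    using compactin_PiE[of "\<lambda>_. euclidean" UNIV "\<lambda>_::'i. {0..1::real}"]
    by (simp add: euclidean_product_topology)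
  then obtain l r where lr: "strict_mono r" "(f \<circ> r) \<longlonglongrightarrow> l"
    unfolding compact_def using assms by (metis (no_types, lifting) PiE_UNIV_domain Pi_I)
  have "(\<lambda>n. f (r n) i) \<longlonglongrightarrow> l i" for i
  proof -
    have "continuous_on UNIV (\<lambda>x :: 'i \<Rightarrow> real. x i)"
      by (rule continuous_on_product_coordinates)
    then have "((\<lambda>x. x i) \<longlongrightarrow> l i) (at l)"
      by (simp add: continuous_on_def)
    from tendsto_compose[OF this lr(2)[unfolded comp_def]] show ?thesis
      by (simp add: tendsto_compose)
  qed
  with lr(1) show ?thesis by blast
qed

text \<open>The library's projective limit needs Polish factors, hence the detour through \<open>discrete\<close>.\<close>

lemma word_measure_exists:
  fixes p :: "'a::finite list \<Rightarrow> real"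
  assumes nonneg: "\<And>w. 0 \<le> p w" and one: "p [] = 1"
    and right: "\<And>w. (\<Sum>u\<in>words 1. p (w @ u)) = p w"
    and left: "\<And>w. (\<Sum>u\<in>words 1. p (u @ w)) = p w"
  shows "\<exists>M. prob_space M \<and> sets M = sets (seq_algebra :: (int \<Rightarrow> 'a) measure) \<and>
     (\<forall>i w. measure M {x. block x i (i + int (length w)) = w} = p w)"
proof -
  have rightn: "(\<Sum>u\<in>words n. p (w @ u)) = p w" for n w
  proof (induction n arbitrary: w)
    case (Suc n)
    have "(\<Sum>u\<in>words (n + 1). p (w @ u)) = (\<Sum>u\<in>words n. p (w @ u))"
      unfolding sum_words_add by (simp add: right[of "w @ u" for u, simplified])
    with Suc show ?case by simp
  qed simp
  have leftn: "(\<Sum>u\<in>words n. p (u @ w)) = p w" for n w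
  proof (induction n arbitrary: w)
    case (Suc n)
    have "(\<Sum>u\<in>words (1 + n). p (u @ w)) = (\<Sum>v\<in>words n. \<Sum>u\<in>words 1. p (u @ v @ w))"
      unfolding sum_words_add append_assoc by (rule sum.swap)
    with Suc show ?case by (simp add: left[simplified])
  qed simp
  define wp where "wp n = embed_pmf (\<lambda>w. if length w = n then p w else 0)" for n
  have pmf_wp: "pmf (wp n) w = (if length w = n then p w else 0)" for n w
    unfolding wp_def
  proof (rule pmf_embed_pmf)
    have "(\<integral>\<^sup>+ w. ennreal (if length w = n then p w else 0) \<partial>count_space UNIV) =
          (\<Sum>w\<in>words n. ennreal (p w))"
      by (subst nn_integral_count_space'[of "words n"]) (auto intro!: sum.cong)
    also have "\<dots> = ennreal (\<Sum>w\<in>words n. p w)"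
      using nonneg by (intro sum_ennreal) auto
    also have "(\<Sum>w\<in>words n. p w) = 1" using rightn[of "[]" n] one by simp
    finally show "(\<integral>\<^sup>+ w. ennreal (if length w = n then p w else 0) \<partial>count_space UNIV) = 1" by simp
  qed (use nonneg in auto)
  have measure_wp: "measure (wp n) A = (\<Sum>w\<in>A \<inter> words n. p w)" for n A
  proof -
    have "measure (wp n) A = measure (wp n) (A \<inter> words n)"
      by (rule measure_prob_cong_0) (auto simp: pmf_wp)
    also have "\<dots> = (\<Sum>w\<in>A \<inter> words n. pmf (wp n) w)"
      by (rule measure_measure_pmf_finite) (auto intro: finite_Int)
    finally show ?thesis by (simp add: pmf_wp)
  qed
  \<comment> \<open>A subword at any position again has law \<open>wp n\<close>: letters to its
    right are summed out by \<open>rightn\<close>, letters to its left by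
    \<open>leftn\<close>.\<close>
  have wp_cut: "map_pmf (\<lambda>v. take n (drop a v)) (wp (a + (n + b))) = wp n" for a n b
  proof (rule pmf_eqI)
    fix w :: "'a list"
    have "pmf (map_pmf (\<lambda>v. take n (drop a v)) (wp (a + (n + b)))) w =
      (\<Sum>v\<in>words (a + (n + b)). if take n (drop a v) = w then p v else 0)"
      by (simp add: pmf_map measure_wp sum.inter_filter[symmetric] vimage_def Int_def conj_commute)
    also have "\<dots> = (\<Sum>x\<in>words a. \<Sum>y\<in>words n. \<Sum>z\<in>words b. if y = w then p (x @ y @ z) else 0)"
      by (simp add: sum_words_add)
    also have "\<dots> = (\<Sum>x\<in>words a. \<Sum>y\<in>words n. if y = w then p (x @ y) else 0)"
      using rightn[of "u @ w" b for u]
      by (intro sum.cong refl) auto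
    also have "\<dots> = (\<Sum>x\<in>words a. if length w = n then p (x @ w) else 0)"
      by (simp add: sum.delta)
    also have "\<dots> = pmf (wp n) w" by (simp add: pmf_wp leftn)
    finally show "pmf (map_pmf (\<lambda>v. take n (drop a v)) (wp (a + (n + b)))) w = pmf (wp n) w" .
  qed
  define ext :: "nat \<Rightarrow> 'a list \<Rightarrow> int \<Rightarrow> 'a discrete" where
    "ext m w = (\<lambda>i. discrete (w ! nat (i + int m)))" for m w
  \<comment> \<open>The law of the coordinates in \<open>J\<close> when a random word of length
    \<open>2 * m\<close> is laid out on \<open>{- int m..<int m}\<close>. It is meaningful, and
    independent of \<open>m\<close>, once \<open>J\<close> lies in that interval.\<close>
  define D where "D m J = map_pmf (\<lambda>w. restrict (ext m w) J) (wp (2 * m))" for m and J :: "int set"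
  have D_cong: "D m J = D m' J" if "m \<le> m'" "J \<subseteq> {- int m..<int m}" for m m' J
  proof -
    have "wp (2 * m) = map_pmf (\<lambda>v. take (2 * m) (drop (m' - m) v)) (wp (2 * m'))"
      using wp_cut[of "2 * m" "m' - m" "m' - m"] that(1) by (simp add: mult_2)
    then have "D m J = map_pmf (\<lambda>v. restrict (ext m (take (2 * m) (drop (m' - m) v))) J) (wp (2 * m'))"
      by (simp add: D_def map_pmf_comp)
    also have "\<dots> = D m' J"
      unfolding D_def
    proof (rule map_pmf_cong[OF refl], rule ext)
      fix v i assume "v \<in> set_pmf (wp (2 * m'))"
      then have "length v = 2 * m'" by (auto simp: set_pmf_iff pmf_wp split: if_splits)
      then show "restrict (ext m (take (2 * m) (drop (m' - m) v))) J i = restrict (ext m' v) J i"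
        using that
        by (auto simp: ext_def restrict_def subset_iff intro!: arg_cong[of _ _ "\<lambda>k. v ! k"] arg_cong[of _ _ discrete])
          (subst nth_take, force, subst nth_drop, force, rule arg_cong[of _ _ "\<lambda>k. v ! k"], force)
    qed
    finally show ?thesis .
  qed
  define bnd where "bnd J = (SOME m::nat. J \<subseteq> {- int m..<int m})" for J
  have bnd: "J \<subseteq> {- int (bnd J)..<int (bnd J)}" if "finite J" for J
    unfolding bnd_def
  proof (rule someI_ex)
    define N where "N = Max (insert 0 ((\<lambda>j. nat \<bar>j\<bar>) ` J)) + 1"
    have "j \<in> {- int N..<int N}" if "j \<in> J" for j
    proof -
      have "nat \<bar>j\<bar> \<le> Max (insert 0 ((\<lambda>j. nat \<bar>j\<bar>) ` J))"
        using \<open>finite J\<close> that by (intro Max_ge) auto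
      then show ?thesis by (auto simp: N_def)
    qed
    then show "\<exists>m::nat. J \<subseteq> {- int m..<int m}" by (intro exI[of _ N] subsetI)
  qed
  have D_bnd: "D (bnd J) J = D m J" if "finite J" "J \<subseteq> {- int m..<int m}" for J m
    using D_cong[OF _ that(2), of "bnd J"] D_cong[OF _ bnd[OF that(1)], of m] by (metis nle_le)
  have meas: "(\<lambda>x. restrict x J) \<in> measurable (measure_pmf q) (PiM J (\<lambda>_. borel))"
    for q :: "(int \<Rightarrow> 'a discrete) pmf" and J
    by (auto simp: space_PiM measurable_pmf_measure1)
  define Q where "Q J = distr (D (bnd J) J) (PiM J (\<lambda>_. borel)) (\<lambda>x. restrict x J)" for J
  have projective: "Q J = distr (Q H) (PiM J (\<lambda>_. borel)) (\<lambda>f. restrict f J)"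
    if JH: "J \<subseteq> H" "finite H" for J H
  proof -
    have fJ: "finite J" using JH by (rule finite_subset)
    have "distr (Q H) (PiM J (\<lambda>_. borel)) (\<lambda>f. restrict f J) =
        distr (D (bnd H) H) (PiM J (\<lambda>_. borel)) (\<lambda>x. restrict x J)"
      unfolding Q_def using JH(1)
      by (subst distr_distr[OF measurable_restrict_subset meas])
         (auto simp: comp_def restrict_restrict Int_absorb1)
    also have "\<dots> = distr (D (bnd H) J) (PiM J (\<lambda>_. borel)) (\<lambda>x. restrict x J)"
    proof -
      have "D (bnd H) J = map_pmf (\<lambda>x. restrict x J) (D (bnd H) H)"
        using JH(1) by (simp add: D_def map_pmf_comp restrict_restrict Int_absorb1)
      then show ?thesis
        by (simp only: map_pmf_rep_eq, subst distr_distr) (auto simp: space_PiM comp_def)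
    qed
    also have "D (bnd H) J = D (bnd J) J"
      using D_bnd[OF fJ, of "bnd H"] bnd[OF JH(2)] JH(1) by auto
    finally show "Q J = distr (Q H) (PiM J (\<lambda>_. borel)) (\<lambda>f. restrict f J)"
      unfolding Q_def[of J] by (rule sym)
  qed
  have prob_Q: "prob_space (Q J)" for J
    unfolding Q_def by (rule prob_space.prob_space_distr[OF prob_space_measure_pmf meas])
  interpret Q: polish_projective UNIV Q
    by (intro polish_projective.intro projective_family.intro projective prob_Q)
  define M where "M = distr Q.lim (seq_algebra :: (int \<Rightarrow> 'a) measure) (\<lambda>x i. of_discrete (x i))"
  have meas_M: "(\<lambda>x i. of_discrete (x i)) \<in> measurable Q.lim (seq_algebra :: (int \<Rightarrow> 'a) measure)"
  proof (rule measurable_PiM_single')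
    fix i :: int
    have "of_discrete \<in> borel \<rightarrow>\<^sub>M count_space (UNIV :: 'a set)"
      by (auto intro!: measurableI borel_open open_discrete)
    then show "(\<lambda>x. of_discrete (x i)) \<in> Q.lim \<rightarrow>\<^sub>M count_space (UNIV :: 'a set)"
      by (rule measurable_compose[rotated]) (simp add: measurable_component_singleton cong: measurable_cong_sets)
  qed auto
  interpret M: prob_space M
    unfolding M_def by (rule Q.P.prob_space_distr[OF meas_M])
  have sets_M: "sets M = sets seq_algebra" by (simp add: M_def)
  have center: "measure M {x. block x (- int m) (int m) = w} = p w" if w: "length w = 2 * m" for m w
  proof -
    define J where "J = {- int m..<int m}"
    define A where "A = {x \<in> space (PiM J (\<lambda>_. borel)). \<forall>j\<in>J. x j \<in> {discrete (w ! nat (j + int m))}}"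
    have "finite J" by (simp add: J_def)
    have A: "A \<in> sets (PiM J (\<lambda>_. borel))"
      unfolding A_def using \<open>finite J\<close>
      by (intro sets.sets_Collect_finite_All measurable_sets_Collect[OF measurable_component_singleton])
        (auto intro: borel_open open_discrete)
    have "measure M {x. block x (- int m) (int m) = w} =
        measure Q.lim ((\<lambda>x i. of_discrete (x i)) -` {x. block x (- int m) (int m) = w} \<inter> space Q.lim)"
      unfolding M_def by (rule measure_distr[OF meas_M sets_seq_block])
    also have "(\<lambda>x i. of_discrete (x i)) -` {x. block x (- int m) (int m) = w} \<inter> space Q.lim =
        prod_emb UNIV (\<lambda>_. borel) J A"
    proof -
      have "block (\<lambda>i. of_discrete (x i)) (- int m) (int m) = w \<longleftrightarrow>
          (\<forall>j\<in>J. x j = discrete (w ! nat (j + int m)))" for x :: "int \<Rightarrow> 'a discrete"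
      proof -
        have "block (\<lambda>i. of_discrete (x i)) (- int m) (int m) = w \<longleftrightarrow>
            (\<forall>k<2 * m. of_discrete (x (int k - int m)) = w ! k)"
          using w by (auto simp: list_eq_iff_nth_eq block_nth)
        also have "\<dots> \<longleftrightarrow> (\<forall>j\<in>J. of_discrete (x j) = w ! nat (j + int m))"
        proof (intro iffI ballI allI impI)
          fix j assume "\<forall>k<2 * m. of_discrete (x (int k - int m)) = w ! k" "j \<in> J"
          then show "of_discrete (x j) = w ! nat (j + int m)"
            by (auto simp: J_def dest: spec[of _ "nat (j + int m)"])
        next
          fix k assume "\<forall>j\<in>J. of_discrete (x j) = w ! nat (j + int m)" "k < 2 * m"
          then show "of_discrete (x (int k - int m)) = w ! k"
            by (auto simp: J_def dest: bspec[of _ _ "int k - int m"])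
        qed
        also have "\<dots> \<longleftrightarrow> (\<forall>j\<in>J. x j = discrete (w ! nat (j + int m)))"
          by (metis discrete_inverse of_discrete_inverse UNIV_I)
        finally show ?thesis .
      qed
      then show ?thesis
        by (auto simp: A_def prod_emb_def space_PiM)
    qed
    also have "measure Q.lim \<dots> = measure (Q J) A"
      using A \<open>finite J\<close> by (intro Q.measure_lim_emb) auto
    also have "\<dots> = measure (D m J) ((\<lambda>x. restrict x J) -` A)"
      unfolding Q_def D_bnd[OF \<open>finite J\<close>, of m, unfolded J_def, simplified, folded J_def]
      using measure_distr[OF meas A, of "D m J"] by simp
    also have "\<dots> = measure (wp (2 * m)) {v. restrict (ext m v) J \<in> A}"
      by (simp add: D_def vimage_def)
    also have "\<dots> = (\<Sum>v\<in>{v. restrict (ext m v) J \<in> A} \<inter> words (2 * m). p v)"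
      by (rule measure_wp)
    also have "{v. restrict (ext m v) J \<in> A} \<inter> words (2 * m) = {w}"
    proof -
      have "v = w" if v: "length v = 2 * m"
        and A: "\<forall>j\<in>J. discrete (v ! nat (j + int m)) = discrete (w ! nat (j + int m))" for v
      proof (rule nth_equalityI)
        fix k assume "k < length v"
        with A[rule_format, of "int k - int m"] v show "v ! k = w ! k"
          by (simp add: J_def discrete_inject)
      qed (simp add: v w)
      then show ?thesis using w by (auto simp: A_def space_PiM ext_def)
    qed
    finally show ?thesis by simp
  qed
  have "measure M {x. block x i (i + int (length w)) = w} = p w" for i w
  proof -
    \<comment> \<open>The word at an arbitrary position is placed in a central window, with
      \<open>a\<close> free letters before it and \<open>b\<close> after it, which are then summed
      out.\<close>
    define m where "m = nat \<bar>i\<bar> + length w"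
    define a b where "a = nat (i + int m)" and "b = nat (int m - i - int (length w))"
    have ab: "i + int m = int a" "int m - i - int (length w) = int b"
      "int a + (int (length w) + int b) = 2 * int m"
      by (auto simp: m_def a_def b_def)
    have "{x. block x i (i + int (length w)) = w} =
      (\<Union>uv\<in>words a \<times> words b. {x. block x (- int m) (int m) = fst uv @ w @ snd uv})"
    proof (intro equalityI subsetI)
      fix x assume "x \<in> {x. block x i (i + int (length w)) = w}"
      moreover have "block x (- int m) (int m) =
          block x (- int m) i @ block x i (i + int (length w)) @ block x (i + int (length w)) (int m)"
        using ab by (subst block_append, simp, simp, subst block_append) auto
      ultimately show "x \<in> (\<Union>uv\<in>words a \<times> words b. {x. block x (- int m) (int m) = fst uv @ w @ snd uv})"
        using ab by (intro UN_I[of "(block x (- int m) i, block x (i + int (length w)) (int m))"]) auto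
    next
      fix x assume "x \<in> (\<Union>uv\<in>words a \<times> words b. {x. block x (- int m) (int m) = fst uv @ w @ snd uv})"
      then have *: "block x (int a - int m) (int a - int m + int (length w)) = w"
        by (auto simp: block_eq_append_iff)
      have "int a - int m = i" using ab by simp
      then show "x \<in> {x. block x i (i + int (length w)) = w}"
        using * by simp
    qed
    also have "measure M \<dots> = (\<Sum>uv\<in>words a \<times> words b. measure M {x. block x (- int m) (int m) = fst uv @ w @ snd uv})"
      by (rule M.finite_measure_finite_Union)
        (auto simp: sets_M sets_seq_block disjoint_family_on_def)
    also have "\<dots> = (\<Sum>uv\<in>words a \<times> words b. p (fst uv @ w @ snd uv))"
      using ab by (intro sum.cong refl center) auto
    also have "\<dots> = (\<Sum>u\<in>words a. \<Sum>v\<in>words b. p (u @ w @ v))"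
      by (simp add: sum.cartesian_product case_prod_unfold)
    also have "\<dots> = p w" using rightn[of "u @ w" b for u] by (simp add: leftn)
    finally show ?thesis .
  qed
  with sets_M M.prob_space_axioms show ?thesis by blast
qed

section \<open>Gibbs measures\<close>

lemma measurable_shift_seq: "shift \<in> measurable seq_algebra (seq_algebra :: (int \<Rightarrow> 'a::finite) measure)"
  unfolding shift_def by (rule measurable_PiM_single') (auto intro: measurable_component_singleton)

lemma (in subshift) measurable_shift: "shift \<in> measurable (Borel_on X) (Borel_on X)"
proof -
  have "shift \<in> measurable (restrict_space seq_algebra X) (restrict_space seq_algebra X)"
    using funpow_shift_mem[of _ 1]
    by (intro measurable_restrict_space3 measurable_shift_seq) auto
  then show ?thesis
    using measurable_cong_sets[OF sets_Borel_on[of X] sets_Borel_on[of X]] by simp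
qed

section \<open>Normalized weights and their comparison estimates\<close>

context spec_potential
begin

text \<open>The two-sided bound determines the value: it is the limit of
  \<open>ln (partition_sum n) / real n\<close>.\<close>

definition pressure :: real where
  "pressure = (SOME P. \<exists>D\<ge>1. \<forall>n. exp (real n * P) / D \<le> partition_sum n \<and>
                                 partition_sum n \<le> D * exp (real n * P))"

definition gibbs_weight :: "'a list \<Rightarrow> real" where
  "gibbs_weight w = weight w * exp (- real (length w) * pressure)"

lemma gibbs_weight_nonneg [simp]: "0 \<le> gibbs_weight w"
  by (simp add: gibbs_weight_def)

lemma gibbs_weight_pos_iff [simp]: "0 < gibbs_weight w \<longleftrightarrow> w \<in> language X"
  by (simp add: gibbs_weight_def zero_less_mult_iff)

lemma gibbs_weight_eq_0: "w \<notin> language X \<Longrightarrow> gibbs_weight w = 0"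
  by (simp add: gibbs_weight_def weight_def)

text \<open>The normalizing factor is multiplicative in the length, so the estimates for
  \<open>weight\<close> survive; in addition the sums over all words of one length now lie between
  two positive constants.\<close>

lemma gibbs_weight_estimates:
  "\<exists>K\<ge>1. \<exists>t. (\<forall>v w. gibbs_weight (v @ w) \<le> K * (gibbs_weight v * gibbs_weight w)) \<and>
     (\<forall>v w. v @ w \<in> language X \<longrightarrow> gibbs_weight v * gibbs_weight w \<le> K * gibbs_weight (v @ w)) \<and>
     (\<forall>v w. gibbs_weight v * gibbs_weight w \<le> K * (\<Sum>u\<in>words t. gibbs_weight (v @ u @ w))) \<and>
     (\<forall>n. 1 \<le> K * (\<Sum>w\<in>words n. gibbs_weight w)) \<and>
     (\<forall>n. (\<Sum>w\<in>words n. gibbs_weight w) \<le> K)"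
proof -
  let ?P = pressure
  have e: "exp (- real (m + n) * ?P) = exp (- real m * ?P) * exp (- real n * ?P)" for m n
    by (simp add: exp_add[symmetric] algebra_simps)
  obtain K1 where K1: "K1 \<ge> 1" "\<And>v w. weight (v @ w) \<le> K1 * (weight v * weight w)"
    "\<And>v w. v @ w \<in> language X \<Longrightarrow> weight v * weight w \<le> K1 * weight (v @ w)"
    using weight_append by blast
  obtain t c where tc: "c > 0" "\<And>v w. c * (weight v * weight w) \<le> (\<Sum>u\<in>words t. weight (v @ u @ w))"
    using weight_specification by blast
  have "\<exists>D\<ge>1. \<forall>n. exp (real n * ?P) / D \<le> partition_sum n \<and> partition_sum n \<le> D * exp (real n * ?P)"
    unfolding pressure_def by (rule someI_ex) (rule partition_sum_growth)
  then obtain D where D: "D \<ge> 1" "\<And>n. exp (real n * ?P) / D \<le> partition_sum n"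
    "\<And>n. partition_sum n \<le> D * exp (real n * ?P)" by blast
  have sum_g: "(\<Sum>w\<in>words n. gibbs_weight w) = partition_sum n * exp (- real n * ?P)" for n
    by (simp add: gibbs_weight_def partition_sum_def sum_distrib_right)
  \<comment> \<open>\<open>exp (real t * ?P)\<close> compensates for the normalization of the
    \<open>t\<close> connecting letters, which occur on one side of the inequality only.\<close>
  define K where "K = max K1 (max D (exp (real t * ?P) / c))"
  have K: "K1 \<le> K" "D \<le> K" "exp (real t * ?P) / c \<le> K" "1 \<le> K"
    using K1(1) by (auto simp: K_def)
  have 1: "gibbs_weight (v @ w) \<le> K * (gibbs_weight v * gibbs_weight w)" for v w
  proof -
    have "weight (v @ w) \<le> K * (weight v * weight w)"
      using K1(2)[of v w] K(1) by (rule order_trans[OF _ mult_right_mono]) auto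
    then have "weight (v @ w) * (exp (- real (length v) * ?P) * exp (- real (length w) * ?P)) \<le>
        K * (weight v * weight w) * (exp (- real (length v) * ?P) * exp (- real (length w) * ?P))"
      by (rule mult_right_mono) auto
    then show ?thesis unfolding gibbs_weight_def length_append e by (simp add: mult_ac)
  qed
  have 2: "gibbs_weight v * gibbs_weight w \<le> K * gibbs_weight (v @ w)" if "v @ w \<in> language X" for v w
  proof -
    have "weight v * weight w \<le> K * weight (v @ w)"
      using K1(3)[OF that] K(1) by (rule order_trans[OF _ mult_right_mono]) auto
    then have "weight v * weight w * (exp (- real (length v) * ?P) * exp (- real (length w) * ?P)) \<le>
        K * weight (v @ w) * (exp (- real (length v) * ?P) * exp (- real (length w) * ?P))"
      by (rule mult_right_mono) auto
    then show ?thesis unfolding gibbs_weight_def length_append e by (simp add: mult_ac)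
  qed
  have 3: "gibbs_weight v * gibbs_weight w \<le> K * (\<Sum>u\<in>words t. gibbs_weight (v @ u @ w))" for v w
  proof -
    let ?E = "exp (- real (length v) * ?P) * exp (- real (length w) * ?P)"
    have "weight v * weight w \<le> (\<Sum>u\<in>words t. weight (v @ u @ w)) / c"
      using tc(2)[of v w] tc(1) by (simp add: field_simps)
    then have "weight v * weight w * ?E \<le> (\<Sum>u\<in>words t. weight (v @ u @ w)) / c * ?E"
      by (rule mult_right_mono) auto
    also have "\<dots> = exp (real t * ?P) / c * (\<Sum>u\<in>words t. gibbs_weight (v @ u @ w))"
      unfolding sum_distrib_left sum_distrib_right sum_divide_distrib
    proof (rule sum.cong[OF refl])
      fix u :: "'a list" assume "u \<in> words t"
      then have "exp (- real (length (v @ u @ w)) * ?P) = ?E * exp (- (real t * ?P))"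
        by (simp add: exp_add[symmetric] algebra_simps)
      moreover have "x / c * (W * (F * y)) = W / c * F * (x * y)" for x y W F :: real
        by simp
      moreover have "exp (real t * ?P) * exp (- (real t * ?P)) = 1"
        by (simp add: exp_add[symmetric])
      ultimately show "weight (v @ u @ w) / c * ?E = exp (real t * ?P) / c * gibbs_weight (v @ u @ w)"
        unfolding gibbs_weight_def by (simp only: mult_1_right)
    qed
    also have "\<dots> \<le> K * (\<Sum>u\<in>words t. gibbs_weight (v @ u @ w))"
      using K(3) by (rule mult_right_mono) (simp add: sum_nonneg)
    finally show ?thesis by (simp add: gibbs_weight_def mult_ac)
  qed
  have ee: "exp (real n * ?P) * exp (- real n * ?P) = 1" for n
    by (simp add: exp_add[symmetric])
  have 4: "1 \<le> K * (\<Sum>w\<in>words n. gibbs_weight w)" for n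
  proof -
    have "exp (real n * ?P) \<le> partition_sum n * D" using D(2)[of n] D(1) by (simp add: field_simps)
    then have "exp (real n * ?P) * exp (- real n * ?P) \<le> partition_sum n * D * exp (- real n * ?P)"
      by (rule mult_right_mono) auto
    also have "\<dots> = D * (\<Sum>w\<in>words n. gibbs_weight w)" by (simp add: sum_g)
    also have "\<dots> \<le> K * (\<Sum>w\<in>words n. gibbs_weight w)"
      using K(2) by (rule mult_right_mono) (simp add: sum_nonneg)
    finally show ?thesis by (simp only: ee)
  qed
  have 5: "(\<Sum>w\<in>words n. gibbs_weight w) \<le> K" for n
  proof -
    have "partition_sum n * exp (- real n * ?P) \<le> D * exp (real n * ?P) * exp (- real n * ?P)"
      using D(3) by (rule mult_right_mono) auto
    also have "\<dots> = D" using ee[of n] by (simp only: mult.assoc mult_1_right)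
    finally show ?thesis using K(2) by (simp add: sum_g)
  qed
  show ?thesis
    using K(4) 1 2 3 4 5 by (intro exI[of _ K] exI[of _ t] conjI allI impI) auto
qed

text \<open>For \<open>i + length v \<le> N\<close> and divided by the sum over all words of length
  \<open>N\<close>, this is the probability of seeing \<open>v\<close> at position \<open>i\<close>
  of a random word.\<close>

definition occurrence :: "nat \<Rightarrow> nat \<Rightarrow> 'a list \<Rightarrow> real" where
  "occurrence N i v = (\<Sum>p\<in>words i. \<Sum>q\<in>words (N - i - length v). gibbs_weight (p @ v @ q))"

lemma occurrence_right:
  assumes "i + length v + k \<le> N"
  shows "(\<Sum>u\<in>words k. occurrence N i (v @ u)) = occurrence N i v"
proof -
  define m where "m = N - i - length v - k"
  have m: "N - i - length v = k + m" "\<And>u. length u = k \<Longrightarrow> N - i - length (v @ u) = m"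
    using assms by (auto simp: m_def)
  have "(\<Sum>u\<in>words k. occurrence N i (v @ u)) =
      (\<Sum>u\<in>words k. \<Sum>p\<in>words i. \<Sum>q\<in>words m. gibbs_weight (p @ v @ u @ q))"
    unfolding occurrence_def using m(2) by (intro sum.cong refl) auto
  also have "\<dots> = (\<Sum>p\<in>words i. \<Sum>u\<in>words k. \<Sum>q\<in>words m. gibbs_weight (p @ v @ u @ q))"
    by (rule sum.swap)
  also have "\<dots> = occurrence N i v"
    unfolding occurrence_def m(1) sum_words_add ..
  finally show ?thesis .
qed

text \<open>Letters summed out on the left move \<open>v\<close> to position \<open>i + k\<close>,
  whereas \<open>occurrence_right\<close> keeps its position. This discrepancy is the reason for
  averaging over positions.\<close>

lemma occurrence_left:
  assumes "i + k + length v \<le> N"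
  shows "(\<Sum>u\<in>words k. occurrence N i (u @ v)) = occurrence N (i + k) v"
proof -
  define m where "m = N - (i + k) - length v"
  have "(\<Sum>u\<in>words k. occurrence N i (u @ v)) =
      (\<Sum>u\<in>words k. \<Sum>p\<in>words i. \<Sum>q\<in>words m. gibbs_weight (p @ u @ v @ q))"
    unfolding occurrence_def m_def by (intro sum.cong refl) auto
  also have "\<dots> = (\<Sum>p\<in>words i. \<Sum>u\<in>words k. \<Sum>q\<in>words m. gibbs_weight (p @ u @ v @ q))"
    by (rule sum.swap)
  finally show ?thesis by (simp add: occurrence_def m_def sum_words_add)
qed

lemma occurrence_nonneg [simp]: "0 \<le> occurrence N i v"
  by (simp add: occurrence_def sum_nonneg)

lemma occurrence_Nil: "i \<le> N \<Longrightarrow> occurrence N i [] = (\<Sum>w\<in>words N. gibbs_weight w)"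
  using sum_words_add[of gibbs_weight i "N - i"] by (simp add: occurrence_def)

lemma occurrence_le:
  assumes "i + length v \<le> N"
  shows "occurrence N i v \<le> (\<Sum>w\<in>words N. gibbs_weight w)"
proof -
  have "occurrence N i v \<le> (\<Sum>u\<in>words (length v). occurrence N i ([] @ u))"
    unfolding append_Nil by (rule member_le_sum) auto
  also have "\<dots> = (\<Sum>w\<in>words N. gibbs_weight w)"
    using assms occurrence_Nil[of i N] by (subst occurrence_right) auto
  finally show ?thesis .
qed

text \<open>Above, each word is cut before and after \<open>v\<close> and the outer sums are
  bounded. Below, specification bridges the outer parts to \<open>v\<close>, which needs
  \<open>t\<close> spare letters on both sides. Each direction spends two factors on cuts or bridges
  and two on outer sums, hence \<open>K ^ 4\<close>.\<close>

lemma occurrence_gibbs: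
  "\<exists>C\<ge>1. \<exists>t. \<forall>N i v.
     (i + length v \<le> N \<longrightarrow> occurrence N i v \<le> C * gibbs_weight v) \<and>
     (t \<le> i \<longrightarrow> i + length v + t \<le> N \<longrightarrow> gibbs_weight v \<le> C * occurrence N i v)"
proof -
  obtain K t where K: "K \<ge> 1" "\<And>v w. gibbs_weight (v @ w) \<le> K * (gibbs_weight v * gibbs_weight w)"
    "\<And>v w. gibbs_weight v * gibbs_weight w \<le> K * (\<Sum>u\<in>words t. gibbs_weight (v @ u @ w))"
    "\<And>n. 1 \<le> K * (\<Sum>w\<in>words n. gibbs_weight w)" "\<And>n. (\<Sum>w\<in>words n. gibbs_weight w) \<le> K"
    using gibbs_weight_estimates by blast
  let ?S = "\<lambda>n. \<Sum>w\<in>words n. gibbs_weight w"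
  have S0: "0 \<le> ?S n" for n by (simp add: sum_nonneg)
  have up: "occurrence N i v \<le> K ^ 4 * gibbs_weight v" for N i v
  proof -
    have "gibbs_weight (p @ v @ q) \<le> K\<^sup>2 * gibbs_weight v * (gibbs_weight p * gibbs_weight q)" for p q
    proof -
      have "gibbs_weight (p @ v @ q) \<le> K * (gibbs_weight p * (K * (gibbs_weight v * gibbs_weight q)))"
        using K(1) by (intro order_trans[OF K(2)] mult_left_mono K(2)) auto
      then show ?thesis by (simp add: power2_eq_square mult_ac)
    qed
    then have "occurrence N i v \<le> (\<Sum>p\<in>words i. \<Sum>q\<in>words (N - i - length v).
        K\<^sup>2 * gibbs_weight v * (gibbs_weight p * gibbs_weight q))"
      unfolding occurrence_def by (intro sum_mono)
    also have "\<dots> = K\<^sup>2 * gibbs_weight v * (?S i * ?S (N - i - length v))"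
      unfolding sum_product by (simp add: sum_distrib_left)
    also have "\<dots> \<le> K\<^sup>2 * gibbs_weight v * (K * K)"
      using K(1) by (intro mult_left_mono mult_mono K(5) S0) auto
    finally show ?thesis by (simp add: power2_eq_square power4_eq_xxxx mult_ac)
  qed
  have low: "gibbs_weight v \<le> K ^ 4 * occurrence N i v" if "t \<le> i" "i + length v + t \<le> N" for N i v
  proof -
    define a b where "a = i - t" and "b = N - i - length v - t"
    have ab: "i = a + t" "N - i - length v = t + b" using that by (auto simp: a_def b_def)
    have "gibbs_weight v = gibbs_weight v * 1" by simp
    also have "\<dots> \<le> gibbs_weight v * (K * ?S a)" using K(4) by (rule mult_left_mono) simp
    also have "\<dots> = K * (\<Sum>p\<in>words a. gibbs_weight p * gibbs_weight v)"
      by (simp add: sum_distrib_left mult_ac)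
    also have "\<dots> \<le> K * (\<Sum>p\<in>words a. K * (\<Sum>u\<in>words t. gibbs_weight (p @ u @ v)))"
      using K(1) by (intro mult_left_mono sum_mono K(3)) auto
    also have "\<dots> = K\<^sup>2 * (\<Sum>p\<in>words i. gibbs_weight (p @ v))"
      unfolding ab(1) sum_words_add by (simp add: sum_distrib_left power2_eq_square mult_ac)
    also have "\<dots> = K\<^sup>2 * ((\<Sum>p\<in>words i. gibbs_weight (p @ v)) * 1)" by simp
    also have "\<dots> \<le> K\<^sup>2 * ((\<Sum>p\<in>words i. gibbs_weight (p @ v)) * (K * ?S b))"
      using K(1) K(4)[of b] by (intro mult_left_mono sum_nonneg) auto
    also have "\<dots> = K ^ 3 * (\<Sum>p\<in>words i. \<Sum>q\<in>words b. gibbs_weight (p @ v) * gibbs_weight q)"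
      unfolding sum_product[symmetric] by (simp add: power2_eq_square power3_eq_cube mult_ac)
    also have "\<dots> \<le> K ^ 3 * (\<Sum>p\<in>words i. \<Sum>q\<in>words b. K * (\<Sum>u\<in>words t. gibbs_weight ((p @ v) @ u @ q)))"
      using K(1) by (intro mult_left_mono sum_mono K(3)) auto
    also have "\<dots> = K ^ 4 * (\<Sum>p\<in>words i. \<Sum>q\<in>words b. \<Sum>u\<in>words t. gibbs_weight (p @ v @ u @ q))"
      by (simp add: sum_distrib_left power4_eq_xxxx power3_eq_cube mult_ac)
    also have "(\<Sum>p\<in>words i. \<Sum>q\<in>words b. \<Sum>u\<in>words t. gibbs_weight (p @ v @ u @ q)) =
        (\<Sum>p\<in>words i. \<Sum>u\<in>words t. \<Sum>q\<in>words b. gibbs_weight (p @ v @ u @ q))"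
      by (intro sum.cong refl sum.swap)
    also have "\<dots> = occurrence N i v"
      unfolding occurrence_def ab(2) sum_words_add by simp
    finally show ?thesis .
  qed
  show ?thesis
    using K(1) up low by (intro exI[of _ "K ^ 4"] exI[of _ t] conjI allI impI) (auto simp: one_le_power)
qed

end

section \<open>Limits of averaged occurrence weights\<close>

context spec_potential
begin

definition gibbs_measure :: "(int \<Rightarrow> 'a) measure \<Rightarrow> bool" where
  "gibbs_measure \<nu> \<longleftrightarrow> invariant_measure X \<nu> \<and>
     (\<exists>C\<ge>1. \<forall>i w. measure \<nu> {x \<in> X. block x i (i + int (length w)) = w} \<le> C * gibbs_weight w \<and>
                   gibbs_weight w \<le> C * measure \<nu> {x \<in> X. block x i (i + int (length w)) = w})"

text \<open>The positions are taken from the middle third of words of length \<open>3 * N\<close>, so that a fixed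
  word eventually stays clear of both ends.\<close>

definition average_occurrence :: "nat \<Rightarrow> 'a list \<Rightarrow> real" where
  "average_occurrence N v =
     (\<Sum>i=N..<2*N. occurrence (3*N) i v / (\<Sum>w\<in>words (3*N). gibbs_weight w)) / real N"

text \<open>The averages are exactly consistent under extension to the right, consistent to the left
  up to a telescoping error of order 1 / N, and satisfy Gibbs bounds uniform in N. All this passes
  to a pointwise subsequential limit.\<close>

lemma gibbs_word_function:
  "\<exists>p. (\<forall>w. 0 \<le> p w) \<and> p [] = 1 \<and> (\<forall>w. (\<Sum>u\<in>words 1. p (w @ u)) = p w) \<and>
     (\<forall>w. (\<Sum>u\<in>words 1. p (u @ w)) = p w) \<and>
     (\<exists>C\<ge>1. \<forall>w. p w \<le> C * gibbs_weight w \<and> gibbs_weight w \<le> C * p w)"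
proof -
  obtain C t where C: "C \<ge> 1"
    "\<And>N i v. i + length v \<le> N \<Longrightarrow> occurrence N i v \<le> C * gibbs_weight v"
    "\<And>N i v. t \<le> i \<Longrightarrow> i + length v + t \<le> N \<Longrightarrow> gibbs_weight v \<le> C * occurrence N i v"
    using occurrence_gibbs by blast
  obtain K where K: "K \<ge> 1" "\<And>n. 1 \<le> K * (\<Sum>w\<in>words n. gibbs_weight w)"
    "\<And>n. (\<Sum>w\<in>words n. gibbs_weight w) \<le> K"
    using gibbs_weight_estimates by blast
  define S where "S n = (\<Sum>w\<in>words n. gibbs_weight w)" for n
  have S_pos: "0 < S n" for n
    using K(1) K(2)[of n] by (smt (verit) S_def mult_nonneg_nonpos)
  define h where "h N i v = occurrence N i v / S N" for N i v
  have h01: "0 \<le> h N i v" "i + length v \<le> N \<Longrightarrow> h N i v \<le> 1" for N i v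
    using S_pos[of N] occurrence_le[of i v N] by (auto simp: h_def S_def divide_simps)
  have h_upper: "h N i v \<le> C * K * gibbs_weight v" if "i + length v \<le> N" for N i v
  proof -
    have "occurrence N i v \<le> C * gibbs_weight v * 1" using C(2)[OF that] by simp
    also have "\<dots> \<le> C * gibbs_weight v * (K * S N)"
      using C(1) K(2)[of N] by (intro mult_left_mono) (auto simp: S_def)
    finally show ?thesis using S_pos[of N] by (simp add: h_def divide_simps mult_ac)
  qed
  have h_lower: "gibbs_weight v \<le> C * K * h N i v" if "t \<le> i" "i + length v + t \<le> N" for N i v
  proof -
    have "gibbs_weight v \<le> C * occurrence N i v" using C(3)[OF that] .
    also have "\<dots> = C * (h N i v * S N)" using S_pos[of N] by (simp add: h_def)
    also have "\<dots> \<le> C * (h N i v * K)"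
      using C(1) K(3)[of N] h01(1) by (intro mult_left_mono) (auto simp: S_def)
    finally show ?thesis by (simp add: mult_ac)
  qed
  have avg: "average_occurrence N v = (\<Sum>i=N..<2*N. h (3*N) i v) / real N" for N v
    by (simp add: average_occurrence_def h_def S_def)
  have avg_le: "average_occurrence N v \<le> a"
    if "N \<ge> 1" "\<And>i. N \<le> i \<Longrightarrow> i < 2 * N \<Longrightarrow> h (3*N) i v \<le> a" for N v a
  proof -
    have "(\<Sum>i=N..<2*N. h (3*N) i v) \<le> (\<Sum>i=N..<2*N. a)"
      using that by (intro sum_mono) auto
    then show ?thesis using that(1) by (simp add: avg divide_simps mult.commute)
  qed
  have avg_ge: "a \<le> average_occurrence N v"
    if "N \<ge> 1" "\<And>i. N \<le> i \<Longrightarrow> i < 2 * N \<Longrightarrow> a \<le> h (3*N) i v" for N v a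
  proof -
    have "(\<Sum>i=N..<2*N. a) \<le> (\<Sum>i=N..<2*N. h (3*N) i v)"
      using that by (intro sum_mono) auto
    then show ?thesis using that(1) by (simp add: avg divide_simps mult.commute)
  qed
  \<comment> \<open>Setting long words to 0 keeps all values in \<open>{0..1}\<close>, as
    compactness demands. For a fixed word the condition holds eventually, and it leaves at least
    \<open>t\<close> letters on both sides at every averaged position.\<close>
  define f where "f N v = (if length v + t + 1 \<le> N then average_occurrence N v else 0)" for N v
  have f01: "f N v \<in> {0..1}" for N v
    using avg_le[of N v 1] avg_ge[of N 0 v] h01 by (auto simp: f_def)
  obtain r p where r: "strict_mono r" and p: "\<And>v. (\<lambda>n. f (r n) v) \<longlonglongrightarrow> p v"
    using convergent_subsequence_pointwise[of f, OF f01] by blast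
  have large: "eventually (\<lambda>n. m \<le> r n) sequentially" for m
    using filterlim_subseq[OF r] by (simp add: filterlim_at_top)
  have upper: "p w \<le> C * K * gibbs_weight w" for w
  proof (rule tendsto_upperbound[OF p])
    show "\<forall>\<^sub>F n in sequentially. f (r n) w \<le> C * K * gibbs_weight w"
      using large[of "length w + t + 1"]
      by eventually_elim (auto simp: f_def intro!: avg_le h_upper)
  qed simp
  have lower: "gibbs_weight w \<le> C * K * p w" for w
  proof (rule tendsto_lowerbound[OF tendsto_mult_left[OF p]])
    show "\<forall>\<^sub>F n in sequentially. gibbs_weight w \<le> C * K * f (r n) w"
      using large[of "length w + t + 1"]
    proof eventually_elim
      case (elim n)
      have "gibbs_weight w / (C * K) \<le> average_occurrence (r n) w"
        using elim C(1) K(1) h_lower[of _ w "3 * r n"]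
        by (intro avg_ge) (auto simp: divide_simps mult_ac)
      then show ?case using elim C(1) K(1) by (simp add: f_def divide_simps mult_ac)
    qed
  qed simp
  have nonneg: "0 \<le> p w" for w
    by (rule tendsto_lowerbound[OF p]) (use f01 in auto)
  have one: "p [] = 1"
  proof (rule LIMSEQ_unique[OF p])
    have "eventually (\<lambda>n. f (r n) [] = 1) sequentially"
      using large[of "t + 1"]
    proof eventually_elim
      case (elim n)
      have "h (3 * r n) i [] = 1" if "i < 2 * r n" for i
        using that occurrence_Nil[of i "3 * r n"] S_pos[of "3 * r n"] by (simp add: h_def S_def)
      then show ?case using elim by (simp add: f_def avg)
    qed
    then show "(\<lambda>n. f (r n) []) \<longlonglongrightarrow> 1" by (rule tendsto_eventually)
  qed
  have right: "(\<Sum>u\<in>words 1. p (w @ u)) = p w" for w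
  proof (rule LIMSEQ_unique)
    show "(\<lambda>n. \<Sum>u\<in>words 1. f (r n) (w @ u)) \<longlonglongrightarrow> (\<Sum>u\<in>words 1. p (w @ u))"
      by (intro tendsto_sum p)
    have "eventually (\<lambda>n. f (r n) w = (\<Sum>u\<in>words 1. f (r n) (w @ u))) sequentially"
      using large[of "length w + t + 2"]
    proof eventually_elim
      case (elim n)
      have "(\<Sum>u\<in>words 1. f (r n) (w @ u)) = (\<Sum>u\<in>words 1. average_occurrence (r n) (w @ u))"
        using elim by (intro sum.cong refl) (auto simp: f_def)
      also have "\<dots> = (\<Sum>i=r n..<2*r n. \<Sum>u\<in>words 1. h (3 * r n) i (w @ u)) / real (r n)"
        unfolding avg sum_divide_distrib[symmetric] by (subst sum.swap) (rule refl)
      also have "\<dots> = (\<Sum>i=r n..<2*r n. h (3 * r n) i w) / real (r n)"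
        using elim unfolding h_def sum_divide_distrib[symmetric]
        by (intro arg_cong2[of _ _ _ _ divide] sum.cong refl occurrence_right) auto
      finally show ?case using elim by (simp add: f_def avg)
    qed
    then show "(\<lambda>n. \<Sum>u\<in>words 1. f (r n) (w @ u)) \<longlonglongrightarrow> p w"
      by (rule Lim_transform_eventually[OF p])
  qed
  have left: "(\<Sum>u\<in>words 1. p (u @ w)) = p w" for w
  proof (rule LIMSEQ_unique)
    show "(\<lambda>n. \<Sum>u\<in>words 1. f (r n) (u @ w)) \<longlonglongrightarrow> (\<Sum>u\<in>words 1. p (u @ w))"
      by (intro tendsto_sum p)
    have "eventually (\<lambda>n. norm ((\<Sum>u\<in>words 1. f (r n) (u @ w)) - f (r n) w) \<le> 1 / real (r n)) sequentially"
      using large[of "length w + t + 2"]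
    proof eventually_elim
      case (elim n)
      let ?N = "r n"
      have "(\<Sum>u\<in>words 1. f ?N (u @ w)) = (\<Sum>u\<in>words 1. average_occurrence ?N (u @ w))"
        using elim by (intro sum.cong refl) (auto simp: f_def)
      also have "\<dots> = (\<Sum>i=?N..<2*?N. \<Sum>u\<in>words 1. h (3 * ?N) i (u @ w)) / real ?N"
        unfolding avg sum_divide_distrib[symmetric] by (subst sum.swap) (rule refl)
      also have "\<dots> = (\<Sum>i=?N..<2*?N. h (3 * ?N) (Suc i) w) / real ?N"
        using elim occurrence_left[of _ 1 w "3 * ?N"] unfolding h_def sum_divide_distrib[symmetric]
        by (intro arg_cong2[of _ _ _ _ divide] sum.cong refl) auto
      finally have "(\<Sum>u\<in>words 1. f ?N (u @ w)) - f ?N w =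
          (\<Sum>i=?N..<2*?N. h (3 * ?N) (Suc i) w - h (3 * ?N) i w) / real ?N"
        using elim by (simp add: f_def avg sum_subtractf diff_divide_distrib)
      \<comment> \<open>Prepending a letter has raised each position by one, so the difference
        telescopes to the two extreme positions, both with values in the unit interval.\<close>
      also have "\<dots> = (h (3 * ?N) (2 * ?N) w - h (3 * ?N) ?N w) / real ?N"
        by (subst sum_Suc_diff') auto
      finally show ?case
        using h01(1)[of "3 * ?N" "2 * ?N" w] h01(1)[of "3 * ?N" ?N w]
          h01(2)[of "2 * ?N" w "3 * ?N"] h01(2)[of ?N w "3 * ?N"] elim
        by (auto simp: divide_simps)
    qed
    moreover have "(\<lambda>n. 1 / real (r n)) \<longlonglongrightarrow> 0"
      using LIMSEQ_subseq_LIMSEQ[OF lim_1_over_n r] by (simp add: comp_def)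
    ultimately have "(\<lambda>n. (\<Sum>u\<in>words 1. f (r n) (u @ w)) - f (r n) w) \<longlonglongrightarrow> 0"
      by (rule Lim_null_comparison)
    from tendsto_add[OF this p[of w]] show "(\<lambda>n. \<Sum>u\<in>words 1. f (r n) (u @ w)) \<longlonglongrightarrow> p w"
      by simp
  qed
  have "C * K \<ge> 1" using C(1) K(1) mult_mono[of 1 C 1 K] by simp
  with nonneg one right left upper lower show ?thesis
    by (intro exI[of _ p] conjI allI exI[of _ "C * K"]) auto
qed

text \<open>The measure built from the word function lives on all sequences. Words off the language
  get mass 0, so it is concentrated on \<open>X\<close>; its restriction is shift invariant because
  the mass of a word does not depend on its position.\<close>

lemma gibbs_measure_exists: "\<exists>\<nu>. gibbs_measure \<nu>"
proof -
  obtain p C where p: "\<And>w. 0 \<le> p w" "p [] = 1" "\<And>w. (\<Sum>u\<in>words 1. p (w @ u)) = p w"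
     "\<And>w. (\<Sum>u\<in>words 1. p (u @ w)) = p w"
    and C: "C \<ge> 1" "\<And>w. p w \<le> C * gibbs_weight w" "\<And>w. gibbs_weight w \<le> C * p w"
    using gibbs_word_function by metis
  obtain M where M: "prob_space M" "sets M = sets (seq_algebra :: (int \<Rightarrow> 'a) measure)"
    "\<And>i w. measure M {x. block x i (i + int (length w)) = w} = p w"
    using word_measure_exists[of p, OF p] by blast
  interpret M: prob_space M by fact
  have space_M: "space M = UNIV"
    using sets_eq_imp_space_eq[OF M(2)] by (simp add: space_PiM)
  have block_sets: "{x. block x i j \<in> W} \<in> sets M" for i j W
    using sets_Borel_on_block_in[of UNIV i j W] M(2)
    by (simp add: sets_Borel_on sets_restrict_UNIV)
  have X_eq: "X = (\<Inter>n::nat. {x. block x (- int n) (int n) \<in> language X})"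
    using mem_iff_blocks by auto
  have X_sets: "X \<in> sets M"
    by (subst X_eq, rule sets.countable_INT) (auto intro: block_sets)
  have AE_X: "AE x in M. x \<in> X"
  proof -
    have "AE x in M. block x (- int n) (int n) \<in> language X" for n :: nat
    proof (rule AE_I')
      let ?W = "words (2 * n) - language X"
      show "{x \<in> space M. block x (- int n) (int n) \<notin> language X} \<subseteq>
          (\<Union>w\<in>?W. {x. block x (- int n) (int n) = w})"
        by auto
      have "{x. block x (- int n) (int n) = w} \<in> null_sets M" if "w \<in> ?W" for w
      proof -
        have "measure M {x. block x (- int n) (- int n + int (length w)) = w} = 0"
          using M(3)[of "- int n" w] p(1)[of w] C(2)[of w] gibbs_weight_eq_0[of w] that by simp
        then have "measure M {x. block x (- int n) (int n) = w} = 0"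
          using that by simp
        then show ?thesis
          using block_sets[of "- int n" "int n" "{w}"]
          by (intro null_setsI) (auto simp: M.emeasure_eq_measure)
      qed
      then show "(\<Union>w\<in>?W. {x. block x (- int n) (int n) = w}) \<in> null_sets M"
        by (intro null_sets_UN') auto
    qed
    then have "AE x in M. \<forall>n::nat. block x (- int n) (int n) \<in> language X"
      by (simp add: AE_all_countable)
    then show ?thesis by (simp add: mem_iff_blocks)
  qed
  define \<nu> where "\<nu> = restrict_space M X"
  have "emeasure M X = 1"
    using M.prob_eq_1[OF X_sets] AE_X by (simp add: M.emeasure_eq_measure)
  then have "prob_space \<nu>"
    unfolding \<nu>_def using X_sets by (intro prob_space_restrict_space) auto
  then interpret \<nu>: prob_space \<nu> .
  have space: "space \<nu> = X" by (simp add: \<nu>_def space_restrict_space space_M)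
  have sets: "sets \<nu> = sets (Borel_on X)"
    unfolding \<nu>_def sets_Borel_on by (rule sets_restrict_space_cong) (rule M(2))
  have meas: "measure \<nu> {x \<in> X. block x i (i + int (length w)) = w} = p w" for i w
  proof -
    have "measure \<nu> {x \<in> X. block x i (i + int (length w)) = w} =
        measure M {x \<in> X. block x i (i + int (length w)) = w}"
      unfolding \<nu>_def by (rule measure_restrict_space) (use X_sets in \<open>auto simp: space_M\<close>)
    also have "\<dots> = measure M {x. block x i (i + int (length w)) = w}"
    proof (rule M.finite_measure_eq_AE)
      show "{x \<in> X. block x i (i + int (length w)) = w} \<in> sets M"
        using sets.Int[OF X_sets block_sets[of i _ "{w}"]] by (simp add: Int_def)
    qed (use AE_X block_sets[of i _ "{w}"] in auto)
    finally show ?thesis by (simp add: M(3))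
  qed
  have shift_meas: "shift \<in> measurable \<nu> \<nu>"
    using measurable_shift measurable_cong_sets[OF sets sets] by simp
  have "distr \<nu> \<nu> shift = \<nu>"
  proof (rule measure_eqI_windows[where S = X])
    show "finite_measure (distr \<nu> \<nu> shift)"
      using \<nu>.prob_space_distr[OF shift_meas] by (simp add: prob_space_def)
    show "finite_measure \<nu>" by (rule \<nu>.finite_measure_axioms)
    fix m and w :: "'a list"
    have "measure (distr \<nu> \<nu> shift) {x \<in> X. block x (- int m) (int m) = w} =
        measure \<nu> (shift -` {x \<in> X. block x (- int m) (int m) = w} \<inter> space \<nu>)"
      by (rule measure_distr[OF shift_meas]) (simp add: sets sets_Borel_on_block)
    also have "shift -` {x \<in> X. block x (- int m) (int m) = w} \<inter> space \<nu> =
        {x \<in> X. block x (- int m + 1) (int m + 1) = w}"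
      using funpow_shift_mem[of _ 1] by (auto simp: space block_shift)
    also have "measure \<nu> \<dots> = measure \<nu> {x \<in> X. block x (- int m) (int m) = w}"
    proof (cases "length w = 2 * m")
      case True
      then show ?thesis
        using meas[of "- int m + 1" w] meas[of "- int m" w] by (simp add: algebra_simps)
    next
      case False
      then have "{x \<in> X. block x (- int m + 1) (int m + 1) = w} = {}"
        "{x \<in> X. block x (- int m) (int m) = w} = {}" by auto
      then show ?thesis by (simp only:)
    qed
    finally show "measure (distr \<nu> \<nu> shift) {x \<in> X. block x (- int m) (int m) = w} =
        measure \<nu> {x \<in> X. block x (- int m) (int m) = w}" .
  qed (simp_all add: sets)
  then have "gibbs_measure \<nu>"
    unfolding gibbs_measure_def invariant_measure_def
    using \<nu>.prob_space_axioms space sets shift_meas meas C by auto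
  then show ?thesis ..
qed

end

section \<open>Entropy of finite-valued functions\<close>

definition fibres :: "'b measure \<Rightarrow> ('b \<Rightarrow> 'c) \<Rightarrow> 'b set set" where
  "fibres M f = (\<lambda>v. {x \<in> space M. f x = v}) ` (f ` space M)"

text \<open>Partitions are presented as fibres of functions: joining becomes pairing, refinement
  becomes functional dependence, and iterated joins become itineraries.\<close>

definition fun_entropy :: "'b measure \<Rightarrow> ('b \<Rightarrow> 'c) \<Rightarrow> real" where
  "fun_entropy M f = partition_entropy M (fibres M f)"

text \<open>H(f | g), defined through the chain rule so that conditional probabilities are
  avoided.\<close>

definition cond_entropy :: "'b measure \<Rightarrow> ('b \<Rightarrow> 'c) \<Rightarrow> ('b \<Rightarrow> 'd) \<Rightarrow> real" where
  "cond_entropy M f g = fun_entropy M (\<lambda>x. (f x, g x)) - fun_entropy M g"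

definition itinerary :: "('b \<Rightarrow> 'c) \<Rightarrow> ('b \<Rightarrow> 'b) \<Rightarrow> nat \<Rightarrow> 'b \<Rightarrow> 'c list" where
  "itinerary f T n x = map (\<lambda>i. f ((T ^^ i) x)) [0..<n]"

lemma fun_entropy_cong:
  assumes "\<And>x y. x \<in> space M \<Longrightarrow> y \<in> space M \<Longrightarrow> f x = f y \<longleftrightarrow> g x = g y"
  shows "fun_entropy M f = fun_entropy M g"
proof -
  have "fibres M f = (\<lambda>x. {y \<in> space M. f y = f x}) ` space M" by (auto simp: fibres_def)
  also have "\<dots> = (\<lambda>x. {y \<in> space M. g y = g x}) ` space M"
    using assms by (intro image_cong) auto
  also have "\<dots> = fibres M g" by (auto simp: fibres_def)
  finally show ?thesis by (simp add: fun_entropy_def)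
qed

text \<open>The index set may exceed the range, since a missing value has probability 0 and its term
  vanishes. Entropies of several functions can thus be summed over common index sets.\<close>

lemma fun_entropy_sum:
  assumes "finite F" "f ` space M \<subseteq> F"
  shows "fun_entropy M f =
    - (\<Sum>v\<in>F. measure M {x \<in> space M. f x = v} * ln (measure M {x \<in> space M. f x = v}))"
proof -
  let ?h = "\<lambda>A. measure M A * ln (measure M A)"
  have "sum ?h (fibres M f) = (\<Sum>v\<in>f ` space M. ?h {x \<in> space M. f x = v})"
    unfolding fibres_def by (rule sum.reindex_cong) (auto simp: inj_on_def)
  also have "\<dots> = (\<Sum>v\<in>F. ?h {x \<in> space M. f x = v})"
  proof (rule sum.mono_neutral_left)
    show "\<forall>v\<in>F - f ` space M. ?h {x \<in> space M. f x = v} = 0"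
    proof
      fix v assume "v \<in> F - f ` space M"
      then have "{x \<in> space M. f x = v} = {}" by auto
      then show "?h {x \<in> space M. f x = v} = 0" by (simp only: measure_empty mult_zero_left)
    qed
  qed (use assms in auto)
  finally show ?thesis by (simp add: fun_entropy_def partition_entropy_def)
qed

lemma fun_entropy_Pair_sum:
  assumes "simple_function M f" "simple_function M g"
  shows "fun_entropy M (\<lambda>x. (f x, g x)) = - (\<Sum>a\<in>f ` space M. \<Sum>b\<in>g ` space M.
    measure M {x \<in> space M. (f x, g x) = (a, b)} * ln (measure M {x \<in> space M. (f x, g x) = (a, b)}))"
proof -
  have fin: "finite (f ` space M \<times> g ` space M)"
    by (intro finite_cartesian_product simple_functionD(1) assms)
  have sub: "(\<lambda>x. (f x, g x)) ` space M \<subseteq> f ` space M \<times> g ` space M"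
    by (intro image_subsetI SigmaI imageI)
  show ?thesis
    unfolding fun_entropy_sum[OF fin sub] sum.cartesian_product' ..
qed

lemma fun_entropy_Pair3_sum:
  assumes "simple_function M f" "simple_function M g" "simple_function M h"
  shows "fun_entropy M (\<lambda>x. (f x, g x, h x)) =
    - (\<Sum>a\<in>f ` space M. \<Sum>b\<in>g ` space M. \<Sum>c\<in>h ` space M.
        measure M {x \<in> space M. (f x, g x, h x) = (a, b, c)} *
        ln (measure M {x \<in> space M. (f x, g x, h x) = (a, b, c)}))"
proof -
  have fin: "finite (f ` space M \<times> g ` space M \<times> h ` space M)"
    by (intro finite_cartesian_product simple_functionD(1) assms)
  have sub: "(\<lambda>x. (f x, g x, h x)) ` space M \<subseteq> f ` space M \<times> g ` space M \<times> h ` space M"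
    by (intro image_subsetI SigmaI imageI)
  show ?thesis
    unfolding fun_entropy_sum[OF fin sub] sum.cartesian_product' ..
qed

lemma simple_function_mem:
  assumes "B \<in> sets M"
  shows "simple_function M (\<lambda>x. x \<in> B)"
  unfolding simple_function_def
proof (intro conjI ballI)
  show "finite ((\<lambda>x. x \<in> B) ` space M)" by (rule finite_subset[of _ UNIV]) auto
  fix v
  have "(\<lambda>x. x \<in> B) -` {v} \<inter> space M = (if v then B \<inter> space M else space M - B)" by auto
  then show "(\<lambda>x. x \<in> B) -` {v} \<inter> space M \<in> sets M" using assms by simp
qed

section \<open>Entropy inequalities\<close>

context prob_space
begin

lemma prob_fibre_pair:
  assumes f: "simple_function M f" and g: "simple_function M g"
  shows "prob {x \<in> space M. f x = a} = (\<Sum>b\<in>g ` space M. prob {x \<in> space M. f x = a \<and> g x = b})"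
proof -
  have "{x \<in> space M. f x = a} = (\<Union>b\<in>g ` space M. {x \<in> space M. f x = a \<and> g x = b})" by auto
  moreover have "prob \<dots> = (\<Sum>b\<in>g ` space M. prob {x \<in> space M. f x = a \<and> g x = b})"
  proof (rule finite_measure_finite_Union)
    have "{x \<in> space M. f x = a \<and> g x = b} = (\<lambda>x. (f x, g x)) -` {(a, b)} \<inter> space M" for b
      by auto
    then show "(\<lambda>b. {x \<in> space M. f x = a \<and> g x = b}) ` g ` space M \<subseteq> events"
      using simple_functionD(2)[OF simple_function_Pair[OF f g]] by auto
  qed (use simple_functionD(1)[OF g] in \<open>auto simp: disjoint_family_on_def\<close>)
  ultimately show ?thesis by simp
qed

text \<open>Replacing a joint probability by the larger marginal inside the logarithm gives H(g) <=
  H(f, g), and pairing \<open>f\<close> with something it determines does not change its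
  fibres.\<close>

lemma fun_entropy_mono:
  assumes f: "simple_function M f" and g: "simple_function M g"
    and det: "\<And>x y. x \<in> space M \<Longrightarrow> y \<in> space M \<Longrightarrow> f x = f y \<Longrightarrow> g x = g y"
  shows "fun_entropy M g \<le> fun_entropy M f"
proof -
  let ?F = "f ` space M" and ?G = "g ` space M"
  let ?p = "\<lambda>a b. prob {x \<in> space M. f x = a \<and> g x = b}"
  let ?pg = "\<lambda>b. prob {x \<in> space M. g x = b}"
  have fin: "finite ?F" "finite ?G" using simple_functionD(1) f g by auto
  have "(\<Sum>a\<in>?F. \<Sum>b\<in>?G. ?p a b * ln (?p a b)) \<le> (\<Sum>a\<in>?F. \<Sum>b\<in>?G. ?p a b * ln (?pg b))"
  proof (intro sum_mono)
    fix a b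
    have "{x \<in> space M. g x = b} \<in> events"
      using simple_functionD(2)[OF g, of "{b}"] by (simp add: vimage_def Int_def conj_commute)
    then have "?p a b \<le> ?pg b" by (intro finite_measure_mono) auto
    moreover have "?p a b = 0 \<or> 0 < ?p a b"
      using measure_nonneg[of M] by (auto simp: less_le)
    ultimately show "?p a b * ln (?p a b) \<le> ?p a b * ln (?pg b)"
      by (elim disjE) (simp, intro mult_left_mono, auto)
  qed
  also have "\<dots> = (\<Sum>b\<in>?G. \<Sum>a\<in>?F. ?p a b * ln (?pg b))"
    by (rule sum.swap)
  also have "\<dots> = (\<Sum>b\<in>?G. ?pg b * ln (?pg b))"
    using prob_fibre_pair[OF g f] by (simp add: sum_distrib_right[symmetric] conj_commute)
  also have "\<dots> = - fun_entropy M g"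
    using fin by (simp add: fun_entropy_sum[of ?G])
  finally have "fun_entropy M g \<le> - (\<Sum>a\<in>?F. \<Sum>b\<in>?G. ?p a b * ln (?p a b))" by linarith
  also have "\<dots> = fun_entropy M (\<lambda>x. (f x, g x))"
    by (simp only: fun_entropy_Pair_sum[OF f g] prod.inject)
  also have "\<dots> = fun_entropy M f"
    by (rule fun_entropy_cong, unfold prod.inject, blast intro: det)
  finally show ?thesis .
qed

text \<open>The conditional mutual information of \<open>f\<close> and \<open>g\<close> given
  \<open>h\<close> is nonnegative. With p the joint probability, \<open>ln x \<le> x - 1\<close> is
  applied to x = pf pg / (ph p); the resulting upper bounds sum to 0.\<close>

lemma fun_entropy_strong_subadditive:
  assumes f: "simple_function M f" and g: "simple_function M g" and h: "simple_function M h"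
  shows "fun_entropy M (\<lambda>x. (f x, g x, h x)) + fun_entropy M h \<le>
         fun_entropy M (\<lambda>x. (f x, h x)) + fun_entropy M (\<lambda>x. (g x, h x))"
proof -
  let ?F = "f ` space M" and ?G = "g ` space M" and ?H = "h ` space M"
  have fin: "finite ?F" "finite ?G" "finite ?H" using simple_functionD(1) f g h by auto
  define p where "p a b c = prob {x \<in> space M. f x = a \<and> g x = b \<and> h x = c}" for a b c
  define pf where "pf a c = prob {x \<in> space M. f x = a \<and> h x = c}" for a c
  define pg where "pg b c = prob {x \<in> space M. g x = b \<and> h x = c}" for b c
  define ph where "ph c = prob {x \<in> space M. h x = c}" for c
  note defs = p_def pf_def pg_def ph_def
  have nn: "0 \<le> p a b c" "0 \<le> pf a c" "0 \<le> pg b c" "0 \<le> ph c" for a b c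
    by (auto simp: defs)
  have pf: "pf a c = (\<Sum>b\<in>?G. p a b c)" for a c
    using prob_fibre_pair[OF simple_function_Pair[OF f h] g, of "(a, c)"] by (simp add: defs conj_ac)
  have pg: "pg b c = (\<Sum>a\<in>?F. p a b c)" for b c
    using prob_fibre_pair[OF simple_function_Pair[OF g h] f, of "(b, c)"] by (simp add: defs conj_ac)
  have ph_f: "ph c = (\<Sum>a\<in>?F. pf a c)" for c
    using prob_fibre_pair[OF h f, of c] by (simp add: defs conj_ac)
  have ph_g: "ph c = (\<Sum>b\<in>?G. pg b c)" for c
    using prob_fibre_pair[OF h g, of c] by (simp add: defs conj_ac)
  have total: "(\<Sum>c\<in>?H. ph c) = 1"
  proof -
    have "simple_function M (\<lambda>_. ())" by simp
    from prob_fibre_pair[OF this h, of "()"] show ?thesis by (simp add: defs prob_space)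
  qed
  have ph_pf: "ph c = (\<Sum>a\<in>?F. \<Sum>b\<in>?G. p a b c)" for c by (simp add: ph_f pf)
  have e_fgh: "fun_entropy M (\<lambda>x. (f x, g x, h x)) = - (\<Sum>a\<in>?F. \<Sum>b\<in>?G. \<Sum>c\<in>?H. p a b c * ln (p a b c))"
    by (simp only: fun_entropy_Pair3_sum[OF f g h] prod.inject p_def)
  have e_fh: "fun_entropy M (\<lambda>x. (f x, h x)) = - (\<Sum>a\<in>?F. \<Sum>b\<in>?G. \<Sum>c\<in>?H. p a b c * ln (pf a c))"
  proof -
    have "fun_entropy M (\<lambda>x. (f x, h x)) = - (\<Sum>a\<in>?F. \<Sum>c\<in>?H. pf a c * ln (pf a c))"
      by (simp only: fun_entropy_Pair_sum[OF f h] prod.inject pf_def)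
    also have "(\<Sum>a\<in>?F. \<Sum>c\<in>?H. pf a c * ln (pf a c)) = (\<Sum>a\<in>?F. \<Sum>c\<in>?H. \<Sum>b\<in>?G. p a b c * ln (pf a c))"
      by (intro sum.cong refl) (simp only: sum_distrib_right[symmetric] pf)
    also have "\<dots> = (\<Sum>a\<in>?F. \<Sum>b\<in>?G. \<Sum>c\<in>?H. p a b c * ln (pf a c))"
      by (intro sum.cong refl sum.swap)
    finally show ?thesis .
  qed
  have e_gh: "fun_entropy M (\<lambda>x. (g x, h x)) = - (\<Sum>a\<in>?F. \<Sum>b\<in>?G. \<Sum>c\<in>?H. p a b c * ln (pg b c))"
  proof -
    have "fun_entropy M (\<lambda>x. (g x, h x)) = - (\<Sum>b\<in>?G. \<Sum>c\<in>?H. pg b c * ln (pg b c))"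
      by (simp only: fun_entropy_Pair_sum[OF g h] prod.inject pg_def)
    also have "(\<Sum>b\<in>?G. \<Sum>c\<in>?H. pg b c * ln (pg b c)) = (\<Sum>b\<in>?G. \<Sum>c\<in>?H. \<Sum>a\<in>?F. p a b c * ln (pg b c))"
      by (intro sum.cong refl) (simp only: sum_distrib_right[symmetric] pg)
    also have "\<dots> = (\<Sum>b\<in>?G. \<Sum>a\<in>?F. \<Sum>c\<in>?H. p a b c * ln (pg b c))"
      by (intro sum.cong refl sum.swap)
    also have "\<dots> = (\<Sum>a\<in>?F. \<Sum>b\<in>?G. \<Sum>c\<in>?H. p a b c * ln (pg b c))"
      by (rule sum.swap)
    finally show ?thesis .
  qed
  have e_h: "fun_entropy M h = - (\<Sum>a\<in>?F. \<Sum>b\<in>?G. \<Sum>c\<in>?H. p a b c * ln (ph c))"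
  proof -
    have "fun_entropy M h = - (\<Sum>c\<in>?H. ph c * ln (ph c))"
      using fin by (subst fun_entropy_sum[of ?H]) (auto simp: ph_def)
    also have "(\<Sum>c\<in>?H. ph c * ln (ph c)) = (\<Sum>c\<in>?H. \<Sum>a\<in>?F. \<Sum>b\<in>?G. p a b c * ln (ph c))"
      by (intro sum.cong refl) (simp only: sum_distrib_right[symmetric] ph_pf)
    also have "\<dots> = (\<Sum>a\<in>?F. \<Sum>c\<in>?H. \<Sum>b\<in>?G. p a b c * ln (ph c))"
      by (rule sum.swap)
    also have "\<dots> = (\<Sum>a\<in>?F. \<Sum>b\<in>?G. \<Sum>c\<in>?H. p a b c * ln (ph c))"
      by (intro sum.cong refl sum.swap)
    finally show ?thesis .
  qed
  \<comment> \<open>At \<open>p a b c = 0\<close> the left side is 0 whatever the logarithms are,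
    and the right side is nonnegative; otherwise all marginals are positive.\<close>
  have term_le: "p a b c * (ln (pf a c) + ln (pg b c) - ln (ph c) - ln (p a b c)) \<le>
      pf a c * pg b c / ph c - p a b c" if "a \<in> ?F" "b \<in> ?G" "c \<in> ?H" for a b c
  proof (cases "p a b c = 0")
    case False
    then have 0: "0 < p a b c" using nn(1)[of a b c] by simp
    have "p a b c \<le> pf a c" unfolding pf by (rule member_le_sum) (use that fin nn in auto)
    moreover have "p a b c \<le> pg b c" unfolding pg by (rule member_le_sum) (use that fin nn in auto)
    moreover have "pf a c \<le> ph c" unfolding ph_f by (rule member_le_sum) (use that fin nn in auto)
    ultimately have pos: "0 < pf a c" "0 < pg b c" "0 < ph c" using 0 by auto
    have "ln (pf a c) + ln (pg b c) - ln (ph c) - ln (p a b c) = ln (pf a c * pg b c / ph c / p a b c)"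
      using pos 0 by (simp add: ln_mult_pos ln_divide_pos)
    also have "\<dots> \<le> pf a c * pg b c / ph c / p a b c - 1"
      by (rule ln_le_minus_one) (use pos 0 in simp)
    finally have "p a b c * (ln (pf a c) + ln (pg b c) - ln (ph c) - ln (p a b c)) \<le>
        p a b c * (pf a c * pg b c / ph c / p a b c - 1)"
      using 0 by (intro mult_left_mono) auto
    also have "\<dots> = pf a c * pg b c / ph c - p a b c" using 0 by (simp add: right_diff_distrib)
    finally show ?thesis .
  qed (use nn in simp)
  have "(\<Sum>a\<in>?F. \<Sum>b\<in>?G. \<Sum>c\<in>?H. p a b c * (ln (pf a c) + ln (pg b c) - ln (ph c) - ln (p a b c))) \<le>
      (\<Sum>a\<in>?F. \<Sum>b\<in>?G. \<Sum>c\<in>?H. pf a c * pg b c / ph c - p a b c)"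
    by (intro sum_mono term_le)
  also have "\<dots> = (\<Sum>a\<in>?F. \<Sum>b\<in>?G. \<Sum>c\<in>?H. pf a c * pg b c / ph c) - (\<Sum>a\<in>?F. \<Sum>b\<in>?G. \<Sum>c\<in>?H. p a b c)"
    by (simp add: sum_subtractf)
  also have "(\<Sum>a\<in>?F. \<Sum>b\<in>?G. \<Sum>c\<in>?H. pf a c * pg b c / ph c) =
      (\<Sum>c\<in>?H. \<Sum>a\<in>?F. \<Sum>b\<in>?G. pf a c * pg b c / ph c)"
    by (subst (2) sum.swap) (simp only: sum.swap[of _ ?H ?G])
  also have "\<dots> = (\<Sum>c\<in>?H. ph c)"
  proof (rule sum.cong[OF refl])
    fix c
    have "(\<Sum>a\<in>?F. \<Sum>b\<in>?G. pf a c * pg b c / ph c) = (\<Sum>a\<in>?F. pf a c) * (\<Sum>b\<in>?G. pg b c) / ph c"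
      by (simp only: sum_product sum_divide_distrib)
    also have "\<dots> = ph c" by (simp add: ph_f[symmetric] ph_g[symmetric])
    finally show "(\<Sum>a\<in>?F. \<Sum>b\<in>?G. pf a c * pg b c / ph c) = ph c" .
  qed
  also have "(\<Sum>a\<in>?F. \<Sum>b\<in>?G. \<Sum>c\<in>?H. p a b c) = (\<Sum>c\<in>?H. ph c)"
    unfolding ph_pf by (subst (2) sum.swap) (simp only: sum.swap[of _ ?H ?G])
  finally show ?thesis
    unfolding e_fgh e_fh e_gh e_h
    by (simp add: algebra_simps sum.distrib sum_subtractf)
qed

lemma fun_entropy_const: "fun_entropy M (\<lambda>_. c) = 0"
  by (subst fun_entropy_sum[of "{c}"]) (auto simp: prob_space)

lemma fun_entropy_subadditive:
  assumes f: "simple_function M f" and g: "simple_function M g"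
  shows "fun_entropy M (\<lambda>x. (f x, g x)) \<le> fun_entropy M f + fun_entropy M g"
proof -
  have "fun_entropy M (\<lambda>x. (f x, g x, ())) + fun_entropy M (\<lambda>_. ()) \<le>
        fun_entropy M (\<lambda>x. (f x, ())) + fun_entropy M (\<lambda>x. (g x, ()))"
    by (rule fun_entropy_strong_subadditive[OF f g]) simp
  moreover have "fun_entropy M (\<lambda>x. (f x, g x, ())) = fun_entropy M (\<lambda>x. (f x, g x))"
    "fun_entropy M (\<lambda>x. (f x, ())) = fun_entropy M f" "fun_entropy M (\<lambda>x. (g x, ())) = fun_entropy M g"
    by (auto intro!: fun_entropy_cong)
  ultimately show ?thesis by (simp add: fun_entropy_const)
qed

lemma cond_entropy_Pair:
  assumes "simple_function M f" "simple_function M g" "simple_function M h"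
  shows "cond_entropy M (\<lambda>x. (f x, g x)) h \<le> cond_entropy M f h + cond_entropy M g h"
proof -
  have "fun_entropy M (\<lambda>x. ((f x, g x), h x)) = fun_entropy M (\<lambda>x. (f x, g x, h x))"
    by (rule fun_entropy_cong) auto
  then show ?thesis
    using fun_entropy_strong_subadditive[OF assms] by (simp add: cond_entropy_def)
qed

text \<open>Pairing with \<open>g\<close> absorbs the \<open>h\<close> it determines; strong
  subadditivity then says that finer information lowers conditional entropy.\<close>

lemma cond_entropy_antimono:
  assumes "simple_function M f" "simple_function M g" "simple_function M h"
    and det: "\<And>x y. x \<in> space M \<Longrightarrow> y \<in> space M \<Longrightarrow> g x = g y \<Longrightarrow> h x = h y"
  shows "cond_entropy M f g \<le> cond_entropy M f h"
proof -
  have "fun_entropy M (\<lambda>x. (f x, g x, h x)) = fun_entropy M (\<lambda>x. (f x, g x))"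
    "fun_entropy M (\<lambda>x. (g x, h x)) = fun_entropy M g"
    by (rule fun_entropy_cong, unfold prod.inject, blast intro: det)+
  then show ?thesis
    using fun_entropy_strong_subadditive[OF assms(1-3)] by (simp add: cond_entropy_def)
qed

lemma cond_entropy_mono:
  assumes "simple_function M f" "simple_function M g" "simple_function M h"
    and det: "\<And>x y. x \<in> space M \<Longrightarrow> y \<in> space M \<Longrightarrow> f x = f y \<Longrightarrow> h x = h y \<Longrightarrow> g x = g y"
  shows "cond_entropy M g h \<le> cond_entropy M f h"
proof -
  have "fun_entropy M (\<lambda>x. (g x, h x)) \<le> fun_entropy M (\<lambda>x. (f x, h x))"
    by (rule fun_entropy_mono[OF simple_function_Pair[OF assms(1,3)] simple_function_Pair[OF assms(2,3)]])
      (unfold prod.inject, blast intro: det)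
  then show ?thesis by (simp add: cond_entropy_def)
qed

lemma cond_entropy_le:
  assumes "simple_function M f" "simple_function M g"
  shows "cond_entropy M f g \<le> fun_entropy M f"
  using fun_entropy_subadditive[OF assms] by (simp add: cond_entropy_def)

lemma fun_entropy_nonneg: "simple_function M f \<Longrightarrow> 0 \<le> fun_entropy M f"
  using fun_entropy_mono[of f "\<lambda>_. ()"] by (simp add: fun_entropy_const)

text \<open>The bound is there to make the entropy small with the probability. For the first term,
  \<open>ln x \<le> x - 1\<close> at \<open>1 / sqrt a\<close> is weak enough to be beaten by the
  factor \<open>a\<close>; the second term is at most \<open>a\<close>.\<close>

lemma fun_entropy_indicator:
  assumes A: "A \<in> events"
  shows "fun_entropy M (\<lambda>x. x \<in> A) \<le> 3 * sqrt (prob A)"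
proof -
  define a where "a = prob A"
  have a: "0 \<le> a" "a \<le> 1" by (auto simp: a_def)
  have AS: "A \<subseteq> space M" using A sets.sets_into_space by auto
  have 1: "{x \<in> space M. x \<in> A} = A" using AS by auto
  have 2: "{x \<in> space M. x \<notin> A} = space M - A" by auto
  have "fun_entropy M (\<lambda>x. x \<in> A) = - (a * ln a + (1 - a) * ln (1 - a))"
    using 1 2 prob_compl[OF A] by (subst fun_entropy_sum[of UNIV]) (auto simp: UNIV_bool a_def)
  also have "- (a * ln a) \<le> 2 * sqrt a"
  proof (cases "a = 0")
    case False
    then have "0 < a" using a by simp
    have "ln (1 / sqrt a) \<le> 1 / sqrt a - 1" using \<open>0 < a\<close> by (intro ln_le_minus_one) simp
    then have "- ln a \<le> 2 * (1 / sqrt a)" using \<open>0 < a\<close> by (simp add: ln_divide_pos ln_sqrt)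
    then have "a * (- ln a) \<le> a * (2 * (1 / sqrt a))" using a by (intro mult_left_mono) auto
    also have "\<dots> = 2 * (a / sqrt a)" by simp
    also have "\<dots> = 2 * sqrt a" using a by (simp only: real_div_sqrt)
    finally show ?thesis by simp
  qed simp
  moreover have "- ((1 - a) * ln (1 - a)) \<le> a"
  proof (cases "a = 1")
    case False
    then have "a < 1" using a by simp
    have "ln (1 / (1 - a)) \<le> 1 / (1 - a) - 1" using \<open>a < 1\<close> by (intro ln_le_minus_one) simp
    then have "(1 - a) * (- ln (1 - a)) \<le> (1 - a) * (1 / (1 - a) - 1)"
      using \<open>a < 1\<close> by (intro mult_left_mono) (auto simp: ln_divide_pos)
    also have "\<dots> = a" using \<open>a < 1\<close> by (simp add: field_simps)
    finally show ?thesis by simp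
  qed simp
  moreover have "a \<le> sqrt a" using a real_sqrt_le_iff[of "a\<^sup>2" a] power2_eq_square[of a] mult_left_le[of a a]
    by (simp add: real_le_rsqrt)
  ultimately show ?thesis by (simp add: a_def)
qed

text \<open>Membership in \<open>A\<close> is recovered from membership in \<open>C\<close> and in
  the symmetric difference, so only the entropy of the latter counts.\<close>

lemma cond_entropy_indicator:
  assumes A: "A \<in> events" and C: "C \<in> events"
  shows "cond_entropy M (\<lambda>x. x \<in> A) (\<lambda>x. x \<in> C) \<le> 3 * sqrt (prob (A - C \<union> (C - A)))"
proof -
  have s: "simple_function M (\<lambda>x. x \<in> B)" if "B \<in> events" for B
    using that by (rule simple_function_mem)
  let ?D = "A - C \<union> (C - A)"
  have D: "?D \<in> events" using A C by auto
  have "cond_entropy M (\<lambda>x. x \<in> A) (\<lambda>x. x \<in> C) \<le> cond_entropy M (\<lambda>x. x \<in> ?D) (\<lambda>x. x \<in> C)"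
    by (rule cond_entropy_mono[OF s[OF D] s[OF A] s[OF C]]) blast
  also have "\<dots> \<le> fun_entropy M (\<lambda>x. x \<in> ?D)" by (rule cond_entropy_le[OF s[OF D] s[OF C]])
  also have "\<dots> \<le> 3 * sqrt (prob ?D)" by (rule fun_entropy_indicator[OF D])
  finally show ?thesis .
qed

end

section \<open>Entropy of itineraries\<close>

text \<open>Fekete's lemma. That the limit is also a lower bound of every quotient is what later
  keeps error terms out of the entropy inequality.\<close>

lemma subadditive_convergent:
  fixes a :: "nat \<Rightarrow> real"
  assumes sub: "\<And>m n. a (m + n) \<le> a m + a n" and nonneg: "\<And>n. 0 \<le> a n"
  shows "\<exists>L. (\<lambda>n. a n / real n) \<longlonglongrightarrow> L \<and> (\<forall>n\<ge>1. L \<le> a n / real n)"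
proof -
  define S where "S = (\<lambda>n. a n / real n) ` {1..}"
  have bdd: "bdd_below S" by (rule bdd_belowI[of _ 0]) (auto simp: S_def nonneg)
  define L where "L = Inf S"
  have L: "L \<le> a n / real n" if "n \<ge> 1" for n
    unfolding L_def using that by (intro cInf_lower bdd) (auto simp: S_def)
  have mult: "a (q * m) \<le> real q * a m + a 0" for q m
  proof (induction q)
    case (Suc q)
    then show ?case using sub[of m "q * m"] by (simp add: algebra_simps)
  qed simp
  have "(\<lambda>n. a n / real n) \<longlonglongrightarrow> L"
  proof (rule LIMSEQ_I)
    fix e :: real assume "e > 0"
    have "\<exists>s\<in>S. s < L + e / 2"
      using \<open>e > 0\<close> cInf_lessD[of S "L + e / 2"] by (auto simp: L_def S_def)
    then obtain m where m: "m \<ge> 1" "a m / real m < L + e / 2" by (auto simp: S_def)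
    \<comment> \<open>One constant for all remainders modulo \<open>m\<close>; \<open>a 0\<close> is
      included because subadditivity allows it to be positive.\<close>
    define b where "b = a 0 + (\<Sum>r<m. a r)"
    obtain N :: nat where N: "2 * b / e < real N" using reals_Archimedean2 by blast
    show "\<exists>no. \<forall>n\<ge>no. norm (a n / real n - L) < e"
    proof (intro exI[of _ "max N 1"] allI impI)
      fix n assume n: "n \<ge> max N 1"
      define q r where "q = n div m" and "r = n mod m"
      have nqr: "n = q * m + r" "r < m" using m(1) by (auto simp: q_def r_def)
      have "a r \<le> (\<Sum>r<m. a r)" by (rule member_le_sum) (use nqr nonneg in auto)
      then have "a n \<le> real q * a m + b"
        using sub[of "q * m" r] mult[of q m] nqr(1) by (simp add: b_def)
      also have "real q * a m = real (q * m) * (a m / real m)" using m(1) by simp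
      also have "\<dots> \<le> real n * (a m / real m)"
        using nqr(1) nonneg[of m] by (intro mult_right_mono) auto
      also have "\<dots> \<le> real n * (L + e / 2)" using m(2) by (intro mult_left_mono) auto
      finally have "a n / real n \<le> L + e / 2 + b / real n"
        using n by (simp add: divide_simps mult_ac)
      also have "b / real n < e / 2"
      proof -
        have "2 * b / e < real n" using N n by simp
        then show ?thesis using \<open>e > 0\<close> n by (simp add: divide_simps mult_ac)
      qed
      finally show "norm (a n / real n - L) < e" using L[of n] n by (simp add: abs_less_iff)
    qed
  qed
  with L show ?thesis by blast
qed

lemma itinerary_0 [simp]: "itinerary f T 0 x = []"
  by (simp add: itinerary_def)

lemma itinerary_Suc: "itinerary f T (Suc n) x = itinerary f T n x @ [f ((T ^^ n) x)]"
  by (simp add: itinerary_def)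

lemma length_itinerary [simp]: "length (itinerary f T n x) = n"
  by (simp add: itinerary_def)

lemma itinerary_add: "itinerary f T (m + n) x = itinerary f T m x @ itinerary f T n ((T ^^ m) x)"
proof (induction n)
  case (Suc n)
  have "(T ^^ (m + n)) x = (T ^^ n) ((T ^^ m) x)"
    by (metis add.commute comp_apply funpow_add)
  with Suc show ?case by (simp add: itinerary_Suc)
qed simp

lemma funpow_measurable: "T \<in> measurable M M \<Longrightarrow> T ^^ n \<in> measurable M M"
proof (induction n)
  case (Suc n)
  then show ?case using measurable_comp[of "T ^^ n" M M T M] by simp
qed simp

lemma distr_funpow:
  assumes "T \<in> measurable M M" "distr M M T = M"
  shows "distr M M (T ^^ n) = M"
proof (induction n)
  case (Suc n)
  have "distr M M (T ^^ Suc n) = distr (distr M M (T ^^ n)) M T"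
    using distr_distr[OF assms(1) funpow_measurable[OF assms(1), of n]] by simp
  also have "\<dots> = M" by (simp only: Suc assms(2))
  finally show ?case .
qed (simp add: distr_id)

lemma simple_function_itinerary:
  assumes "simple_function M f" "T \<in> measurable M M"
  shows "simple_function M (itinerary f T n)"
proof (induction n)
  case (Suc n)
  have "simple_function M (\<lambda>x. f ((T ^^ n) x))"
    by (rule simple_function_comp[OF funpow_measurable[OF assms(2)] assms(1)])
  from simple_function_compose2[OF Suc this, of "\<lambda>v b. v @ [b]"] show ?case
    by (simp add: itinerary_Suc[abs_def])
qed (simp add: itinerary_def[abs_def])

text \<open>The map \<open>\<lambda>x. {A \<in> Q. x \<in> A}\<close> names the cell of a point as a
  singleton and so turns the partition into a function. The cells of the iterated join are then the
  nonempty sets of points with a common itinerary.\<close>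

lemma fibres_itinerary:
  assumes Q: "finite_partition M Q" and T: "T \<in> measurable M M"
  shows "iterated_join M T Q n = fibres M (itinerary (\<lambda>x. {A \<in> Q. x \<in> A}) T n)"
proof -
  let ?q = "\<lambda>x. {A \<in> Q. x \<in> A}"
  have part: "partition_on (space M) Q" using Q by (simp add: finite_partition_def)
  have uniq: "?q x = {A} \<longleftrightarrow> x \<in> A" if "A \<in> Q" for x A
  proof -
    have "B = A" if "x \<in> A" "x \<in> B" "B \<in> Q" for B
      using part that \<open>A \<in> Q\<close> unfolding partition_on_def disjoint_def by blast
    then show ?thesis using \<open>A \<in> Q\<close> by blast
  qed
  have ex: "\<exists>A\<in>Q. x \<in> A" if "x \<in> space M" for x
    using part that by (auto simp: partition_on_def)
  have sp: "(T ^^ i) x \<in> space M" if "x \<in> space M" for i x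
    using measurable_space[OF funpow_measurable[OF T] that] .
  have cell: "space M \<inter> (\<Inter>i<n. (T ^^ i) -` p i) = {y \<in> space M. itinerary ?q T n y = map (\<lambda>i. {p i}) [0..<n]}"
    if "\<forall>i<n. p i \<in> Q" for p
    using that by (auto simp: itinerary_def uniq)
  show ?thesis
  proof (intro equalityI subsetI)
    fix C assume "C \<in> iterated_join M T Q n"
    then obtain p where p: "\<forall>i<n. p i \<in> Q" "C = space M \<inter> (\<Inter>i<n. (T ^^ i) -` p i)" "C \<noteq> {}"
      by (auto simp: iterated_join_def)
    then obtain x where x: "x \<in> space M" "itinerary ?q T n x = map (\<lambda>i. {p i}) [0..<n]"
      using cell[OF p(1)] by auto
    have "C = {y \<in> space M. itinerary ?q T n y = itinerary ?q T n x}"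
      unfolding p(2) cell[OF p(1)] x(2) ..
    then show "C \<in> fibres M (itinerary ?q T n)" using x(1) by (auto simp: fibres_def)
  next
    fix C assume "C \<in> fibres M (itinerary ?q T n)"
    then obtain x where x: "x \<in> space M" "C = {y \<in> space M. itinerary ?q T n y = itinerary ?q T n x}"
      by (auto simp: fibres_def)
    have "\<forall>i. \<exists>A\<in>Q. (T ^^ i) x \<in> A" using ex sp[OF x(1)] by blast
    then obtain p where p: "\<And>i. p i \<in> Q" "\<And>i. (T ^^ i) x \<in> p i" by metis
    then have "itinerary ?q T n x = map (\<lambda>i. {p i}) [0..<n]"
      by (auto simp: itinerary_def uniq)
    then have "C = space M \<inter> (\<Inter>i<n. (T ^^ i) -` p i)"
      using cell[of p] p(1) x(2) by simp
    moreover have "C \<noteq> {}" using x by auto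
    ultimately show "C \<in> iterated_join M T Q n"
      unfolding iterated_join_def using p(1) by blast
  qed
qed

section \<open>Itineraries under a measure-preserving map\<close>

context prob_space
begin

lemma fun_entropy_comp:
  assumes f: "simple_function M f" and T: "T \<in> measurable M M" "distr M M T = M"
  shows "fun_entropy M (\<lambda>x. f (T x)) = fun_entropy M f"
proof -
  have fin: "finite (f ` space M)" by (rule simple_functionD(1)[OF f])
  have sub: "(\<lambda>x. f (T x)) ` space M \<subseteq> f ` space M"
    using measurable_space[OF T(1)] by blast
  have "prob {x \<in> space M. f (T x) = v} = prob {x \<in> space M. f x = v}" for v
  proof -
    have "{x \<in> space M. f x = v} = f -` {v} \<inter> space M" by auto
    then have ev: "{x \<in> space M. f x = v} \<in> events" using simple_functionD(2)[OF f] by simp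
    have "prob {x \<in> space M. f x = v} = measure (distr M M T) {x \<in> space M. f x = v}"
      by (simp only: T(2))
    also have "\<dots> = prob (T -` {x \<in> space M. f x = v} \<inter> space M)"
      by (rule measure_distr[OF T(1) ev])
    also have "T -` {x \<in> space M. f x = v} \<inter> space M = {x \<in> space M. f (T x) = v}"
      using measurable_space[OF T(1)] by auto
    finally show ?thesis ..
  qed
  then show ?thesis
    by (simp only: fun_entropy_sum[OF fin sub] fun_entropy_sum[OF fin order_refl])
qed

lemma fun_entropy_itinerary_add:
  assumes f: "simple_function M f" and T: "T \<in> measurable M M" "distr M M T = M"
  shows "fun_entropy M (itinerary f T (m + n)) \<le>
         fun_entropy M (itinerary f T m) + fun_entropy M (itinerary f T n)"
proof -
  let ?g = "\<lambda>x. itinerary f T n ((T ^^ m) x)"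
  have g: "simple_function M ?g"
    by (rule simple_function_comp[OF funpow_measurable[OF T(1)] simple_function_itinerary[OF f T(1)]])
  have "fun_entropy M (itinerary f T (m + n)) = fun_entropy M (\<lambda>x. (itinerary f T m x, ?g x))"
    by (rule fun_entropy_cong) (simp add: itinerary_add)
  also have "\<dots> \<le> fun_entropy M (itinerary f T m) + fun_entropy M ?g"
    by (rule fun_entropy_subadditive[OF simple_function_itinerary[OF f T(1)] g])
  also have "fun_entropy M ?g = fun_entropy M (itinerary f T n)"
    by (rule fun_entropy_comp[OF simple_function_itinerary[OF f T(1)] funpow_measurable[OF T(1)] distr_funpow[OF T]])
  finally show ?thesis .
qed

text \<open>Each step adds the value of \<open>f\<close> at time \<open>n\<close>, and it is enough
  to condition it on the value of \<open>g\<close> at the same time. By invariance the price of a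
  step does not depend on \<open>n\<close>.\<close>

lemma cond_entropy_itinerary:
  assumes f: "simple_function M f" and g: "simple_function M g"
    and T: "T \<in> measurable M M" "distr M M T = M"
  shows "cond_entropy M (itinerary f T n) (itinerary g T n) \<le> real n * cond_entropy M f g"
proof (induction n)
  case 0
  have "fun_entropy M (\<lambda>x. (itinerary f T 0 x, itinerary g T 0 x)) = fun_entropy M (itinerary g T 0)"
    by (rule fun_entropy_cong) simp
  then show ?case
    by (simp only: cond_entropy_def diff_self of_nat_0 mult_zero_left order_refl)
next
  case (Suc n)
  note s = simple_function_itinerary[OF _ T(1)]
  let ?f = "\<lambda>x. f ((T ^^ n) x)" and ?g = "\<lambda>x. g ((T ^^ n) x)"
  have fT: "simple_function M ?f" and gT: "simple_function M ?g"
    by (rule simple_function_comp[OF funpow_measurable[OF T(1)]], fact)+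
  have "cond_entropy M (itinerary f T (Suc n)) (itinerary g T (Suc n)) \<le>
      cond_entropy M (\<lambda>x. (itinerary f T n x, ?f x)) (itinerary g T (Suc n))"
    by (rule cond_entropy_mono[OF simple_function_Pair[OF s[OF f] fT] s[OF f] s[OF g]])
      (simp add: itinerary_Suc)
  also have "\<dots> \<le> cond_entropy M (itinerary f T n) (itinerary g T (Suc n)) +
      cond_entropy M ?f (itinerary g T (Suc n))"
    by (rule cond_entropy_Pair[OF s[OF f] fT s[OF g]])
  also have "cond_entropy M (itinerary f T n) (itinerary g T (Suc n)) \<le>
      cond_entropy M (itinerary f T n) (itinerary g T n)"
    by (rule cond_entropy_antimono[OF s[OF f] s[OF g] s[OF g]]) (simp add: itinerary_Suc)
  also have "cond_entropy M ?f (itinerary g T (Suc n)) \<le> cond_entropy M ?f ?g"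
    by (rule cond_entropy_antimono[OF fT s[OF g] gT]) (simp add: itinerary_Suc)
  also have "cond_entropy M ?f ?g = cond_entropy M f g"
    using fun_entropy_comp[OF simple_function_Pair[OF f g] funpow_measurable[OF T(1)] distr_funpow[OF T], of n]
      fun_entropy_comp[OF g funpow_measurable[OF T(1)] distr_funpow[OF T], of n]
    by (simp add: cond_entropy_def)
  finally show ?case using Suc by (simp add: algebra_simps)
qed

text \<open>The set of members containing a point is determined by finitely many indicators, so
  conditional subadditivity applies. Approximating a partition thus reduces to approximating its
  cells one at a time.\<close>

lemma cond_entropy_members:
  assumes F: "finite F" "F \<subseteq> events" and g: "simple_function M g"
  shows "simple_function M (\<lambda>x. {A \<in> F. x \<in> A}) \<and>
    cond_entropy M (\<lambda>x. {A \<in> F. x \<in> A}) g \<le> (\<Sum>A\<in>F. cond_entropy M (\<lambda>x. x \<in> A) g)"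
  using F
proof (induction F rule: finite_induct)
  case empty
  have "fun_entropy M (\<lambda>x. ({A \<in> {}. x \<in> A}, g x)) = fun_entropy M g"
    by (rule fun_entropy_cong) simp
  then show ?case by (simp add: cond_entropy_def)
next
  case (insert A F)
  let ?h = "\<lambda>x. {B \<in> F. x \<in> B}"
  have eq: "(\<lambda>x. {B \<in> insert A F. x \<in> B}) = (\<lambda>x. (if x \<in> A then insert A (?h x) else ?h x))"
    by (rule ext) auto
  have A: "A \<in> events" and h: "simple_function M ?h"
    and IH: "cond_entropy M ?h g \<le> (\<Sum>A\<in>F. cond_entropy M (\<lambda>x. x \<in> A) g)" using insert by auto
  note sA = simple_function_mem[OF A]
  have s: "simple_function M (\<lambda>x. {B \<in> insert A F. x \<in> B})"
    using simple_function_compose2[OF sA h, of "\<lambda>b S. if b then insert A S else S"]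
    unfolding eq .
  have "cond_entropy M (\<lambda>x. {B \<in> insert A F. x \<in> B}) g \<le> cond_entropy M (\<lambda>x. (x \<in> A, ?h x)) g"
    by (rule cond_entropy_mono[OF simple_function_Pair[OF sA h] s g]) auto
  also have "\<dots> \<le> cond_entropy M (\<lambda>x. x \<in> A) g + cond_entropy M ?h g"
    by (rule cond_entropy_Pair[OF sA h g])
  finally show ?case using insert.hyps IH s by simp
qed

text \<open>The operator \<open>lim\<close> is informative only along a convergent sequence;
  Fekete's lemma provides the convergence.\<close>

lemma entropy_wrt_partition_limit:
  assumes Q: "finite_partition M Q" and T: "T \<in> measurable M M" "distr M M T = M"
  shows "(\<lambda>n. fun_entropy M (itinerary (\<lambda>x. {A \<in> Q. x \<in> A}) T n) / real n) \<longlonglongrightarrow>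
           entropy_wrt_partition M T Q"
    and "simple_function M (\<lambda>x. {A \<in> Q. x \<in> A})"
proof -
  let ?q = "\<lambda>x. {A \<in> Q. x \<in> A}"
  have "finite Q" "Q \<subseteq> events" using Q by (auto simp: finite_partition_def)
  then show q: "simple_function M ?q"
    using cond_entropy_members[of Q "\<lambda>_. ()"] by simp
  have "\<exists>L. (\<lambda>n. fun_entropy M (itinerary ?q T n) / real n) \<longlonglongrightarrow> L"
    using subadditive_convergent[of "\<lambda>n. fun_entropy M (itinerary ?q T n)"]
      fun_entropy_itinerary_add[OF q T] fun_entropy_nonneg[OF simple_function_itinerary[OF q T(1)]] by blast
  then obtain L where L: "(\<lambda>n. fun_entropy M (itinerary ?q T n) / real n) \<longlonglongrightarrow> L" ..
  have "entropy_wrt_partition M T Q = L"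
    unfolding entropy_wrt_partition_def fibres_itinerary[OF Q T(1)]
    using L by (intro limI) (simp add: fun_entropy_def)
  with L show "(\<lambda>n. fun_entropy M (itinerary ?q T n) / real n) \<longlonglongrightarrow> entropy_wrt_partition M T Q"
    by simp
qed

end

section \<open>Block entropy of invariant measures\<close>

text \<open>The log sum inequality: merging the elements of \<open>S\<close> does not increase
  relative entropy. It follows from \<open>ln x \<le> x - 1\<close> once \<open>q\<close> is
  rescaled by \<open>c\<close> to the total mass of \<open>p\<close>.\<close>

lemma log_sum:
  fixes p q :: "'b \<Rightarrow> real"
  assumes "finite S" and p: "\<And>s. s \<in> S \<Longrightarrow> 0 \<le> p s" and q: "\<And>s. s \<in> S \<Longrightarrow> 0 \<le> q s"
    and pq: "\<And>s. s \<in> S \<Longrightarrow> 0 < p s \<Longrightarrow> 0 < q s" and pos: "0 < sum p S"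
  shows "0 < sum q S" "sum p S * (ln (sum p S) - ln (sum q S)) \<le> (\<Sum>s\<in>S. p s * (ln (p s) - ln (q s)))"
proof -
  obtain s where s: "s \<in> S" "0 < p s"
    using pos p by (metis less_le not_less sum_nonpos)
  then have "0 < q s" using pq by blast
  also have "q s \<le> sum q S" by (rule member_le_sum) (use s q assms(1) in auto)
  finally show Q: "0 < sum q S" .
  define c where "c = sum p S / sum q S"
  have c: "0 < c" using Q pos by (simp add: c_def)
  have "p s * ln c + (p s - c * q s) \<le> p s * (ln (p s) - ln (q s))" if "s \<in> S" for s
  proof (cases "p s = 0")
    case True
    then show ?thesis using q[OF that] c by simp
  next
    case False
    then have ps: "0 < p s" "0 < q s" using p[OF that] pq[OF that] by auto
    have "ln (c * q s / p s) \<le> c * q s / p s - 1"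
      by (rule ln_le_minus_one) (use ps c in simp)
    then have "p s * (ln c + ln (q s) - ln (p s)) \<le> p s * (c * q s / p s - 1)"
      using ps c by (intro mult_left_mono) (auto simp: ln_mult_pos ln_divide_pos)
    then show ?thesis using ps by (simp add: algebra_simps)
  qed
  then have "(\<Sum>s\<in>S. p s * ln c + (p s - c * q s)) \<le> (\<Sum>s\<in>S. p s * (ln (p s) - ln (q s)))"
    by (rule sum_mono)
  also have "(\<Sum>s\<in>S. p s * ln c + (p s - c * q s)) = sum p S * ln c + (sum p S - c * sum q S)"
    by (simp add: sum.distrib sum_subtractf sum_distrib_left sum_distrib_right)
  also have "\<dots> = sum p S * (ln (sum p S) - ln (sum q S))"
    using Q pos by (simp add: c_def ln_divide_pos)
  finally show "sum p S * (ln (sum p S) - ln (sum q S)) \<le> (\<Sum>s\<in>S. p s * (ln (p s) - ln (q s)))" .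
qed

lemma xlnx_ge: "0 \<le> x \<Longrightarrow> - 1 \<le> x * ln (x::real)"
proof (cases "x = 0")
  case False
  assume "0 \<le> x"
  then have x: "0 < x" using False by simp
  have "ln (1 / x) \<le> 1 / x - 1" by (rule ln_le_minus_one) (use x in simp)
  then have "x * - ln x \<le> x * (1 / x - 1)" using x by (intro mult_left_mono) (auto simp: ln_divide_pos)
  then show ?thesis using x by (simp add: algebra_simps)
qed simp

locale invariant_prob = subshift X + prob_space \<mu>
  for X :: "(int \<Rightarrow> 'a::finite) set" and \<mu> :: "(int \<Rightarrow> 'a) measure" +
  assumes invariant: "invariant_measure X \<mu>"
begin

lemma space_eq: "space \<mu> = X" and sets_eq: "sets \<mu> = sets (Borel_on X)"
  and shift_measurable: "shift \<in> measurable \<mu> \<mu>" and shift_preserving: "distr \<mu> \<mu> shift = \<mu>"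
  using invariant by (auto simp: invariant_measure_def)

lemma block_event: "{x \<in> X. block x i j = w} \<in> events" "{x \<in> X. block x i j \<in> W} \<in> events"
  by (simp_all add: sets_eq sets_Borel_on_block sets_Borel_on_block_in)

lemma prob_block_translate_nat:
  "prob {x \<in> X. block x (i + int k) (j + int k) \<in> W} = prob {x \<in> X. block x i j \<in> W}"
proof -
  have "prob {x \<in> X. block x i j \<in> W} = measure (distr \<mu> \<mu> (shift ^^ k)) {x \<in> X. block x i j \<in> W}"
    by (simp only: distr_funpow[OF shift_measurable shift_preserving])
  also have "\<dots> = prob ((shift ^^ k) -` {x \<in> X. block x i j \<in> W} \<inter> space \<mu>)"
    by (rule measure_distr[OF funpow_measurable[OF shift_measurable] block_event(2)])
  also have "(shift ^^ k) -` {x \<in> X. block x i j \<in> W} \<inter> space \<mu> =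
      {x \<in> X. block x (i + int k) (j + int k) \<in> W}"
    using funpow_shift_mem by (auto simp: space_eq block_funpow_shift)
  finally show ?thesis ..
qed

lemma prob_block_translate:
  "prob {x \<in> X. block x (i + k) (j + k) \<in> W} = prob {x \<in> X. block x i j \<in> W}"
proof (cases "k \<ge> 0")
  case True
  then show ?thesis using prob_block_translate_nat[of i "nat k" j W] by simp
next
  case False
  then show ?thesis using prob_block_translate_nat[of "i + k" "nat (- k)" "j + k" W] by simp
qed

lemma simple_function_block: "simple_function \<mu> (\<lambda>x. block x i j)"
  unfolding simple_function_def
proof (intro conjI ballI)
  show "finite ((\<lambda>x. block x i j) ` space \<mu>)"
    by (rule finite_subset[of _ "words (nat (j - i))"]) auto
  fix w
  have "(\<lambda>x. block x i j) -` {w} \<inter> space \<mu> = {x \<in> X. block x i j = w}" by (auto simp: space_eq)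
  then show "(\<lambda>x. block x i j) -` {w} \<inter> space \<mu> \<in> events" using block_event(1) by simp
qed

definition block_entropy :: "nat \<Rightarrow> real" where
  "block_entropy n = fun_entropy \<mu> (\<lambda>x. block x 0 (int n))"

lemma block_entropy_sum:
  "block_entropy n = - (\<Sum>w\<in>words n. prob {x \<in> X. block x 0 (int n) = w} *
                                       ln (prob {x \<in> X. block x 0 (int n) = w}))"
  unfolding block_entropy_def by (subst fun_entropy_sum[of "words n"]) (auto simp: space_eq)

lemma fun_entropy_block: "i \<le> j \<Longrightarrow> fun_entropy \<mu> (\<lambda>x. block x i j) = block_entropy (nat (j - i))"
proof -
  assume ij: "i \<le> j"
  define n where "n = nat (j - i)"
  have pr: "prob {x \<in> space \<mu>. block x i j = w} = prob {x \<in> X. block x 0 (int n) = w}" for w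
    using prob_block_translate[of 0 i "int n" "{w}"] ij by (simp add: space_eq n_def)
  have "fun_entropy \<mu> (\<lambda>x. block x i j) = - (\<Sum>w\<in>words n. prob {x \<in> space \<mu>. block x i j = w} *
       ln (prob {x \<in> space \<mu>. block x i j = w}))"
    by (rule fun_entropy_sum) (auto simp: n_def)
  then show ?thesis unfolding pr by (simp add: block_entropy_sum n_def)
qed

lemma block_entropy_add: "block_entropy (m + n) \<le> block_entropy m + block_entropy n"
proof -
  have "block_entropy (m + n) = fun_entropy \<mu> (\<lambda>x. (block x 0 (int m), block x (int m) (int (m + n))))"
    unfolding block_entropy_def
  proof (rule fun_entropy_cong)
    fix x y :: "int \<Rightarrow> 'a"
    have "block z 0 (int (m + n)) = block z 0 (int m) @ block z (int m) (int (m + n))" for z :: "int \<Rightarrow> 'a"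
      by (simp add: block_append)
    then show "block x 0 (int (m + n)) = block y 0 (int (m + n)) \<longleftrightarrow>
      (block x 0 (int m), block x (int m) (int (m + n))) = (block y 0 (int m), block y (int m) (int (m + n)))"
      by simp
  qed
  also have "\<dots> \<le> block_entropy m + fun_entropy \<mu> (\<lambda>x. block x (int m) (int (m + n)))"
    unfolding block_entropy_def by (rule fun_entropy_subadditive[OF simple_function_block simple_function_block])
  finally show ?thesis by (simp add: fun_entropy_block)
qed

lemma block_entropy_nonneg: "0 \<le> block_entropy n"
  unfolding block_entropy_def by (rule fun_entropy_nonneg[OF simple_function_block])

text \<open>Every event is nearly a window, membership in a window is decided by any sufficiently
  wide central block, and nearly equal events have small conditional entropy.\<close>

lemma cond_entropy_block_small:
  assumes A: "A \<in> events" and "e > 0"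
  shows "\<forall>\<^sub>F j in sequentially. cond_entropy \<mu> (\<lambda>x. x \<in> A) (\<lambda>x. block x (- int j) (int j)) < e"
proof -
  have fm: "finite_measure \<mu>" by (rule finite_measure_axioms)
  \<comment> \<open>The square makes the final bound \<open>3 * (e / 4)\<close>, which is below
    \<open>e\<close>.\<close>
  obtain m W where mW: "prob (A - window X m W \<union> (window X m W - A)) < (e / 4)\<^sup>2"
    using window_approx[OF fm sets_eq fm sets_eq, of A "(e / 4)\<^sup>2"] A sets_eq \<open>e > 0\<close> by auto
  have win: "window X m W \<in> events" by (simp add: window_def block_event)
  have bound: "cond_entropy \<mu> (\<lambda>x. x \<in> A) (\<lambda>x. block x (- int j) (int j)) < e" if "j \<ge> m" for j
  proof -
    have "cond_entropy \<mu> (\<lambda>x. x \<in> A) (\<lambda>x. block x (- int j) (int j)) \<le>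
        cond_entropy \<mu> (\<lambda>x. x \<in> A) (\<lambda>x. x \<in> window X m W)"
    proof (rule cond_entropy_antimono[OF simple_function_mem[OF A] simple_function_block simple_function_mem[OF win]])
      fix x y assume "x \<in> space \<mu>" "y \<in> space \<mu>" "block x (- int j) (int j) = block y (- int j) (int j)"
      moreover from this that have "block x (- int m) (int m) = block y (- int m) (int m)"
        by (simp add: block_eq_iff)
      ultimately show "(x \<in> window X m W) = (y \<in> window X m W)" by (simp add: window_def space_eq)
    qed
    also have "\<dots> \<le> 3 * sqrt (prob (A - window X m W \<union> (window X m W - A)))"
      by (rule cond_entropy_indicator[OF A win])
    also have "\<dots> \<le> 3 * sqrt ((e / 4)\<^sup>2)"
      using mW by (intro mult_left_mono real_sqrt_le_mono) auto
    also have "\<dots> < e" using \<open>e > 0\<close> by simp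
    finally show ?thesis .
  qed
  then show ?thesis unfolding eventually_sequentially by blast
qed

text \<open>The half of the Kolmogorov--Sinai theorem that bounds an arbitrary partition by the
  generating partition into letters.\<close>

lemma entropy_wrt_partition_le:
  assumes Q: "finite_partition \<mu> Q" and n: "n \<ge> 1"
  shows "entropy_wrt_partition \<mu> shift Q \<le> block_entropy n / real n"
proof -
  let ?q = "\<lambda>x. {A \<in> Q. x \<in> A}"
  note T = shift_measurable shift_preserving
  have Qs: "finite Q" "Q \<subseteq> events" using Q by (auto simp: finite_partition_def)
  note q = entropy_wrt_partition_limit[OF Q T]
  obtain L where L: "(\<lambda>n. block_entropy n / real n) \<longlonglongrightarrow> L" "\<And>n. n \<ge> 1 \<Longrightarrow> L \<le> block_entropy n / real n"
    using subadditive_convergent[of block_entropy] block_entropy_add block_entropy_nonneg by blast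
  have "entropy_wrt_partition \<mu> shift Q \<le> L + e" if "e > 0" for e
  proof -
    define d where "d = e / (real (card Q) + 1)"
    have "d > 0" using \<open>e > 0\<close> by (simp add: d_def)
    have "\<forall>\<^sub>F j in sequentially. \<forall>A\<in>Q. cond_entropy \<mu> (\<lambda>x. x \<in> A) (\<lambda>x. block x (- int j) (int j)) < d"
      using Qs \<open>d > 0\<close> by (intro eventually_ball_finite ballI cond_entropy_block_small) auto
    then obtain j where j: "\<And>A. A \<in> Q \<Longrightarrow> cond_entropy \<mu> (\<lambda>x. x \<in> A) (\<lambda>x. block x (- int j) (int j)) < d"
      by (auto simp: eventually_sequentially)
    let ?b = "\<lambda>x :: int \<Rightarrow> 'a. block x (- int j) (int j)"
    have b: "simple_function \<mu> ?b" by (rule simple_function_block)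
    have "cond_entropy \<mu> ?q ?b \<le> (\<Sum>A\<in>Q. cond_entropy \<mu> (\<lambda>x. x \<in> A) ?b)"
      using cond_entropy_members[OF Qs b] by blast
    also have "\<dots> \<le> (\<Sum>A\<in>Q. d)" using j by (intro sum_mono less_imp_le)
    also have "\<dots> \<le> e" using \<open>e > 0\<close> by (simp add: d_def field_simps)
    finally have ce: "cond_entropy \<mu> ?q ?b \<le> e" .
    \<comment> \<open>The central blocks seen during \<open>N\<close> steps are contained in the
      block from \<open>- int j\<close> to \<open>int (N + j)\<close>. Its overhang costs
      \<open>block_entropy (2 * j)\<close>, which disappears after division by
      \<open>N\<close>.\<close>
    have le: "fun_entropy \<mu> (itinerary ?q shift N) / real N \<le>
        block_entropy N / real N + block_entropy (2 * j) / real N + e" if "N \<ge> 1" for N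
    proof -
      note s = simple_function_itinerary[OF _ T(1)]
      have "fun_entropy \<mu> (itinerary ?q shift N) \<le>
          fun_entropy \<mu> (\<lambda>x. (itinerary ?q shift N x, itinerary ?b shift N x))"
        by (rule fun_entropy_mono[OF simple_function_Pair[OF s[OF q(2)] s[OF b]] s[OF q(2)]])
          (unfold prod.inject, blast)
      also have "\<dots> = fun_entropy \<mu> (itinerary ?b shift N) + cond_entropy \<mu> (itinerary ?q shift N) (itinerary ?b shift N)"
        by (simp add: cond_entropy_def)
      also have "cond_entropy \<mu> (itinerary ?q shift N) (itinerary ?b shift N) \<le> real N * cond_entropy \<mu> ?q ?b"
        by (rule cond_entropy_itinerary[OF q(2) b T])
      also have "real N * cond_entropy \<mu> ?q ?b \<le> real N * e" using ce by (intro mult_left_mono) auto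
      also have "fun_entropy \<mu> (itinerary ?b shift N) \<le> fun_entropy \<mu> (\<lambda>x. block x (- int j) (int (N + j)))"
      proof (rule fun_entropy_mono[OF simple_function_block s[OF b]])
        fix x y :: "int \<Rightarrow> 'a"
        assume "block x (- int j) (int (N + j)) = block y (- int j) (int (N + j))"
        then show "itinerary ?b shift N x = itinerary ?b shift N y"
          by (auto simp: itinerary_def block_funpow_shift block_eq_iff)
      qed
      also have "\<dots> = block_entropy (N + 2 * j)"
      proof -
        have "nat (int (N + j) - - int j) = N + 2 * j" by simp
        then show ?thesis by (subst fun_entropy_block) simp_all
      qed
      also have "\<dots> \<le> block_entropy N + block_entropy (2 * j)" by (rule block_entropy_add)
      finally show ?thesis using that by (simp add: field_simps)
    qed
    have "(\<lambda>N. block_entropy N / real N + block_entropy (2 * j) / real N + e) \<longlonglongrightarrow> L + 0 + e"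
      by (intro tendsto_add L(1) lim_const_over_n tendsto_const)
    from LIMSEQ_le[OF q(1) this] le show ?thesis by auto
  qed
  then have "entropy_wrt_partition \<mu> shift Q \<le> L" by (rule field_le_epsilon)
  then show ?thesis using L(2)[OF n] by simp
qed

lemma measure_entropy_le: "n \<ge> 1 \<Longrightarrow> measure_entropy \<mu> shift \<le> ereal (block_entropy n / real n)"
  unfolding measure_entropy_def by (rule SUP_least) (simp add: entropy_wrt_partition_le)

text \<open>For a lower bound one partition is enough: the iterated joins of the partition by the
  letter at coordinate 0 have the block entropies, and \<open>c / real n\<close> vanishes in the
  limit.\<close>

lemma measure_entropy_ge:
  assumes "\<And>n. n \<ge> 1 \<Longrightarrow> h - c / real n \<le> block_entropy n / real n"
  shows "ereal h \<le> measure_entropy \<mu> shift"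
proof -
  define Q where "Q = fibres \<mu> (\<lambda>x. x 0)"
  have ev: "{x \<in> X. x 0 = a} \<in> events" for a
    using block_event(1)[of 0 1 "[a]"] by (simp add: block_def)
  have mem: "A \<in> Q \<longleftrightarrow> (\<exists>x\<in>X. A = {y \<in> X. y 0 = x 0})" for A
    by (auto simp: Q_def fibres_def space_eq)
  have Q: "finite_partition \<mu> Q"
    unfolding finite_partition_def
  proof (intro conjI)
    show "finite Q" unfolding Q_def fibres_def by (rule finite_imageI, rule finite)
    show "Q \<subseteq> events" using ev by (auto simp: mem)
    show "partition_on (space \<mu>) Q"
    proof (rule partition_onI)
      show "\<Union>Q = space \<mu>" by (auto simp: mem space_eq) (auto simp: Q_def fibres_def space_eq)
      show "{} \<notin> Q" by (auto simp: mem)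
      show "disjnt p p'" if "p \<in> Q" "p' \<in> Q" "p \<noteq> p'" for p p'
        using that by (auto simp: mem disjnt_def)
    qed
  qed
  let ?q = "\<lambda>x. {A \<in> Q. x \<in> A}"
  have q: "?q x = ?q y \<longleftrightarrow> x 0 = y 0" if "x \<in> X" "y \<in> X" for x y
  proof
    assume "?q x = ?q y"
    moreover have "{z \<in> X. z 0 = x 0} \<in> ?q x" using that by (auto simp: mem)
    ultimately show "x 0 = y 0" by auto
  qed (use that in \<open>auto simp: mem\<close>)
  have ent: "fun_entropy \<mu> (itinerary ?q shift n) = block_entropy n" for n
    unfolding block_entropy_def
  proof (rule fun_entropy_cong)
    fix x y assume "x \<in> space \<mu>" "y \<in> space \<mu>"
    then have "?q ((shift ^^ i) x) = ?q ((shift ^^ i) y) \<longleftrightarrow> x (int i) = y (int i)" for i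
      using q[of "(shift ^^ i) x" "(shift ^^ i) y"] funpow_shift_mem
        block_funpow_shift[of i x 0 1] block_funpow_shift[of i y 0 1]
      by (auto simp: space_eq block_def)
    then have "itinerary ?q shift n x = itinerary ?q shift n y \<longleftrightarrow> (\<forall>i<n. x (int i) = y (int i))"
      by (auto simp: itinerary_def)
    also have "\<dots> \<longleftrightarrow> block x 0 (int n) = block y 0 (int n)"
      by (auto simp: list_eq_iff_nth_eq block_nth)
    finally show "itinerary ?q shift n x = itinerary ?q shift n y \<longleftrightarrow> block x 0 (int n) = block y 0 (int n)" .
  qed
  have "(\<lambda>n. block_entropy n / real n) \<longlonglongrightarrow> entropy_wrt_partition \<mu> shift Q"
    using entropy_wrt_partition_limit(1)[OF Q shift_measurable shift_preserving] by (simp add: ent)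
  moreover have "(\<lambda>n. h - c / real n) \<longlonglongrightarrow> h - 0"
    by (intro tendsto_diff tendsto_const lim_const_over_n)
  ultimately have "h \<le> entropy_wrt_partition \<mu> shift Q"
    using LIMSEQ_le[of "\<lambda>n. h - c / real n" h "\<lambda>n. block_entropy n / real n"] assms by auto
  also have "ereal (entropy_wrt_partition \<mu> shift Q) \<le> measure_entropy \<mu> shift"
    unfolding measure_entropy_def by (rule SUP_upper) (simp add: Q)
  finally show ?thesis by simp
qed

end

section \<open>Equilibrium measures are absolutely continuous with respect to Gibbs measures\<close>

lemma continuous_map_borel_measurable:
  assumes "continuous_map (subtopology shift_topology S) euclideanreal f"
  shows "f \<in> borel_measurable (Borel_on S)"
proof (rule borel_measurableI)
  fix U :: "real set" assume "open U"
  then have "openin (subtopology shift_topology S) {x \<in> topspace (subtopology shift_topology S). f x \<in> U}"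
    using assms by (auto simp: continuous_map_def)
  moreover have "topspace (shift_topology :: (int \<Rightarrow> 'a) topology) = UNIV"
    by (simp add: shift_topology_def Metric_space.topspace_mtopology[OF Metric_space_shift_dist])
  then have "{x \<in> topspace (subtopology shift_topology S). f x \<in> U} = f -` U \<inter> space (Borel_on S)"
    by auto
  ultimately show "f -` U \<inter> space (Borel_on S) \<in> sets (Borel_on S)"
    unfolding sets_Borel_on_eq by auto
qed

section \<open>Integrals of block functions and Birkhoff sums\<close>

lemma (in invariant_prob) sum_prob_block:
  fixes f :: "'a list \<Rightarrow> real"
  shows "expectation (\<lambda>x. f (block x i j)) =
    (\<Sum>w\<in>words (nat (j - i)). prob {x \<in> X. block x i j = w} * f w)"
    "integrable \<mu> (\<lambda>x. f (block x i j))"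
proof -
  let ?W = "words (nat (j - i)) :: 'a list set"
  let ?g = "\<lambda>x. \<Sum>w\<in>?W. indicator {x \<in> X. block x i j = w} x * f w"
  have eq: "f (block x i j) = ?g x" if "x \<in> space \<mu>" for x
  proof -
    have "?g x = (\<Sum>w\<in>?W. if w = block x i j then f w else 0)"
      using that by (intro sum.cong refl) (auto simp: space_eq indicator_def)
    then show ?thesis by simp
  qed
  have int: "integrable \<mu> (\<lambda>x. indicator {x \<in> X. block x i j = w} x * f w)" for w
    using block_event(1) by (intro integrable_mult_left integrable_real_indicator) (auto simp: emeasure_eq_measure)
  show "integrable \<mu> (\<lambda>x. f (block x i j))"
    by (subst Bochner_Integration.integrable_cong[OF refl eq], assumption)
      (rule Bochner_Integration.integrable_sum, rule int)
  have "expectation (\<lambda>x. f (block x i j)) = expectation ?g"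
    by (rule Bochner_Integration.integral_cong[OF refl eq])
  also have "\<dots> = (\<Sum>w\<in>?W. expectation (\<lambda>x. indicator {x \<in> X. block x i j = w} x * f w))"
    by (rule Bochner_Integration.integral_sum) (rule int)
  also have "\<dots> = (\<Sum>w\<in>?W. prob {x \<in> X. block x i j = w} * f w)"
  proof (intro sum.cong refl)
    fix w
    have "{x \<in> X. block x i j = w} \<inter> X = {x \<in> X. block x i j = w}" by auto
    then show "expectation (\<lambda>x. indicator {x \<in> X. block x i j = w} x * f w) =
        prob {x \<in> X. block x i j = w} * f w"
      by (simp add: space_eq)
  qed
  finally show "expectation (\<lambda>x. f (block x i j)) = (\<Sum>w\<in>?W. prob {x \<in> X. block x i j = w} * f w)" .
qed

lemma (in invariant_prob) sum_prob_block_1: "(\<Sum>w\<in>words n. prob {x \<in> X. block x 0 (int n) = w}) = 1"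
  using sum_prob_block(1)[of "\<lambda>_. 1" 0 "int n"] by (simp add: prob_space)

lemma (in invariant_prob) prob_block_in:
  "prob {x \<in> X. block x i j \<in> W} = (\<Sum>w\<in>W \<inter> words (nat (j - i)). prob {x \<in> X. block x i j = w})"
proof -
  have "{x \<in> X. block x i j \<in> W} = (\<Union>w\<in>W \<inter> words (nat (j - i)). {x \<in> X. block x i j = w})"
    by auto
  moreover have "prob \<dots> = (\<Sum>w\<in>W \<inter> words (nat (j - i)). prob {x \<in> X. block x i j = w})"
    using block_event by (intro finite_measure_finite_Union) (auto simp: disjoint_family_on_def)
  ultimately show ?thesis by simp
qed

locale invariant_potential = potential X \<phi> + invariant_prob X \<mu>
  for X :: "(int \<Rightarrow> 'a::finite) set" and \<phi> and \<mu> +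
  assumes potential_measurable: "\<phi> \<in> borel_measurable (Borel_on X)"
begin

lemma expectation_birkhoff_sum:
  "integrable \<mu> (birkhoff_sum \<phi> n)" "expectation (birkhoff_sum \<phi> n) = real n * expectation \<phi>"
proof -
  obtain B where B: "\<forall>x\<in>X. \<bar>\<phi> x\<bar> \<le> B" using potential_bounded by auto
  have meas: "\<phi> \<in> borel_measurable \<mu>"
    using potential_measurable measurable_cong_sets[OF sets_eq refl] by blast
  note T = funpow_measurable[OF shift_measurable]
  have int: "integrable \<mu> (\<lambda>x. \<phi> ((shift ^^ k) x))" for k
    using B funpow_shift_mem
    by (intro integrable_const_bound[where B = B] AE_I2 measurable_compose[OF T meas]) (auto simp: space_eq)
  have "expectation (\<lambda>x. \<phi> ((shift ^^ k) x)) = expectation \<phi>" for k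
    using integral_distr[OF T meas, of k] by (simp only: distr_funpow[OF shift_measurable shift_preserving])
  then show "expectation (birkhoff_sum \<phi> n) = real n * expectation \<phi>"
    unfolding birkhoff_sum_def by (subst Bochner_Integration.integral_sum) (auto intro: int)
  show "integrable \<mu> (birkhoff_sum \<phi> n)"
    unfolding birkhoff_sum_def by (intro Bochner_Integration.integrable_sum int)
qed

text \<open>The logarithmic weight differs pointwise from the Birkhoff sum by at most the distortion
  constant, and by invariance the latter integrates to exactly
  \<open>real n * expectation \<phi>\<close>. The error is uniform in \<open>n\<close>.\<close>

lemma expectation_ln_weight:
  "\<exists>V\<ge>0. \<forall>n. \<bar>(\<Sum>w\<in>words n. prob {x \<in> X. block x 0 (int n) = w} * ln (weight w)) - real n * expectation \<phi>\<bar> \<le> V"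
proof -
  obtain V where V: "V \<ge> 0"
    "\<And>n x. x \<in> X \<Longrightarrow> \<bar>ln (weight (block x 0 (int n))) - birkhoff_sum \<phi> n x\<bar> \<le> V"
    using weight_distortion by blast
  have "\<bar>(\<Sum>w\<in>words n. prob {x \<in> X. block x 0 (int n) = w} * ln (weight w)) - real n * expectation \<phi>\<bar> \<le> V" for n
  proof -
    let ?f = "\<lambda>x. ln (weight (block x 0 (int n))) - birkhoff_sum \<phi> n x"
    have int: "integrable \<mu> (\<lambda>x. ln (weight (block x 0 (int n))))"
      by (rule sum_prob_block(2)[of "\<lambda>w. ln (weight w)"])
    have "\<bar>expectation ?f\<bar> \<le> expectation (\<lambda>x. \<bar>?f x\<bar>)" by (rule integral_abs_bound)
    also have "\<dots> \<le> expectation (\<lambda>_. V)"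
      using V(2) int expectation_birkhoff_sum(1) by (intro integral_mono) (auto simp: space_eq)
    also have "\<dots> = V" by (simp add: prob_space)
    finally show ?thesis
      using int expectation_birkhoff_sum[of n] sum_prob_block(1)[of "\<lambda>w. ln (weight w)" 0 "int n"]
      by simp
  qed
  with V(1) show ?thesis by blast
qed

end

section \<open>Comparison of an equilibrium measure with a Gibbs measure\<close>

context spec_potential
begin

lemma ln_gibbs_weight:
  "w \<in> language X \<Longrightarrow> ln (gibbs_weight w) = ln (weight w) - real (length w) * pressure"
  by (simp add: gibbs_weight_def ln_mult_pos)

text \<open>By the upper Gibbs bound, minus the logarithm of the mass of an n-word is at least n
  times the pressure minus its logarithmic weight, up to a constant. Averaging gives block entropies
  of the required size.\<close>

lemma gibbs_measure_free_energy:
  assumes \<nu>: "gibbs_measure \<nu>" and meas: "\<phi> \<in> borel_measurable (Borel_on X)"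
  shows "ereal pressure \<le> measure_entropy \<nu> shift + ereal (integral\<^sup>L \<nu> \<phi>)"
proof -
  have inv: "invariant_measure X \<nu>" using \<nu> by (simp add: gibbs_measure_def)
  interpret prob_space \<nu> using inv by (simp add: invariant_measure_def)
  interpret invariant_potential X \<phi> \<nu>
    by unfold_locales (fact inv meas)+
  obtain C where C: "C \<ge> 1" "\<And>i w. prob {x \<in> X. block x i (i + int (length w)) = w} \<le> C * gibbs_weight w"
    using \<nu> unfolding gibbs_measure_def by blast
  obtain V where V: "V \<ge> 0" "\<And>n. \<bar>(\<Sum>w\<in>words n. prob {x \<in> X. block x 0 (int n) = w} * ln (weight w)) -
      real n * expectation \<phi>\<bar> \<le> V"
    using expectation_ln_weight by blast
  have "pressure - expectation \<phi> - (ln C + V) / real n \<le> block_entropy n / real n" if "n \<ge> 1" for n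
  proof -
    let ?p = "\<lambda>w. prob {x \<in> X. block x 0 (int n) = w}"
    have "(\<Sum>w\<in>words n. ?p w * ln (?p w)) \<le> (\<Sum>w\<in>words n. ?p w * (ln C + ln (weight w) - real n * pressure))"
    proof (rule sum_mono)
      fix w :: "'a list" assume w: "w \<in> words n"
      show "?p w * ln (?p w) \<le> ?p w * (ln C + ln (weight w) - real n * pressure)"
      proof (cases "?p w = 0")
        case False
        then have p: "0 < ?p w" using measure_nonneg[of \<nu>] by (simp add: less_le)
        have le: "?p w \<le> C * gibbs_weight w" using C(2)[of 0 w] w by simp
        have L: "w \<in> language X"
        proof (rule ccontr)
          assume "w \<notin> language X"
          then have "gibbs_weight w = 0" by (rule gibbs_weight_eq_0)
          then show False using le p by simp
        qed
        have "ln (?p w) \<le> ln (C * gibbs_weight w)" using le p by simp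
        also have "\<dots> = ln C + ln (weight w) - real n * pressure"
          using L C(1) w by (simp add: ln_mult_pos ln_gibbs_weight)
        finally show ?thesis using p by (intro mult_left_mono) auto
      qed (simp only: mult_zero_left order_refl)
    qed
    also have "\<dots> = (\<Sum>w\<in>words n. ?p w * ln (weight w)) + (ln C - real n * pressure) * (\<Sum>w\<in>words n. ?p w)"
      by (simp add: algebra_simps sum.distrib sum_subtractf sum_distrib_left)
    also have "\<dots> \<le> real n * expectation \<phi> + V + (ln C - real n * pressure)"
      using V(2)[of n] by (simp add: sum_prob_block_1 abs_le_iff)
    finally have "real n * (pressure - expectation \<phi>) - (ln C + V) \<le> block_entropy n"
      by (simp add: block_entropy_sum algebra_simps)
    then have "(real n * (pressure - expectation \<phi>) - (ln C + V)) / real n \<le> block_entropy n / real n"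
      by (rule divide_right_mono) simp
    moreover have "(real n * (pressure - expectation \<phi>) - (ln C + V)) / real n =
        pressure - expectation \<phi> - (ln C + V) / real n"
      using that by (subst diff_divide_distrib) simp
    ultimately show ?thesis by simp
  qed
  then have "ereal (pressure - expectation \<phi>) \<le> measure_entropy \<nu> shift"
    by (rule measure_entropy_ge)
  then have "ereal (pressure - expectation \<phi>) + ereal (expectation \<phi>) \<le> measure_entropy \<nu> shift + ereal (expectation \<phi>)"
    by (rule add_right_mono)
  then show ?thesis by simp
qed

text \<open>The relative entropy of an equilibrium measure with respect to a Gibbs measure stays bounded on
  words of length \<open>n\<close>, since both free energies equal the pressure.\<close>

lemma equilibrium_relative_entropy:
  assumes \<nu>: "gibbs_measure \<nu>" and \<mu>: "equilibrium_measure X \<phi> \<mu>"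
    and meas: "\<phi> \<in> borel_measurable (Borel_on X)"
  shows "\<exists>K. \<forall>n\<ge>1. (\<Sum>w\<in>words n. measure \<mu> {x \<in> X. block x 0 (int n) = w} *
    (ln (measure \<mu> {x \<in> X. block x 0 (int n) = w}) - ln (measure \<nu> {x \<in> X. block x 0 (int n) = w}))) \<le> K"
proof -
  have inv: "invariant_measure X \<mu>" using \<mu> by (simp add: equilibrium_measure_def)
  interpret prob_space \<mu> using inv by (simp add: invariant_measure_def)
  interpret invariant_potential X \<phi> \<mu>
    by unfold_locales (fact inv meas)+
  have "ereal pressure \<le> measure_entropy \<nu> shift + ereal (integral\<^sup>L \<nu> \<phi>)"
    by (rule gibbs_measure_free_energy[OF \<nu> meas])
  also have "\<dots> \<le> measure_entropy \<mu> shift + ereal (expectation \<phi>)"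
    using \<mu> \<nu> by (auto simp: equilibrium_measure_def gibbs_measure_def)
  finally have P: "ereal pressure \<le> measure_entropy \<mu> shift + ereal (expectation \<phi>)" .
  obtain C where C: "C \<ge> 1" "\<And>i w. gibbs_weight w \<le> C * measure \<nu> {x \<in> X. block x i (i + int (length w)) = w}"
    using \<nu> unfolding gibbs_measure_def by blast
  obtain V where V: "V \<ge> 0" "\<And>n. \<bar>(\<Sum>w\<in>words n. prob {x \<in> X. block x 0 (int n) = w} * ln (weight w)) -
      real n * expectation \<phi>\<bar> \<le> V"
    using expectation_ln_weight by blast
  have "(\<Sum>w\<in>words n. prob {x \<in> X. block x 0 (int n) = w} *
    (ln (prob {x \<in> X. block x 0 (int n) = w}) - ln (measure \<nu> {x \<in> X. block x 0 (int n) = w}))) \<le> V + ln C"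
    if n: "n \<ge> 1" for n
  proof -
    let ?p = "\<lambda>w. prob {x \<in> X. block x 0 (int n) = w}"
    let ?q = "\<lambda>w. measure \<nu> {x \<in> X. block x 0 (int n) = w}"
    note P
    \<comment> \<open>The entropy is at most \<open>block_entropy n / real n\<close> for this very
      \<open>n\<close>, so that multiplication by \<open>n\<close> leaves no growing error.\<close>
    also have "measure_entropy \<mu> shift + ereal (expectation \<phi>) \<le> ereal (block_entropy n / real n) + ereal (expectation \<phi>)"
      by (rule add_right_mono) (rule measure_entropy_le[OF n])
    finally have "pressure \<le> block_entropy n / real n + expectation \<phi>" by simp
    then have nP: "real n * pressure \<le> block_entropy n + real n * expectation \<phi>"
      using n by (simp add: field_simps)
    have "(\<Sum>w\<in>words n. ?p w * (ln (?p w) - ln (?q w))) \<le>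
        (\<Sum>w\<in>words n. ?p w * (ln (?p w) - (ln (weight w) - real n * pressure - ln C)))"
    proof (rule sum_mono)
      fix w :: "'a list" assume w: "w \<in> words n"
      show "?p w * (ln (?p w) - ln (?q w)) \<le> ?p w * (ln (?p w) - (ln (weight w) - real n * pressure - ln C))"
      \<comment> \<open>A nonempty cylinder puts \<open>w\<close> in the language, where the lower
        Gibbs bound makes its mass under \<open>\<nu>\<close> positive; for an empty one the factor
        in front is 0.\<close>
      proof (cases "{x \<in> X. block x 0 (int n) = w} = {}")
        case True
        then show ?thesis by (simp only: measure_empty mult_zero_left order_refl)
      next
        case False
        then have L: "w \<in> language X" using block_in_language by auto
        then have "0 < gibbs_weight w" by simp
        moreover have le: "gibbs_weight w \<le> C * ?q w" using C(2)[of w 0] w by simp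
        ultimately have q: "0 < ?q w" using C(1) by (smt (verit) mult_nonneg_nonpos)
        have "ln (gibbs_weight w) \<le> ln (C * ?q w)" using le L by (intro ln_mono) auto
        then have "ln (weight w) - real n * pressure - ln C \<le> ln (?q w)"
          using L C(1) w q by (simp add: ln_mult_pos ln_gibbs_weight)
        then show ?thesis by (intro mult_left_mono) auto
      qed
    qed
    also have "\<dots> = (\<Sum>w\<in>words n. ?p w * ln (?p w)) - (\<Sum>w\<in>words n. ?p w * ln (weight w)) +
        (real n * pressure + ln C) * (\<Sum>w\<in>words n. ?p w)"
      by (simp add: algebra_simps sum.distrib sum_subtractf sum_distrib_left)
    also have "\<dots> \<le> V + ln C"
      using V(2)[of n] nP by (simp add: sum_prob_block_1 block_entropy_sum abs_le_iff)
    finally show ?thesis .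
  qed
  then show ?thesis by blast
qed

text \<open>Otherwise some window close to \<open>B\<close> has mass at least b under
  \<open>\<mu>\<close> and below e under \<open>\<nu>\<close>. Merging words into the window and its
  complement makes the relative entropy at least b ln (1 / e) - 2, contrary to its bound when e is
  small.\<close>

lemma equilibrium_absolutely_continuous:
  assumes \<nu>: "gibbs_measure \<nu>" and \<mu>: "equilibrium_measure X \<phi> \<mu>"
    and meas: "\<phi> \<in> borel_measurable (Borel_on X)"
    and B: "B \<in> sets (Borel_on X)" "measure \<nu> B = 0"
  shows "measure \<mu> B = 0"
proof (rule ccontr)
  have inv: "invariant_measure X \<mu>" "invariant_measure X \<nu>"
    using \<mu> \<nu> by (simp_all add: equilibrium_measure_def gibbs_measure_def)
  interpret M: prob_space \<mu> using inv(1) by (simp add: invariant_measure_def)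
  interpret M: invariant_prob X \<mu> by unfold_locales (fact inv)
  interpret N: prob_space \<nu> using inv(2) by (simp add: invariant_measure_def)
  interpret N: invariant_prob X \<nu> by unfold_locales (fact inv)
  obtain K where K: "\<And>n. n \<ge> 1 \<Longrightarrow> (\<Sum>w\<in>words n. M.prob {x \<in> X. block x 0 (int n) = w} *
    (ln (M.prob {x \<in> X. block x 0 (int n) = w}) - ln (N.prob {x \<in> X. block x 0 (int n) = w}))) \<le> K"
    using equilibrium_relative_entropy[OF \<nu> \<mu> meas] by blast
  obtain C where C: "C \<ge> 1" "\<And>i w. gibbs_weight w \<le> C * N.prob {x \<in> X. block x i (i + int (length w)) = w}"
    using \<nu> unfolding gibbs_measure_def by blast
  assume "M.prob B \<noteq> 0"
  define b where "b = M.prob B / 2"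
  have b: "0 < b" using \<open>M.prob B \<noteq> 0\<close> measure_nonneg[of \<mu> B] by (simp add: b_def less_le)
  \<comment> \<open>Chosen so that \<open>b * (- ln e)\<close> is at least
    \<open>\<bar>K\<bar> + 3\<close>, beyond the upper bound \<open>K + 2\<close> derived below;
    \<open>e \<le> b\<close> keeps the two masses of the window apart.\<close>
  define e where "e = b * exp (- ((\<bar>K\<bar> + 3) / b))"
  have "0 \<le> (\<bar>K\<bar> + 3) / b" using b by simp
  then have e: "0 < e" "e \<le> b" using b by (auto simp: e_def mult_le_cancel_left1)
  obtain m W where mW: "M.prob (B - window X m W \<union> (window X m W - B)) < e"
      "N.prob (B - window X m W \<union> (window X m W - B)) < e"
    using window_approx[OF M.finite_measure_axioms M.sets_eq N.finite_measure_axioms N.sets_eq B(1) e(1)]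
    by blast
  define n where "n = 2 * m"
  have win: "window X m W \<in> sets (Borel_on X)" by (simp add: window_def sets_Borel_on_block_in)
  have "M.prob B \<le> M.prob (window X m W \<union> (B - window X m W \<union> (window X m W - B)))"
    using win B(1) M.sets_eq by (intro M.finite_measure_mono) auto
  also have "\<dots> \<le> M.prob (window X m W) + M.prob (B - window X m W \<union> (window X m W - B))"
    using win B(1) M.sets_eq by (intro measure_Un_le) auto
  finally have Mw: "b \<le> M.prob (window X m W)" using mW(1) e(2) by (simp add: b_def)
  have "N.prob (window X m W) \<le> N.prob (B \<union> (B - window X m W \<union> (window X m W - B)))"
    using win B(1) N.sets_eq by (intro N.finite_measure_mono) auto
  also have "\<dots> \<le> N.prob B + N.prob (B - window X m W \<union> (window X m W - B))"
    using win B(1) N.sets_eq by (intro measure_Un_le) auto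
  finally have Nw: "N.prob (window X m W) < e" using mW(2) B(2) by simp
  define p q where "p w = M.prob {x \<in> X. block x 0 (int n) = w}"
    and "q w = N.prob {x \<in> X. block x 0 (int n) = w}" for w
  have pq: "0 < q w" if "0 < p w" "w \<in> words n" for w
  proof -
    have "{x \<in> X. block x 0 (int n) = w} \<noteq> {}"
      using that(1) by (metis p_def less_irrefl measure_empty)
    then have "w \<in> language X" using block_in_language by auto
    then have "0 < gibbs_weight w" by simp
    also have "gibbs_weight w \<le> C * N.prob {x \<in> X. block x 0 (int n) = w}"
      using C(2)[of w 0] that(2) by simp
    finally have "0 < C * N.prob {x \<in> X. block x 0 (int n) = w}" .
    then show ?thesis using C(1) by (simp add: q_def zero_less_mult_iff)
  qed
  have nn: "0 \<le> p w" "0 \<le> q w" for w by (auto simp: p_def q_def)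
  let ?S = "W \<inter> words n" and ?S' = "words n - W"
  \<comment> \<open>Invariance moves the symmetric window to an interval starting at 0, where the
    relative entropy is bounded.\<close>
  have Mwin: "M.prob (window X m W) = sum p ?S"
  proof -
    have "M.prob (window X m W) = M.prob {x \<in> X. block x (- int m + int m) (int m + int m) \<in> W}"
      unfolding window_def by (rule M.prob_block_translate[symmetric])
    also have "- int m + int m = 0" by simp
    also have "int m + int m = int n" by (simp add: n_def)
    also have "M.prob {x \<in> X. block x 0 (int n) \<in> W} = sum p ?S"
      unfolding M.prob_block_in[of 0 "int n" W] p_def by simp
    finally show ?thesis .
  qed
  have Nwin: "N.prob (window X m W) = sum q ?S"
  proof -
    have "N.prob (window X m W) = N.prob {x \<in> X. block x (- int m + int m) (int m + int m) \<in> W}"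
      unfolding window_def by (rule N.prob_block_translate[symmetric])
    also have "- int m + int m = 0" by simp
    also have "int m + int m = int n" by (simp add: n_def)
    also have "N.prob {x \<in> X. block x 0 (int n) \<in> W} = sum q ?S"
      unfolding N.prob_block_in[of 0 "int n" W] q_def by simp
    finally show ?thesis .
  qed
  have split: "sum f (words n) = sum f ?S + sum f ?S'" for f :: "'a list \<Rightarrow> real"
    by (subst sum.union_disjoint[symmetric]) (auto intro: arg_cong[of _ _ "sum f"])
  \<comment> \<open>At length 0 the window is \<open>X\<close> or empty and has equal mass under
    both measures, which \<open>e \<le> b\<close> excludes; the relative entropy bound is stated for
    positive lengths.\<close>
  have "n \<ge> 1"
  proof (rule ccontr)
    assume "\<not> n \<ge> 1"
    then have n: "n = 0" by simp
    have "{x \<in> X. block x 0 (int n) = []} = X" by (auto simp: n)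
    then have "q [] = 1" "p [] = 1"
      using M.prob_space N.prob_space by (auto simp: p_def q_def M.space_eq N.space_eq)
    then have "sum q ?S = sum p ?S" by (intro sum.cong refl) (simp add: n)
    then show False using Mw Nw Mwin Nwin e(2) by simp
  qed
  have S: "0 < sum p ?S" using Mw b Mwin by simp
  have 1: "0 < sum q ?S" "sum p ?S * (ln (sum p ?S) - ln (sum q ?S)) \<le> (\<Sum>w\<in>?S. p w * (ln (p w) - ln (q w)))"
    by (rule log_sum[of ?S p q]; use nn pq S in simp)+
  \<comment> \<open>The complement may contribute negatively, but its mass under
    \<open>\<nu>\<close> is at most 1 and \<open>x * ln x \<ge> - 1\<close>, so no more than 1 is
    lost.\<close>
  have 2: "- 1 \<le> (\<Sum>w\<in>?S'. p w * (ln (p w) - ln (q w)))"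
  proof (cases "sum p ?S' = 0")
    case True
    then have "\<forall>w\<in>?S'. p w = 0" using nn by (subst (asm) sum_nonneg_eq_0_iff) auto
    then show ?thesis by simp
  next
    case False
    then have S': "0 < sum p ?S'" using nn by (simp add: less_le sum_nonneg)
    have "sum q ?S' \<le> 1"
      using split[of q] N.sum_prob_block_1[of n] sum_nonneg[of ?S q] nn
      by (simp add: q_def[symmetric])
    moreover have q': "0 < sum q ?S'"
      "sum p ?S' * (ln (sum p ?S') - ln (sum q ?S')) \<le> (\<Sum>w\<in>?S'. p w * (ln (p w) - ln (q w)))"
      by (rule log_sum[of ?S' p q]; use nn pq S' in simp)+
    ultimately have "ln (sum q ?S') \<le> 0" by simp
    then have "sum p ?S' * ln (sum p ?S') \<le> sum p ?S' * (ln (sum p ?S') - ln (sum q ?S'))"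
      using S' by (intro mult_left_mono) auto
    then show ?thesis using q'(2) xlnx_ge[OF less_imp_le[OF S']] by linarith
  qed
  have "sum p ?S * ln (sum p ?S) - sum p ?S * ln (sum q ?S) \<le> K + 1"
    using K[OF \<open>n \<ge> 1\<close>] 1(2) 2 split[of "\<lambda>w. p w * (ln (p w) - ln (q w))"]
    by (simp add: p_def[symmetric] q_def[symmetric] right_diff_distrib)
  then have upper: "sum p ?S * (- ln (sum q ?S)) \<le> K + 2"
    using xlnx_ge[OF less_imp_le[OF S]] by (simp only: mult_minus_right)
  have "b \<le> 1" using M.prob_le_1[of B] unfolding b_def by linarith
  then have "ln b \<le> 0" using b by simp
  have "ln (sum q ?S) \<le> ln e" using 1(1) Nw Nwin e(1) by simp
  also have "\<dots> = ln b + - ((\<bar>K\<bar> + 3) / b)"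
    unfolding e_def using b by (subst ln_mult_pos) simp_all
  finally have lower: "(\<bar>K\<bar> + 3) / b \<le> - ln (sum q ?S)" using \<open>ln b \<le> 0\<close> by linarith
  have "0 \<le> (\<bar>K\<bar> + 3) / b" using b by simp
  then have nonneg: "0 \<le> - ln (sum q ?S)" using lower by linarith
  have "\<bar>K\<bar> + 3 = b * ((\<bar>K\<bar> + 3) / b)" using b by simp
  also have "\<dots> \<le> b * (- ln (sum q ?S))" using lower b by (intro mult_left_mono) auto
  also have "\<dots> \<le> sum p ?S * (- ln (sum q ?S))"
    using Mw Mwin nonneg by (intro mult_right_mono) auto
  finally show False using upper by linarith
qed

end

section \<open>Product structure of Gibbs measures\<close>

lemma measurable_bracket_seq:
  "(\<lambda>(x, y). bracket x y) \<in> measurable (seq_algebra \<Otimes>\<^sub>M seq_algebra) (seq_algebra :: (int \<Rightarrow> 'a::finite) measure)"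
proof (rule measurable_PiM_single')
  fix i :: int
  have "(\<lambda>z. if i \<le> 0 then fst z i else snd z i) \<in>
      measurable (seq_algebra \<Otimes>\<^sub>M seq_algebra :: ((int \<Rightarrow> 'a) \<times> (int \<Rightarrow> 'a)) measure) (count_space UNIV)"
  proof (cases "i \<le> 0")
    case True
    then show ?thesis
      using measurable_compose[OF measurable_fst measurable_component_singleton[of i UNIV "\<lambda>_. count_space (UNIV::'a set)"]]
      by simp
  next
    case False
    then show ?thesis
      using measurable_compose[OF measurable_snd measurable_component_singleton[of i UNIV "\<lambda>_. count_space (UNIV::'a set)"]]
      by simp
  qed
  then show "(\<lambda>z. (case z of (x, y) \<Rightarrow> bracket x y) i) \<in>
      measurable (seq_algebra \<Otimes>\<^sub>M seq_algebra) (count_space (UNIV :: 'a set))"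
    by (simp add: bracket_def case_prod_unfold)
qed auto

lemma measurable_bracket:
  fixes f g :: "'b \<Rightarrow> int \<Rightarrow> 'a::finite"
  assumes f: "f \<in> measurable M (Borel_on S)" and g: "g \<in> measurable M (Borel_on S')"
    and mem: "\<And>z. z \<in> space M \<Longrightarrow> bracket (f z) (g z) \<in> R"
  shows "(\<lambda>z. bracket (f z) (g z)) \<in> measurable M (Borel_on R)"
proof -
  have emb: "h \<in> measurable M seq_algebra" if "h \<in> measurable M (Borel_on S)"
    for h :: "'b \<Rightarrow> int \<Rightarrow> 'a" and S
    using that measurable_cong_sets[OF refl sets_Borel_on[of S], of M]
    by (auto intro: measurable_restrict_space2_iff[THEN iffD1, THEN conjunct1])
  have "(\<lambda>z. bracket (f z) (g z)) \<in> measurable M seq_algebra"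
    using measurable_compose[OF measurable_Pair[OF emb[OF f] emb[OF g]] measurable_bracket_seq] by simp
  then have "(\<lambda>z. bracket (f z) (g z)) \<in> measurable M (restrict_space seq_algebra R)"
    using mem by (intro measurable_restrict_space2) auto
  then show ?thesis
    using measurable_cong_sets[OF refl sets_Borel_on[of R], of M] by simp
qed

text \<open>The independent coupling of past and future. It factors through \<open>Wu R q\<close> and \<open>Ws R q\<close> for
  every \<open>q\<close>, because the bracket forgets the halves that were replaced by those of \<open>q\<close>.\<close>

definition bracket_product :: "(int \<Rightarrow> 'a) set \<Rightarrow> (int \<Rightarrow> 'a) measure \<Rightarrow> (int \<Rightarrow> 'a) measure" where
  "bracket_product R \<rho> = distr (\<rho> \<Otimes>\<^sub>M \<rho>) (Borel_on R) (\<lambda>(x, y). bracket y x)"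

lemma product_measure_on_bracket_product:
  fixes R :: "(int \<Rightarrow> 'a::finite) set"
  assumes R: "rectangle X R" and \<rho>: "finite_measure \<rho>" "sets \<rho> = sets (Borel_on R)"
  shows "product_measure_on R (bracket_product R \<rho>)"
  unfolding product_measure_on_def
proof (intro conjI ballI)
  show "space (bracket_product R \<rho>) = R" "sets (bracket_product R \<rho>) = sets (Borel_on R)"
    by (simp_all add: bracket_product_def)
  fix q assume q: "q \<in> R"
  interpret finite_measure \<rho> by fact
  have sp: "space \<rho> = R" using sets_eq_imp_space_eq[OF \<rho>(2)] by simp
  have br: "bracket x y \<in> R" "x 0 = y 0" if "x \<in> R" "y \<in> R" for x y
    using R that by (auto simp: rectangle_def bracket_defined_def)
  have id: "(\<lambda>x. x) \<in> measurable \<rho> (Borel_on R)"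
    using measurable_ident_sets[OF \<rho>(2)] by simp
  have const: "(\<lambda>_. q) \<in> measurable \<rho> (Borel_on R)"
    by (rule measurable_const) (simp add: q)
  have mu: "(\<lambda>x. bracket q x) \<in> measurable \<rho> (Borel_on (Wu R q))"
  proof (rule measurable_bracket[OF const id])
    fix x assume "x \<in> space \<rho>"
    then have "bracket q x \<in> R" using q br(1) sp by simp
    moreover have "\<forall>n\<le>0. bracket q x n = q n" by (simp add: bracket_def)
    ultimately show "bracket q x \<in> Wu R q" by (simp add: Wu_def)
  qed
  have ms: "(\<lambda>x. bracket x q) \<in> measurable \<rho> (Borel_on (Ws R q))"
  proof (rule measurable_bracket[OF id const])
    fix x assume "x \<in> space \<rho>"
    then have "bracket x q \<in> R" "x 0 = q 0" using q br sp by auto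
    moreover from this have "\<forall>n\<ge>0. bracket x q n = q n" by (auto simp: bracket_def)
    ultimately show "bracket x q \<in> Ws R q" by (simp add: Ws_def)
  qed
  define Mu Ms where "Mu = distr \<rho> (Borel_on (Wu R q)) (\<lambda>x. bracket q x)"
    and "Ms = distr \<rho> (Borel_on (Ws R q)) (\<lambda>x. bracket x q)"
  have fin: "finite_measure Mu" "finite_measure Ms"
    unfolding Mu_def Ms_def by (rule finite_measure_distr; fact)+
  have sf: "sigma_finite_measure Mu" "sigma_finite_measure Ms"
    using fin by (simp_all add: finite_measure_def)
  have sets_pair: "sets (Mu \<Otimes>\<^sub>M Ms) = sets (Borel_on (Wu R q) \<Otimes>\<^sub>M Borel_on (Ws R q))"
    by (rule sets_pair_measure_cong) (simp_all add: Mu_def Ms_def)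
  have iota: "\<iota> \<in> measurable (Borel_on (Wu R q) \<Otimes>\<^sub>M Borel_on (Ws R q)) (Borel_on R)"
    unfolding \<iota>_def case_prod_unfold
    by (rule measurable_bracket[OF measurable_snd measurable_fst])
      (use br in \<open>auto simp: space_pair_measure Wu_def Ws_def\<close>)
  have pair: "(\<lambda>(x, y). (bracket q x, bracket y q)) \<in>
      measurable (\<rho> \<Otimes>\<^sub>M \<rho>) (Borel_on (Wu R q) \<Otimes>\<^sub>M Borel_on (Ws R q))"
    unfolding case_prod_unfold
    by (intro measurable_Pair measurable_compose[OF measurable_fst mu] measurable_compose[OF measurable_snd ms])
  \<comment> \<open>The product of the two image measures is the image of the product; composing
    with \<open>\<iota>\<close> then cancels \<open>q\<close>.\<close>
  have "distr (Mu \<Otimes>\<^sub>M Ms) (Borel_on R) \<iota> =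
      distr (distr (\<rho> \<Otimes>\<^sub>M \<rho>) (Borel_on (Wu R q) \<Otimes>\<^sub>M Borel_on (Ws R q)) (\<lambda>(x, y). (bracket q x, bracket y q)))
        (Borel_on R) \<iota>"
    unfolding Mu_def Ms_def
    by (subst pair_measure_distr[OF mu ms]) (use sf in \<open>simp_all add: Ms_def\<close>)
  also have "\<dots> = distr (\<rho> \<Otimes>\<^sub>M \<rho>) (Borel_on R) (\<iota> \<circ> (\<lambda>(x, y). (bracket q x, bracket y q)))"
    by (rule distr_distr[OF iota pair])
  also have "\<iota> \<circ> (\<lambda>(x, y). (bracket q x, bracket y q)) = (\<lambda>(x, y). bracket y x)"
    by (auto simp: \<iota>_def bracket_def fun_eq_iff)
  finally have "bracket_product R \<rho> = distr (Mu \<Otimes>\<^sub>M Ms) (Borel_on R) \<iota>"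
    by (simp add: bracket_product_def)
  then show "\<exists>mu ms. space mu = Wu R q \<and> sets mu = sets (Borel_on (Wu R q)) \<and> sigma_finite_measure mu \<and>
      space ms = Ws R q \<and> sets ms = sets (Borel_on (Ws R q)) \<and> sigma_finite_measure ms \<and>
      bracket_product R \<rho> = distr (mu \<Otimes>\<^sub>M ms) (Borel_on R) \<iota>"
    using sf by (intro exI[of _ Mu] exI[of _ Ms]) (auto simp: Mu_def Ms_def)
qed

lemma (in subshift) no_block: "w \<notin> language X \<Longrightarrow> {x \<in> X. block x i j = w} = {}"
  using block_in_language by auto

lemma sets_restrict_Borel_on:
  fixes X :: "(int \<Rightarrow> 'a::finite) set"
  assumes "R \<subseteq> X" "sets M = sets (Borel_on X)"
  shows "sets (restrict_space M R) = sets (Borel_on R)"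
proof -
  have "(\<inter>) R ` (\<inter>) X ` \<A> = (\<inter>) R ` \<A>" for \<A>
    using assms(1) by (auto simp: image_image Int_assoc[symmetric] Int_absorb2)
  then show ?thesis
    by (simp add: sets_restrict_space assms(2) sets_Borel_on)
qed

section \<open>Quasi-product estimate, recurrence and domination by the product measure\<close>

context spec_potential
begin

text \<open>Cutting after \<open>z\<close> bounds the weight of \<open>a @ z @ b\<close> by those of
  \<open>a @ z\<close> and \<open>b\<close>, and the weight of \<open>b\<close> is at most a
  constant times that of \<open>z @ b\<close> divided by that of \<open>z\<close>. The constant may
  depend on \<open>z\<close>, which is fixed on each rectangle.\<close>

lemma gibbs_measure_quasi_product:
  assumes \<nu>: "gibbs_measure \<nu>"
  shows "\<exists>C>0. \<forall>a b i j k.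
    measure \<nu> {x \<in> X. block x i (i + int (length (a @ z @ b))) = a @ z @ b} \<le>
    C * (measure \<nu> {x \<in> X. block x j (j + int (length (a @ z))) = a @ z} *
         measure \<nu> {x \<in> X. block x k (k + int (length (z @ b))) = z @ b})"
proof -
  obtain K where K: "K \<ge> 1" "\<And>v w. gibbs_weight (v @ w) \<le> K * (gibbs_weight v * gibbs_weight w)"
    "\<And>v w. v @ w \<in> language X \<Longrightarrow> gibbs_weight v * gibbs_weight w \<le> K * gibbs_weight (v @ w)"
    using gibbs_weight_estimates by blast
  obtain C where C: "C \<ge> 1"
    "\<And>i w. measure \<nu> {x \<in> X. block x i (i + int (length w)) = w} \<le> C * gibbs_weight w"
    "\<And>i w. gibbs_weight w \<le> C * measure \<nu> {x \<in> X. block x i (i + int (length w)) = w}"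
    using \<nu> unfolding gibbs_measure_def by blast
  show ?thesis
  proof (cases "z \<in> language X")
    case False
    have "measure \<nu> {x \<in> X. block x i (i + int (length (a @ z @ b))) = a @ z @ b} = 0" for a b i
    proof -
      have "a @ z @ b \<notin> language X" using False language_appendD by blast
      then have "{x \<in> X. block x i (i + int (length (a @ z @ b))) = a @ z @ b} = {}"
        by (rule no_block)
      then show ?thesis by (simp only: measure_empty)
    qed
    then show ?thesis
      by (intro exI[of _ 1] conjI allI zero_less_one) (simp only: mult_1 measure_nonneg mult_nonneg_nonneg)
  next
    case True
    define g where "g = gibbs_weight z"
    have g: "0 < g" using True by (simp add: g_def)
    define D where "D = C * K\<^sup>2 / g * C\<^sup>2"
    have D: "0 < D" using C(1) K(1) g by (simp add: D_def)
    have "measure \<nu> {x \<in> X. block x i (i + int (length (a @ z @ b))) = a @ z @ b} \<le>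
      D * (measure \<nu> {x \<in> X. block x j (j + int (length (a @ z))) = a @ z} *
         measure \<nu> {x \<in> X. block x k (k + int (length (z @ b))) = z @ b})" for a b i j k
    proof (cases "a @ z @ b \<in> language X")
      case False
      then have "{x \<in> X. block x i (i + int (length (a @ z @ b))) = a @ z @ b} = {}"
        by (rule no_block)
      then have "measure \<nu> {x \<in> X. block x i (i + int (length (a @ z @ b))) = a @ z @ b} = 0"
        by (simp only: measure_empty)
      then show ?thesis using D by (simp only: mult_nonneg_nonneg less_imp_le measure_nonneg)
    next
      case True
      then have zb: "z @ b \<in> language X" using language_appendD by blast
      have "gibbs_weight b * g \<le> K * gibbs_weight (z @ b)"
        using K(3)[OF zb] by (simp add: g_def mult.commute)
      then have b: "gibbs_weight b \<le> K * gibbs_weight (z @ b) / g" using g by (simp add: field_simps)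
      have "measure \<nu> {x \<in> X. block x i (i + int (length (a @ z @ b))) = a @ z @ b} \<le> C * gibbs_weight ((a @ z) @ b)"
        using C(2)[of i "a @ z @ b"] by simp
      also have "\<dots> \<le> C * (K * (gibbs_weight (a @ z) * gibbs_weight b))"
        using C(1) by (intro mult_left_mono K(2)) auto
      also have "\<dots> \<le> C * (K * (gibbs_weight (a @ z) * (K * gibbs_weight (z @ b) / g)))"
        using C(1) K(1) b by (intro mult_left_mono) auto
      also have "\<dots> = C * K\<^sup>2 / g * (gibbs_weight (a @ z) * gibbs_weight (z @ b))"
        by (simp add: power2_eq_square)
      also have "\<dots> \<le> C * K\<^sup>2 / g *
          ((C * measure \<nu> {x \<in> X. block x j (j + int (length (a @ z))) = a @ z}) *
           (C * measure \<nu> {x \<in> X. block x k (k + int (length (z @ b))) = z @ b}))"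
        using C(1) K(1) g by (intro mult_left_mono mult_mono C(3)) auto
      finally show ?thesis by (simp add: D_def power2_eq_square mult_ac)
    qed
    with D show ?thesis by blast
  qed
qed

text \<open>Whatever word has been read, specification and the Gibbs bounds give conditional
  probability at least d that \<open>s\<close> ends the next \<open>t + length s\<close> letters.
  Avoiding this in k successive stretches has probability at most (1 - d)^k.\<close>

lemma gibbs_measure_recurrent:
  assumes \<nu>: "gibbs_measure \<nu>" and s: "s \<in> language X"
    and B: "B \<in> sets (Borel_on X)"
      "\<And>x i. x \<in> B \<Longrightarrow> i \<le> 0 \<Longrightarrow> block x (i - int (length s)) i \<noteq> s"
  shows "measure \<nu> B = 0"
proof -
  have inv: "invariant_measure X \<nu>" using \<nu> by (simp add: gibbs_measure_def)
  interpret prob_space \<nu> using inv by (simp add: invariant_measure_def)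
  interpret invariant_prob X \<nu> by unfold_locales (fact inv)
  obtain K t where K: "K \<ge> 1"
    "\<And>v w. gibbs_weight v * gibbs_weight w \<le> K * (\<Sum>u\<in>words t. gibbs_weight (v @ u @ w))"
    using gibbs_weight_estimates by blast
  obtain C where C: "C \<ge> 1"
    "\<And>i w. prob {x \<in> X. block x i (i + int (length w)) = w} \<le> C * gibbs_weight w"
    "\<And>i w. gibbs_weight w \<le> C * prob {x \<in> X. block x i (i + int (length w)) = w}"
    using \<nu> unfolding gibbs_measure_def by blast
  define p where "p w = prob {x \<in> X. block x 0 (int (length w)) = w}" for w
  have p0: "0 \<le> p w" for w by (simp add: p_def)
  have p_words: "prob {x \<in> X. block x 0 (int n) = w} = p w" if "length w = n" for n w
    using that by (simp add: p_def)
  have p_append: "(\<Sum>v\<in>words n. p (w @ v)) = p w" for w n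
  proof -
    let ?m = "length w"
    have "p w = prob {x \<in> X. block x 0 (int (?m + n)) \<in> (\<lambda>v. w @ v) ` words n}"
    proof -
      have "block x 0 (int ?m) = w \<longleftrightarrow> block x 0 (int (?m + n)) \<in> (\<lambda>v. w @ v) ` words n" for x :: "int \<Rightarrow> 'a"
      proof -
        have app: "block x 0 (int (?m + n)) = block x 0 (int ?m) @ block x (int ?m) (int (?m + n))"
          by (simp add: block_append)
        show ?thesis unfolding app by (force simp: image_iff)
      qed
      then show ?thesis by (simp only: p_def)
    qed
    also have "\<dots> = (\<Sum>w'\<in>(\<lambda>v. w @ v) ` words n. p w')"
      by (subst prob_block_in) (rule sum.cong, auto simp: p_def)
    also have "\<dots> = (\<Sum>v\<in>words n. p (w @ v))"
      by (subst sum.reindex) (auto simp: inj_on_def)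
    finally show ?thesis ..
  qed
  define l where "l = t + length s"
  \<comment> \<open>The Gibbs comparison is used twice and specification once, hence
    \<open>C\<^sup>2 * K\<close>; the cap at 1 keeps \<open>1 - d\<close> nonnegative.\<close>
  define d where "d = min 1 (gibbs_weight s / (C\<^sup>2 * K))"
  have d: "0 < d" "d \<le> 1" using s C(1) K(1) by (auto simp: d_def)
  have hit: "d * p w \<le> (\<Sum>u\<in>words t. p (w @ u @ s))" for w
  proof -
    have "p w * gibbs_weight s \<le> C * gibbs_weight w * gibbs_weight s"
      using C(2)[of 0 w] by (intro mult_right_mono) (auto simp: p_def)
    also have "\<dots> \<le> C * (K * (\<Sum>u\<in>words t. gibbs_weight (w @ u @ s)))"
      unfolding mult.assoc using C(1) by (intro mult_left_mono K(2)) auto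
    also have "\<dots> \<le> C * (K * (\<Sum>u\<in>words t. C * p (w @ u @ s)))"
      using C(1) K(1) C(3)[of "w @ u @ s" 0 for u]
      by (intro mult_left_mono sum_mono) (auto simp: p_def)
    also have "\<dots> = C\<^sup>2 * K * (\<Sum>u\<in>words t. p (w @ u @ s))"
      by (simp add: sum_distrib_left power2_eq_square mult_ac)
    finally have "p w * (gibbs_weight s / (C\<^sup>2 * K)) \<le> (\<Sum>u\<in>words t. p (w @ u @ s))"
      using C(1) K(1) by (simp add: divide_simps mult_ac)
    moreover have "d * p w \<le> p w * (gibbs_weight s / (C\<^sup>2 * K))"
      unfolding mult.commute[of d] using p0 by (intro mult_left_mono) (auto simp: d_def)
    ultimately show ?thesis by linarith
  qed
  \<comment> \<open>Only occurrences at the very end of each stretch of \<open>l\<close> letters are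
    tested, so the condition on a new stretch involves its own letters alone.\<close>
  define avoid where "avoid k w \<longleftrightarrow> (\<forall>i<k. take (length s) (drop (i * l + t) w) \<noteq> s)" for k and w :: "'a list"
  have avoid_Suc: "avoid (Suc k) (w @ v) \<longleftrightarrow> avoid k w \<and> drop t v \<noteq> s"
    if "length w = k * l" "length v = l" for k w v
  proof -
    have "take (length s) (drop (i * l + t) (w @ v)) = take (length s) (drop (i * l + t) w)" if "i < k" for i
    proof -
      have "Suc i * l \<le> k * l" using that by (intro mult_right_mono) auto
      then show ?thesis using \<open>length w = k * l\<close> by (simp add: l_def)
    qed
    moreover have "take (length s) (drop (k * l + t) (w @ v)) = drop t v"
      using that by (simp add: l_def)
    ultimately show ?thesis
      by (auto simp: avoid_def less_Suc_eq simp del: drop_append take_append)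
  qed
  define A where "A k = (\<Sum>w\<in>words (k * l). if avoid k w then p w else 0)" for k
  have A_Suc: "A (Suc k) \<le> (1 - d) * A k" for k
  proof -
    have "A (Suc k) = (\<Sum>w\<in>words (k * l + l). if avoid (Suc k) w then p w else 0)"
      by (simp add: A_def add.commute)
    also have "\<dots> = (\<Sum>w\<in>words (k * l). \<Sum>v\<in>words l. if avoid k w \<and> drop t v \<noteq> s then p (w @ v) else 0)"
      unfolding sum_words_add by (intro sum.cong refl) (simp add: avoid_Suc)
    also have "\<dots> \<le> (\<Sum>w\<in>words (k * l). (1 - d) * (if avoid k w then p w else 0))"
    proof (rule sum_mono)
      fix w :: "'a list"
      have "(\<Sum>v\<in>words l. if drop t v \<noteq> s then p (w @ v) else 0) =
          (\<Sum>v\<in>words l. p (w @ v)) - (\<Sum>v\<in>words l. if drop t v = s then p (w @ v) else 0)"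
        unfolding sum_subtractf[symmetric] by (rule sum.cong) auto
      also have "(\<Sum>v\<in>words l. if drop t v = s then p (w @ v) else 0) =
          (\<Sum>u\<in>words t. \<Sum>z\<in>words (length s). if z = s then p (w @ u @ z) else 0)"
        unfolding l_def sum_words_add by (intro sum.cong refl) simp
      also have "\<dots> = (\<Sum>u\<in>words t. p (w @ u @ s))" by simp
      finally have "(\<Sum>v\<in>words l. if drop t v \<noteq> s then p (w @ v) else 0) \<le> (1 - d) * p w"
        using hit[of w] by (simp add: p_append algebra_simps)
      then show "(\<Sum>v\<in>words l. if avoid k w \<and> drop t v \<noteq> s then p (w @ v) else 0) \<le>
          (1 - d) * (if avoid k w then p w else 0)"
        by simp
    qed
    finally show ?thesis by (simp add: A_def sum_distrib_left)
  qed
  have A_le: "A k \<le> (1 - d) ^ k" for k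
  proof (induction k)
    case 0
    have "A 0 = (\<Sum>w\<in>words 0. if avoid 0 w then p w else 0)" unfolding A_def mult_0 ..
    also have "\<dots> = p []" unfolding words_0 by (simp add: avoid_def)
    also have "\<dots> \<le> 1" unfolding p_def by (rule prob_le_1)
    finally show ?case by simp
  next
    case (Suc k)
    have "A (Suc k) \<le> (1 - d) * A k" by (rule A_Suc)
    also have "\<dots> \<le> (1 - d) * (1 - d) ^ k" using Suc d by (intro mult_left_mono) auto
    finally show ?case by simp
  qed
  have "prob B \<le> (1 - d) ^ k" for k
  proof -
    have BX: "B \<subseteq> X" using B(1) sets.sets_into_space[of B "Borel_on X"] by simp
    have "avoid k (block x (- int (k * l)) 0)" if "x \<in> B" for x
      unfolding avoid_def
    proof (intro allI impI notI)
      fix i assume i: "i < k" "take (length s) (drop (i * l + t) (block x (- int (k * l)) 0)) = s"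
      have il: "Suc i * l \<le> k * l" using i(1) by (intro mult_right_mono) auto
      define m where "m = i * l + t"
      define e where "e = - int (k * l) + int m + int (length s)"
      have "m + length s \<le> k * l" using il by (simp add: m_def l_def)
      then have e0: "e \<le> 0" unfolding e_def by linarith
      have "block x (- int (k * l)) 0 = block x (- int (k * l)) (e - int (length s)) @
          block x (e - int (length s)) e @ block x e 0"
        using e0 block_append[of "e - int (length s)" e 0 x]
          block_append[of "- int (k * l)" "e - int (length s)" 0 x]
        by (simp add: e_def)
      moreover have "length (block x (- int (k * l)) (e - int (length s))) = i * l + t"
        by (simp add: e_def m_def[symmetric])
      ultimately have "take (length s) (drop (i * l + t) (block x (- int (k * l)) 0)) =
          block x (e - int (length s)) e"
        by simp
      then show False using B(2)[OF that e0] i(2) by simp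
    qed
    \<comment> \<open>Points of \<open>B\<close> carry no \<open>s\<close> to the left of coordinate
      0, so the stretches are laid out to end there; invariance then moves them to start at
      0.\<close>
    then have "B \<subseteq> {x \<in> X. block x (- int (k * l)) 0 \<in> {w. avoid k w}}" using BX by auto
    then have "prob B \<le> prob {x \<in> X. block x (- int (k * l)) 0 \<in> {w. avoid k w}}"
      by (rule finite_measure_mono[OF _ block_event(2)])
    also have "\<dots> = prob {x \<in> X. block x (- int (k * l) + int (k * l)) (0 + int (k * l)) \<in> {w. avoid k w}}"
      by (rule prob_block_translate[symmetric])
    also have "- int (k * l) + int (k * l) = 0" by simp
    also have "0 + int (k * l) = int (k * l)" by simp
    also have "prob {x \<in> X. block x 0 (int (k * l)) \<in> {w. avoid k w}} =
        (\<Sum>w\<in>{w. avoid k w} \<inter> words (k * l). p w)"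
      unfolding prob_block_in diff_zero nat_int
      by (rule sum.cong[OF refl], rule p_words) simp
    also have "\<dots> = A k"
      unfolding A_def Int_commute[of _ "words (k * l)"] by (simp only: sum.inter_restrict[OF finite_words] mem_Collect_eq)
    also have "\<dots> \<le> (1 - d) ^ k" by (rule A_le)
    finally show ?thesis .
  qed
  moreover have "(\<lambda>k. (1 - d) ^ k) \<longlonglongrightarrow> 0" using d by (intro LIMSEQ_power_zero) auto
  ultimately have "prob B \<le> 0" by (intro LIMSEQ_le_const) auto
  then show ?thesis using measure_nonneg[of \<nu> B] by linarith
qed

lemma finite_measure_bracket_product:
  assumes "rectangle X R" "finite_measure \<rho>" "sets \<rho> = sets (Borel_on R)"
  shows "finite_measure (bracket_product R \<rho>)"
    and "(\<lambda>(x, y). bracket y x) \<in> measurable (\<rho> \<Otimes>\<^sub>M \<rho>) (Borel_on R)"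
proof -
  have sp: "space \<rho> = R" using sets_eq_imp_space_eq[OF assms(3)] by simp
  have id: "(\<lambda>x. x) \<in> measurable \<rho> (Borel_on R)"
    using measurable_ident_sets[OF assms(3)] by simp
  show m: "(\<lambda>(x, y). bracket y x) \<in> measurable (\<rho> \<Otimes>\<^sub>M \<rho>) (Borel_on R)"
    unfolding case_prod_unfold
    by (rule measurable_bracket[OF measurable_compose[OF measurable_snd id] measurable_compose[OF measurable_fst id]])
      (use assms(1) in \<open>auto simp: space_pair_measure sp rectangle_def\<close>)
  have "finite_measure (\<rho> \<Otimes>\<^sub>M \<rho>)"
    by (rule finite_measure_pair_measure) fact+
  then show "finite_measure (bracket_product R \<rho>)"
    unfolding bracket_product_def by (rule finite_measure.finite_measure_distr[OF _ m])
qed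

text \<open>Pasts reading a z and futures reading z b have brackets in the cylinder of a z b, so its
  product mass is at least the product of their masses. With the quasi-product estimate this bounds
  \<open>\<nu>\<close> on windows by a multiple of the product; approximating \<open>B\<close> for
  both measures carries the null set over.\<close>

lemma gibbs_measure_past_cyl_product:
  assumes \<nu>: "gibbs_measure \<nu>" and z: "synchronizing z" "z \<noteq> []"
    and B: "B \<in> sets (Borel_on (past_cyl z))"
      "measure (bracket_product (past_cyl z) (restrict_space \<nu> (past_cyl z))) B = 0"
  shows "measure \<nu> B = 0"
proof -
  let ?R = "past_cyl z"
  let ?l = "1 - int (length z)"
  define \<rho> where "\<rho> = restrict_space \<nu> ?R"
  define m where "m = bracket_product ?R \<rho>"
  have inv: "invariant_measure X \<nu>" using \<nu> by (simp add: gibbs_measure_def)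
  interpret prob_space \<nu> using inv by (simp add: invariant_measure_def)
  interpret invariant_prob X \<nu> by unfold_locales (fact inv)
  have R_event: "?R \<in> events" unfolding past_cyl_def by (rule block_event(1))
  have RX: "?R \<subseteq> X" by (auto simp: past_cyl_def)
  have sets_\<rho>: "sets \<rho> = sets (Borel_on ?R)"
    unfolding \<rho>_def by (rule sets_restrict_Borel_on[OF RX sets_eq])
  have fin_\<rho>: "finite_measure \<rho>"
    unfolding \<rho>_def by (rule finite_measure_restrict_space[OF finite_measure_axioms]) (use R_event RX space_eq in auto)
  note rect = rectangle_past_cyl[OF z]
  note m_fin = finite_measure_bracket_product[OF rect fin_\<rho> sets_\<rho>]
  have sets_m: "sets m = sets (Borel_on ?R)" by (simp add: m_def bracket_product_def)
  have fin_m: "finite_measure m" unfolding m_def by (rule m_fin(1))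
  have meas_\<rho>: "measure \<rho> A = prob A" if "A \<subseteq> ?R" for A
    unfolding \<rho>_def by (rule measure_restrict_space) (use R_event that in auto)
  interpret \<rho>: finite_measure \<rho> by (rule fin_\<rho>)
  interpret m: finite_measure m by (rule fin_m)
  obtain C where C: "C > 0" "\<And>a b i j k.
    prob {x \<in> X. block x i (i + int (length (a @ z @ b))) = a @ z @ b} \<le>
    C * (prob {x \<in> X. block x j (j + int (length (a @ z))) = a @ z} *
         prob {x \<in> X. block x k (k + int (length (z @ b))) = z @ b})"
    using gibbs_measure_quasi_product[OF \<nu>, of z] by blast
  \<comment> \<open>\<open>length z \<le> n\<close> makes the window contain all coordinates of
    \<open>z\<close>; windows can be widened to this size.\<close>
  have cyl: "measure \<rho> {x \<in> ?R. block x (- int n) (int n) = w} \<le> C * measure m {x \<in> ?R. block x (- int n) (int n) = w}"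
    if n: "length z \<le> n" for n w
  proof (cases "{x \<in> ?R. block x (- int n) (int n) = w} = {}")
    case True
    then show ?thesis by (simp only: measure_empty mult_zero_right order_refl)
  next
    case False
    then obtain x0 where x0: "x0 \<in> ?R" "block x0 (- int n) (int n) = w" by auto
    define a b where "a = block x0 (- int n) ?l" and "b = block x0 1 (int n)"
    have n1: "1 \<le> int n" "- int n \<le> ?l" "?l \<le> 1" using n z(2) by (cases z; simp)+
    have w: "w = a @ z @ b"
      using x0 n1 block_append[of ?l 1 "int n" x0] block_append[of "- int n" ?l "int n" x0]
      by (simp add: a_def b_def past_cyl_def)
    have len: "- int n + int (length (a @ z)) = 1" "?l + int (length (z @ b)) = int n"
      "- int n + int (length (a @ z @ b)) = int n"
      using n1 by (simp_all add: a_def b_def)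
    let ?P = "{x \<in> X. block x (- int n) 1 = a @ z}" and ?F = "{x \<in> X. block x ?l (int n) = z @ b}"
    have PR: "?P \<subseteq> ?R"
      using n1 by (auto simp: past_cyl_def block_eq_append_iff a_def)
    have FR: "?F \<subseteq> ?R"
      using n1 by (auto simp: past_cyl_def block_eq_append_iff)
    have "measure \<rho> {x \<in> ?R. block x (- int n) (int n) = w} = prob {x \<in> ?R. block x (- int n) (int n) = w}"
      by (rule meas_\<rho>) auto
    also have "\<dots> \<le> prob {x \<in> X. block x (- int n) (int n) = w}"
      using RX by (intro finite_measure_mono block_event) auto
    also have "\<dots> \<le> C * (prob ?P * prob ?F)"
      using C(2)[of "- int n" a b "- int n" ?l, unfolded len] by (simp only: w)
    also have "prob ?P * prob ?F = measure \<rho> ?F * measure \<rho> ?P"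
      using meas_\<rho>[OF PR] meas_\<rho>[OF FR] by simp
    also have "\<dots> = measure (\<rho> \<Otimes>\<^sub>M \<rho>) (?F \<times> ?P)"
    proof -
      have eq: "?P = {x \<in> ?R. block x (- int n) 1 = a @ z}" "?F = {x \<in> ?R. block x ?l (int n) = z @ b}"
        using PR FR RX by blast+
      have "?P \<in> sets \<rho>" "?F \<in> sets \<rho>"
        unfolding sets_\<rho> eq by (rule sets_Borel_on_block)+
      then show ?thesis
        by (simp add: measure_def \<rho>.emeasure_pair_measure_Times enn2real_mult)
    qed
    also have "\<dots> \<le> measure (\<rho> \<Otimes>\<^sub>M \<rho>) ((\<lambda>(x, y). bracket y x) -` {x \<in> ?R. block x (- int n) (int n) = w} \<inter> space (\<rho> \<Otimes>\<^sub>M \<rho>))"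
    proof (rule finite_measure.finite_measure_mono[OF finite_measure_pair_measure[OF fin_\<rho> fin_\<rho>]])
      show "?F \<times> ?P \<subseteq> (\<lambda>(x, y). bracket y x) -` {x \<in> ?R. block x (- int n) (int n) = w} \<inter> space (\<rho> \<Otimes>\<^sub>M \<rho>)"
      proof clarify
        fix x y assume x: "x \<in> X" "block x ?l (int n) = z @ b" and y: "y \<in> X" "block y (- int n) 1 = a @ z"
        have xy: "x \<in> ?R" "y \<in> ?R" using x y PR FR by blast+
        have "block (bracket y x) (- int n) 1 = a @ z"
          unfolding y(2)[symmetric] by (auto simp: block_eq_iff bracket_def)
        moreover have "block (bracket y x) 1 (int n) = block x 1 (int n)"
          by (auto simp: block_eq_iff bracket_def)
        moreover have "block x 1 (int n) = b"
          using x(2) n1 by (auto simp: block_eq_append_iff)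
        ultimately have "block (bracket y x) (- int n) (int n) = w"
          using block_append[of "- int n" 1 "int n" "bracket y x"] n1 w by simp
        moreover have "bracket y x \<in> ?R" using rect xy by (auto simp: rectangle_def)
        moreover have "(x, y) \<in> space (\<rho> \<Otimes>\<^sub>M \<rho>)"
          using xy sets_eq_imp_space_eq[OF sets_\<rho>] by (simp add: space_pair_measure)
        ultimately show "(x, y) \<in> (\<lambda>(x, y). bracket y x) -` {x \<in> ?R. block x (- int n) (int n) = w} \<inter> space (\<rho> \<Otimes>\<^sub>M \<rho>)"
          by simp
      qed
      show "(\<lambda>(x, y). bracket y x) -` {x \<in> ?R. block x (- int n) (int n) = w} \<inter> space (\<rho> \<Otimes>\<^sub>M \<rho>) \<in> sets (\<rho> \<Otimes>\<^sub>M \<rho>)"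
        by (rule measurable_sets[OF m_fin(2) sets_Borel_on_block])
    qed
    also have "\<dots> = measure m {x \<in> ?R. block x (- int n) (int n) = w}"
      unfolding m_def bracket_product_def
      by (rule measure_distr[symmetric, OF m_fin(2)]) (rule sets_Borel_on_block)
    finally show ?thesis using C(1) by simp
  qed
  have win: "measure \<rho> (window ?R n W) \<le> C * measure m (window ?R n W)" if n: "length z \<le> n" for n W
  proof -
    have sum: "measure M (window ?R n W) = (\<Sum>w\<in>W \<inter> words (2 * n). measure M {x \<in> ?R. block x (- int n) (int n) = w})"
      if "finite_measure M" "sets M = sets (Borel_on ?R)" for M
    proof -
      have "window ?R n W = (\<Union>w\<in>W \<inter> words (2 * n). {x \<in> ?R. block x (- int n) (int n) = w})"
        by (auto simp: window_def)
      moreover have "measure M \<dots> = (\<Sum>w\<in>W \<inter> words (2 * n). measure M {x \<in> ?R. block x (- int n) (int n) = w})"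
        using that sets_Borel_on_block
        by (intro finite_measure.finite_measure_finite_Union) (auto simp: disjoint_family_on_def)
      ultimately show ?thesis by (simp only:)
    qed
    show ?thesis
      unfolding sum[OF fin_\<rho> sets_\<rho>] sum[OF fin_m sets_m] sum_distrib_left
      by (intro sum_mono cyl n)
  qed
  \<comment> \<open>One \<open>e\<close> is the mass of the symmetric difference under
    \<open>\<rho>\<close>; \<open>C * e\<close> dominates the mass of the window, whose product mass
    is small because \<open>B\<close> is null for the product.\<close>
  have le: "prob B \<le> (C + 1) * e" if e: "e > 0" for e
  proof -
    obtain n0 W0 where W0: "measure \<rho> (B - window ?R n0 W0 \<union> (window ?R n0 W0 - B)) < e"
      "measure m (B - window ?R n0 W0 \<union> (window ?R n0 W0 - B)) < e"
      using window_approx[OF fin_\<rho> sets_\<rho> fin_m sets_m B(1) e] by blast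
    obtain W where W: "window ?R n0 W0 = window ?R (max n0 (length z)) W"
      using window_extend[of n0 "max n0 (length z)" ?R W0] by auto
    define E where "E = window ?R n0 W0"
    have E: "E \<in> sets (Borel_on ?R)" unfolding E_def window_def by (rule sets_Borel_on_block_in)
    have "prob B = measure \<rho> B" using B(1) sets.sets_into_space[OF B(1)] by (intro meas_\<rho>[symmetric]) simp
    also have "\<dots> \<le> measure \<rho> (E \<union> (B - E \<union> (E - B)))"
      using E B(1) sets_\<rho> by (intro \<rho>.finite_measure_mono) auto
    also have "\<dots> \<le> measure \<rho> E + measure \<rho> (B - E \<union> (E - B))"
      using E B(1) sets_\<rho> by (intro measure_Un_le) auto
    also have "measure \<rho> (B - E \<union> (E - B)) \<le> e" using W0(1) by (simp add: E_def)
    also have "measure \<rho> E \<le> C * measure m E"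
      unfolding E_def W by (rule win) simp
    also have "measure m E \<le> measure m (B \<union> (B - E \<union> (E - B)))"
      using E B(1) sets_m by (intro m.finite_measure_mono) auto
    also have "\<dots> \<le> measure m B + measure m (B - E \<union> (E - B))"
      using E B(1) sets_m by (intro measure_Un_le) auto
    also have "\<dots> \<le> e" using W0(2) B(2) by (simp add: E_def m_def \<rho>_def)
    finally show ?thesis using C(1) by (simp add: algebra_simps)
  qed
  have "prob B \<le> 0"
  proof (rule field_le_epsilon)
    fix e :: real assume "e > 0"
    then show "prob B \<le> 0 + e" using le[of "e / (C + 1)"] C(1) by simp
  qed
  then show ?thesis using measure_nonneg[of \<nu> B] by linarith
qed

end

theorem theorem1:
  fixes X :: "(int \<Rightarrow> 'a::finite) set"
    and \<phi> :: "(int \<Rightarrow> 'a) \<Rightarrow> real"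
    and \<mu> :: "(int \<Rightarrow> 'a) measure"
  assumes "shift_space X"
    and "specification_property X"
    and "continuous_map (subtopology shift_topology X) euclideanreal \<phi>"
    and "walters_property X \<phi>"
    and "equilibrium_measure X \<phi> \<mu>"
  shows "local_product_structure X \<mu>"
proof -
  interpret spec_potential X \<phi>
    using assms by unfold_locales
  have meas: "\<phi> \<in> borel_measurable (Borel_on X)"
    by (rule continuous_map_borel_measurable[OF assms(3)])
  obtain \<nu> where \<nu>: "gibbs_measure \<nu>" using gibbs_measure_exists by blast
  have inv: "invariant_measure X \<mu>" "invariant_measure X \<nu>"
    using assms(5) \<nu> by (simp_all add: equilibrium_measure_def gibbs_measure_def)
  interpret M: prob_space \<mu> using inv(1) by (simp add: invariant_measure_def)
  interpret M: invariant_prob X \<mu> by unfold_locales (fact inv)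
  interpret N: prob_space \<nu> using inv(2) by (simp add: invariant_measure_def)
  interpret N: invariant_prob X \<nu> by unfold_locales (fact inv)
  note ac = equilibrium_absolutely_continuous[OF \<nu> assms(5) meas]
  obtain s where s: "s \<in> language X" "synchronizing s"
    using synchronizing_exists[OF assms(2)] by blast
  \<comment> \<open>An enumeration of all words made of \<open>s\<close> and a nonempty tail, the
    pair type encoding nonemptiness. An occurrence of \<open>s\<close> to the left of coordinate 0
    always leaves at least the letter at 0 as a tail.\<close>
  define z :: "nat \<Rightarrow> 'a list" where "z n = s @ fst (from_nat n :: 'a \<times> 'a list) # snd (from_nat n :: 'a \<times> 'a list)" for n
  have z: "synchronizing (z n)" "z n \<noteq> []" for n
    unfolding z_def by (rule synchronizing_append[OF s(2)]) simp
  define R where "R n = past_cyl (z n)" for n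
  \<comment> \<open>The product measures are made from the marginals of \<open>\<nu>\<close>, for
    which the quasi-product estimate is available; \<open>\<mu>\<close> is reached through its
    absolute continuity.\<close>
  define m where "m n = bracket_product (R n) (restrict_space \<nu> (R n))" for n
  have RX: "R n \<subseteq> X" for n by (auto simp: R_def past_cyl_def)
  have R_sets: "R n \<in> sets (Borel_on X)" for n
    unfolding R_def past_cyl_def by (rule sets_Borel_on_block)
  have sets_R: "sets (restrict_space \<kappa> (R n)) = sets (Borel_on (R n))"
    if "sets \<kappa> = sets (Borel_on X)" for \<kappa> n
    by (rule sets_restrict_Borel_on[OF RX that])
  have rect: "rectangle X (R n)" for n unfolding R_def by (rule rectangle_past_cyl[OF z])
  have prod: "product_measure_on (R n) (m n)" for n
    unfolding m_def
  proof (rule product_measure_on_bracket_product[OF rect _ sets_R[OF N.sets_eq]])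
    show "finite_measure (restrict_space \<nu> (R n))"
      by (rule finite_measure_restrict_space[OF N.finite_measure_axioms])
        (use R_sets RX N.sets_eq N.space_eq in auto)
  qed
  have "absolutely_continuous (m n) (restrict_space \<mu> (R n))" for n
    unfolding absolutely_continuous_def
  proof
    fix B assume "B \<in> null_sets (m n)"
    then have B: "B \<in> sets (Borel_on (R n))" "measure (m n) B = 0"
      by (auto simp: m_def bracket_product_def measure_def)
    then have "measure \<nu> B = 0"
      using gibbs_measure_past_cyl_product[OF \<nu> z] unfolding m_def R_def by blast
    moreover have "B \<in> sets (Borel_on X)"
    proof -
      have "B \<in> sets (restrict_space \<mu> (R n))" using B(1) sets_R[OF M.sets_eq] by simp
      then obtain A where "A \<in> sets \<mu>" "B = R n \<inter> A" by (auto simp: sets_restrict_space)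
      then show ?thesis using R_sets[of n] M.sets_eq by auto
    qed
    ultimately have "measure \<mu> B = 0" using ac by blast
    moreover have "B \<subseteq> R n" using sets.sets_into_space[OF B(1)] by simp
    ultimately have "emeasure (restrict_space \<mu> (R n)) B = 0"
      using R_sets[of n] M.sets_eq by (subst emeasure_restrict_space) (auto simp: M.emeasure_eq_measure)
    then show "B \<in> null_sets (restrict_space \<mu> (R n))"
      using B(1) sets_R[OF M.sets_eq] by (intro null_setsI) auto
  qed
  moreover have "emeasure \<mu> (\<Union>n. R n) = 1"
  proof -
    \<comment> \<open>A point outside all rectangles has no \<open>s\<close> in its past: an
      occurrence together with the letters up to 0 would be some \<open>z n\<close>.\<close>
    let ?B = "X - (\<Union>n. R n)"
    have U: "(\<Union>n. R n) \<in> sets (Borel_on X)" using R_sets by auto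
    have X: "X \<in> sets (Borel_on X)" using sets.top[of "Borel_on X"] by simp
    have B: "?B \<in> sets (Borel_on X)" by (rule sets.Diff[OF X U])
    have "block x (i - int (length s)) i \<noteq> s" if x: "x \<in> ?B" and i: "i \<le> 0" for x i
    proof
      assume eq: "block x (i - int (length s)) i = s"
      define r where "r = block x i 1"
      have "r \<noteq> []" using i by (auto simp: r_def dest: arg_cong[of _ _ length])
      then obtain a r' where r': "r = a # r'" by (cases r) auto
      obtain n where n: "from_nat n = (a, r')" using surj_from_nat by (metis surjD)
      have zn: "z n = s @ r" by (simp add: z_def n r')
      have "block x (i - int (length s)) 1 = z n"
        using eq i block_append[of "i - int (length s)" i 1 x] by (simp add: zn r_def)
      moreover have "1 - int (length (z n)) = i - int (length s)"
        using i by (simp add: zn r_def)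
      ultimately have "x \<in> R n" using x by (simp add: R_def past_cyl_def)
      then show False using x by blast
    qed
    then have "measure \<nu> ?B = 0" by (rule gibbs_measure_recurrent[OF \<nu> s(1) B])
    then have "measure \<mu> ?B = 0" by (rule ac[OF B])
    moreover have "measure \<mu> ?B = 1 - measure \<mu> (\<Union>n. R n)"
      using M.prob_compl[of "\<Union>n. R n"] U M.sets_eq M.space_eq by simp
    ultimately show ?thesis by (simp add: M.emeasure_eq_measure)
  qed
  ultimately show ?thesis
    unfolding local_product_structure_def
    using rect prod R_sets M.sets_eq by (intro exI[of _ R] exI[of _ m]) auto
qed

end
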